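(* Let $\mathcal{B}$ be the set of suitably labelled planar maps and $\mathcal{H}$ the set of well-labelled planar hypermaps. For $B\in\mathcal{B}$, let $\Phi(B)$ be obtained as follows: place a new (black) vertex $v_f$ inside each face $f$ of $B$; in each face $f$, traversing its contour clockwise, for each descending edge (an edge traversed from a corner of a vertex $u$ to a vertex $v$ with $\ell(v)=\ell(u)-1$) insert a new edge from $v_f$ to that corner of $u$; then erase all local min vertices of $B$ and all edges of $B$. Then the resulting figure is the star-representation of a well-labelled hypermap $\Phi(B)\in\mathcal{H}$ (keeping the labels of the remaining vertices), and $\Phi:\mathcal{B}\to\mathcal{H}$ is a bijection. Its inverse $\Psi$ is given, for $H\in\mathcal{H}$ with star-representation $S$, as follows: inside each face $f$ of $S$ (equivalently each light face of $H$) insert a new vertex $v_f$ of label $\min(f)-1$; for each corner $c$ of $f$ at a labelled (white) vertex $v$, insert an edge starting in $c$ which goes to the next corner of label $\ell(v)-1$ after $c$ in counterclockwise order around $f$ if $\ell(v)>\min(f)$, and to $v_f$ if $\ell(v)=\min(f)$; finally delete all black vertices and all edges of $S$. Moreover, for $B\in\mathcal{B}$ and $H=\Phi(B)$: each vertex $v$ of $H$ corresponds to a vertex $v'$ of $B$ that is not a local min and has the same label, and $v$ is a right local max in $H$ if and only if $v'$ is a local max in $B$; each light face $f$ of $H$ corresponds to a local min vertex of $B$ of label $\min(f)-1$; and each dark face of $H$ of cw-type $\tau$ corresponds to a face of $B$ of cw-type $c^{\downarrow}(\tau)$.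
   Context: All maps are planar: connected graphs (loops and multiple edges allowed) embedded in the sphere, considered up to orientation-preserving homeomorphism. A suitably labelled map is a map $B$ with a labelling $\ell:V(B)\to\mathbb{Z}$ such that $|\ell(u)-\ell(v)|=1$ for every edge $\{u,v\}$. A local max (resp. local min) of $B$ is a vertex all of whose neighbours have smaller (resp. greater) label. The cw-type (resp. ccw-type) of a face is the cyclic list of labels of the vertices met in clockwise (resp. counterclockwise) order around the face. A hypermap is a map all of whose vertices have even degree, together with a proper bicolouring of its faces into dark and light faces (every edge has a dark face on one side and a light face on the other). Its star-representation is the bipartite map obtained by replacing the contour of each dark face of degree $d$ by a star of degree $d$ centred at a new black vertex placed inside that face; the faces of the star-representation identify with the light faces of the hypermap. A well-labelled hypermap is a hypermap $H$ with labels $\ell:V(H)\to\mathbb{Z}$ such that for any edge $\{v,u\}$, with the dark face incident to it on the right when traversed from $v$ to $u$, $\ell(u)\ge \ell(v)-1$. A right neighbour of a vertex $u$ is a vertex $v$ adjacent to $u$ such that the edge traversed from $v$ to $u$ has a dark face on its right; $u$ is a right local max (resp. right local min) if every right neighbour $v$ satisfies $\ell(v)\le\ell(u)$ (resp. $\ell(v)\ge \ell(u)$). The cw-type of a dark face is the cyclic list of labels of its vertices in clockwise order. For a light face $f$, $\min(f)$ and $\max(f)$ denote the minimal and maximal labels of the vertices incident to $f$. A Łukasiewicz cyclic sequence is a cyclic integer sequence in which each element minus the preceding one is at least $-1$. For such $\tau$, the lower completion $c^{\downarrow}(\tau)$ is obtained by inserting the sequence $i-1,i,\ldots,j-1$ between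 any two consecutive elements $i,j$ with $j\ge i$; the upper completion $c^{\uparrow}(\tau)$ is obtained by inserting $i+1,\ldots,j+1$ between any two consecutive elements $i,j$ with $j\ge i$. *)

theory Defs
  imports Main "HOL-Combinatorics.Orbits"
begin

section \<open>Maps on the sphere\<close>

text \<open>
  Maps are encoded by their rotation systems. A dart is an edge together with a direction, seen as
  a half-edge at its origin; \<open>rot\<close> sends a dart to the next one in counterclockwise order around
  the origin, and \<open>opp\<close> reverses a dart. Two maps on the sphere are related by an
  orientation-preserving homeomorphism iff their rotation systems are isomorphic.
  The map without edges has no darts and is excluded.

  A label on the vertices is a function on darts that only depends on the origin of the dart.
  The label type is a parameter because some vertices of the auxiliary figures are unlabelled.
\<close>

record ('d, 'l) lmap =
  darts :: "'d set"
  rot :: "'d \<Rightarrow> 'd"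
  opp :: "'d \<Rightarrow> 'd"
  lab :: "'d \<Rightarrow> 'l"

text \<open>
  \<open>cw M d\<close> is the dart that follows \<open>d\<close> on the contour of the face to the right of \<open>d\<close>, which is
  hence traversed clockwise. A face is represented by the set of darts that have it on their right;
  its corners are the gaps between \<open>inv rot d\<close> and \<open>d\<close>, for \<open>d\<close> in that set.
\<close>

definition cw :: "('d, 'l, 'z) lmap_scheme \<Rightarrow> 'd \<Rightarrow> 'd" where
  "cw M d = rot M (opp M d)"

definition vertices :: "('d, 'l, 'z) lmap_scheme \<Rightarrow> 'd set set" where
  "vertices M = (\<lambda>d. orbit (rot M) d) ` darts M"

definition edges :: "('d, 'l, 'z) lmap_scheme \<Rightarrow> 'd set set" where
  "edges M = (\<lambda>d. {d, opp M d}) ` darts M"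

definition right_face :: "('d, 'l, 'z) lmap_scheme \<Rightarrow> 'd \<Rightarrow> 'd set" where
  "right_face M d = orbit (cw M) d"

definition faces :: "('d, 'l, 'z) lmap_scheme \<Rightarrow> 'd set set" where
  "faces M = right_face M ` darts M"

definition connected_map :: "('d, 'l, 'z) lmap_scheme \<Rightarrow> bool" where
  "connected_map M \<longleftrightarrow>
     (\<forall>d\<in>darts M. \<forall>e\<in>darts M.
        (d, e) \<in> {(x, y). x \<in> darts M \<and> (y = rot M x \<or> y = opp M x)}\<^sup>*)"

text \<open>Being embedded in the sphere is expressed by Euler's relation.\<close>

definition planar_map :: "('d, 'l, 'z) lmap_scheme \<Rightarrow> bool" where
  "planar_map M \<longleftrightarrow>
     finite (darts M) \<and> darts M \<noteq> {} \<and>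
     bij_betw (rot M) (darts M) (darts M) \<and>
     (\<forall>d\<in>darts M. opp M d \<in> darts M \<and> opp M d \<noteq> d \<and> opp M (opp M d) = d) \<and>
     (\<forall>d\<in>darts M. lab M (rot M d) = lab M d) \<and>
     connected_map M \<and>
     card (vertices M) + card (faces M) = card (edges M) + 2"

definition lmap_iso ::
    "('d \<Rightarrow> 'e) \<Rightarrow> ('d, 'l, 'y) lmap_scheme \<Rightarrow> ('e, 'l, 'z) lmap_scheme \<Rightarrow> bool" where
  "lmap_iso g M N \<longleftrightarrow>
     bij_betw g (darts M) (darts N) \<and>
     (\<forall>d\<in>darts M. g (rot M d) = rot N (g d) \<and> g (opp M d) = opp N (g d) \<and> lab N (g d) = lab M d)"

definition lmap_isomorphic ::
    "('d, 'l, 'y) lmap_scheme \<Rightarrow> ('e, 'l, 'z) lmap_scheme \<Rightarrow> bool" where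
  "lmap_isomorphic M N \<longleftrightarrow> (\<exists>g. lmap_iso g M N)"

definition vlab :: "('d, 'l, 'z) lmap_scheme \<Rightarrow> 'd set \<Rightarrow> 'l" where
  "vlab M v = the_elem (lab M ` v)"

definition neighbour :: "('d, 'l, 'z) lmap_scheme \<Rightarrow> 'd set \<Rightarrow> 'd set \<Rightarrow> bool" where
  "neighbour M u v \<longleftrightarrow> v \<in> vertices M \<and> (\<exists>d\<in>u. opp M d \<in> v)"

definition local_max :: "('d, int, 'z) lmap_scheme \<Rightarrow> 'd set \<Rightarrow> bool" where
  "local_max M u \<longleftrightarrow> (\<forall>v. neighbour M u v \<longrightarrow> vlab M v < vlab M u)"

definition local_min :: "('d, int, 'z) lmap_scheme \<Rightarrow> 'd set \<Rightarrow> bool" where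
  "local_min M u \<longleftrightarrow> (\<forall>v. neighbour M u v \<longrightarrow> vlab M v > vlab M u)"

text \<open>A cyclic list is represented by the set of all its linear readings.\<close>

definition cw_type :: "('d, 'l, 'z) lmap_scheme \<Rightarrow> 'd set \<Rightarrow> 'l list set" where
  "cw_type M f = (\<lambda>d. map (\<lambda>k. lab M ((cw M ^^ k) d)) [0..<card f]) ` f"

definition suitably_labelled :: "('d, int, 'z) lmap_scheme \<Rightarrow> bool" where
  "suitably_labelled B \<longleftrightarrow>
     planar_map B \<and> (\<forall>d\<in>darts B. \<bar>lab B d - lab B (opp B d)\<bar> = 1)"


section \<open>Hypermaps\<close>

record 'd hmap = "('d, int) lmap" +
  dark :: "'d set set"

definition light_faces :: "'d hmap \<Rightarrow> 'd set set" where
  "light_faces H = faces H - dark H"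

definition hypermap :: "'d hmap \<Rightarrow> bool" where
  "hypermap H \<longleftrightarrow>
     planar_map H \<and>
     (\<forall>v\<in>vertices H. even (card v)) \<and>
     dark H \<subseteq> faces H \<and>
     (\<forall>d\<in>darts H. right_face H d \<in> dark H \<longleftrightarrow> right_face H (opp H d) \<in> light_faces H)"

definition well_labelled :: "'d hmap \<Rightarrow> bool" where
  "well_labelled H \<longleftrightarrow>
     hypermap H \<and>
     (\<forall>d\<in>darts H. right_face H d \<in> dark H \<longrightarrow> lab H (opp H d) \<ge> lab H d - 1)"

definition right_neighbour :: "'d hmap \<Rightarrow> 'd set \<Rightarrow> 'd set \<Rightarrow> bool" where
  "right_neighbour H u v \<longleftrightarrow>
     v \<in> vertices H \<and> (\<exists>d\<in>v. opp H d \<in> u \<and> right_face H d \<in> dark H)"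

definition right_local_max :: "'d hmap \<Rightarrow> 'd set \<Rightarrow> bool" where
  "right_local_max H u \<longleftrightarrow> (\<forall>v. right_neighbour H u v \<longrightarrow> vlab H v \<le> vlab H u)"

definition face_min :: "'d hmap \<Rightarrow> 'd set \<Rightarrow> int" where
  "face_min H f = Min (lab H ` f)"

definition hmap_isomorphic :: "'d hmap \<Rightarrow> 'e hmap \<Rightarrow> bool" where
  "hmap_isomorphic H H' \<longleftrightarrow> (\<exists>g. lmap_iso g H H' \<and> (\<lambda>f. g ` f) ` dark H = dark H')"


section \<open>Drawing and erasing\<close>

text \<open>The next element of \<open>A\<close> strictly after \<open>x\<close> along the cycle of \<open>f\<close> through \<open>x\<close>.\<close>

definition next_in :: "('a \<Rightarrow> 'a) \<Rightarrow> 'a set \<Rightarrow> 'a \<Rightarrow> 'a" where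
  "next_in f A x = (f ^^ (LEAST k. 0 < k \<and> (f ^^ k) x \<in> A)) x"

text \<open>
  Erasing the edges formed by the darts in \<open>X\<close> (a set closed under \<open>opp\<close>), together with the vertices
  that become isolated.
\<close>

definition erase :: "'d set \<Rightarrow> ('d, 'l) lmap \<Rightarrow> ('d, 'l) lmap" where
  "erase X M =
     \<lparr>darts = darts M - X, rot = next_in (rot M) (darts M - X), opp = opp M, lab = lab M\<rparr>"

text \<open>
  \<open>add_stars A M\<close>: in each face \<open>f\<close> of \<open>M\<close>, a black vertex is inserted and joined by an edge
  to the corner at the origin of \<open>d\<close>, for each dart \<open>d\<close> of \<open>A\<close> on the clockwise contour of \<open>f\<close>.
  The half-edge \<open>White d\<close> of the new edge comes just before \<open>d\<close> in counterclockwise order, and the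
  half-edges \<open>Black d\<close> are in counterclockwise order around the black vertex. Black vertices carry
  the label \<open>None\<close>.
\<close>

datatype 'd starred = Old 'd | White 'd | Black 'd

definition add_stars :: "'d set \<Rightarrow> ('d, 'l, 'z) lmap_scheme \<Rightarrow> ('d starred, 'l option) lmap" where
  "add_stars A M =
     \<lparr>darts = Old ` darts M \<union> White ` A \<union> Black ` A,
      rot = (\<lambda>x. case x of
               Old d \<Rightarrow> (if rot M d \<in> A then White (rot M d) else Old (rot M d))
             | White d \<Rightarrow> Old d
             | Black d \<Rightarrow> Black (next_in (inv_into (darts M) (cw M)) A d)),
      opp = (\<lambda>x. case x of Old d \<Rightarrow> Old (opp M d) | White d \<Rightarrow> Black d | Black d \<Rightarrow> White d),
      lab = (\<lambda>x. case x of
               Old d \<Rightarrow> Some (lab M d) | White d \<Rightarrow> Some (lab M d) | Black d \<Rightarrow> None)\<rparr>"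

definition star_rep :: "'d hmap \<Rightarrow> ('d starred, int option) lmap" where
  "star_rep H = erase (range Old) (add_stars {d \<in> darts H. right_face H d \<in> dark H} H)"


section \<open>The mapping from suitably labelled maps to well-labelled hypermaps\<close>

definition descending :: "('d, int, 'z) lmap_scheme \<Rightarrow> 'd set" where
  "descending B = {d \<in> darts B. lab B (opp B d) = lab B d - 1}"

text \<open>
  No descending dart starts at a local min vertex, so these vertices disappear when the edges of
  \<open>B\<close> are erased.
\<close>

definition Phi_figure :: "('d, int) lmap \<Rightarrow> ('d starred, int option) lmap" where
  "Phi_figure B = erase (range Old) (add_stars (descending B) B)"


section \<open>The mapping from well-labelled hypermaps to suitably labelled maps\<close>

text \<open>
  The corners of a star-representation \<open>S\<close> at white vertices are indexed by the darts \<open>s\<close> with white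
  origin: \<open>s\<close> stands for the corner on its left, between \<open>s\<close> and \<open>rot S s\<close>. \<open>ccw S s\<close> follows \<open>s\<close>
  on the contour of the face to the left of \<open>s\<close>, which is hence traversed counterclockwise.
\<close>

definition ccw :: "('d, 'l, 'z) lmap_scheme \<Rightarrow> 'd \<Rightarrow> 'd" where
  "ccw S s = inv_into (darts S) (rot S) (opp S s)"

definition white :: "('d, int option) lmap \<Rightarrow> 'd set" where
  "white S = {s \<in> darts S. lab S s \<noteq> None}"

definition wlab :: "('d, int option) lmap \<Rightarrow> 'd \<Rightarrow> int" where
  "wlab S s = the (lab S s)"

definition corner_min :: "('d, int option) lmap \<Rightarrow> 'd \<Rightarrow> int" where
  "corner_min S s = Min (wlab S ` (orbit (ccw S) s \<inter> white S))"

definition min_corners :: "('d, int option) lmap \<Rightarrow> 'd set" where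
  "min_corners S = {s \<in> white S. wlab S s = corner_min S s}"

definition successor :: "('d, int option) lmap \<Rightarrow> 'd \<Rightarrow> 'd" where
  "successor S s = next_in (ccw S) {t \<in> white S. wlab S t = wlab S s - 1} s"

definition predecessors :: "('d, int option) lmap \<Rightarrow> 'd \<Rightarrow> 'd set" where
  "predecessors S t = {s \<in> white S - min_corners S. successor S s = t}"

text \<open>
  \<open>add_chords S\<close>: in each face \<open>f\<close> of \<open>S\<close>, a vertex \<open>v\<^sub>f\<close> is inserted, and each white corner \<open>s\<close> of
  \<open>f\<close> gets an edge with half-edges \<open>Out s\<close> (in the corner \<open>s\<close>) and \<open>In s\<close> (in the corner
  \<open>successor S s\<close>, or at \<open>v\<^sub>f\<close> if \<open>s\<close> has minimal label). The edges do not cross. Hence a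
  counterclockwise sweep of the corner \<open>t\<close> from the dart \<open>t\<close> to the dart \<open>rot S t\<close> meets \<open>Out t\<close>,
  and then the \<open>In s\<close> with successor \<open>t\<close> in the counterclockwise order around \<open>f\<close> of their starting
  corners \<open>s\<close>, starting after \<open>t\<close>; around \<open>v\<^sub>f\<close>, the half-edges are ordered as their starting
  corners around \<open>f\<close>.
\<close>

datatype 's chorded = Base 's | Out 's | In 's

definition next_incoming :: "('s, int option) lmap \<Rightarrow> 's \<Rightarrow> 's \<Rightarrow> 's chorded" where
  "next_incoming S t s =
     (let q = next_in (ccw S) (insert t (predecessors S t)) s
      in if q = t then Base (rot S t) else In q)"

definition add_chords :: "('s, int option) lmap \<Rightarrow> ('s chorded, int option) lmap" where
  "add_chords S =
     \<lparr>darts = Base ` darts S \<union> Out ` white S \<union> In ` white S,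
      rot = (\<lambda>x. case x of
               Base s \<Rightarrow> (if s \<in> white S then Out s else Base (rot S s))
             | Out s \<Rightarrow> next_incoming S s s
             | In s \<Rightarrow> (if s \<in> min_corners S then In (next_in (ccw S) (min_corners S) s)
                       else next_incoming S (successor S s) s)),
      opp = (\<lambda>x. case x of Base s \<Rightarrow> Base (opp S s) | Out s \<Rightarrow> In s | In s \<Rightarrow> Out s),
      lab = (\<lambda>x. case x of
               Base s \<Rightarrow> lab S s
             | Out s \<Rightarrow> lab S s
             | In s \<Rightarrow> (if s \<in> min_corners S then Some (corner_min S s - 1)
                       else lab S (successor S s)))\<rparr>"

definition Psi_figure :: "'d hmap \<Rightarrow> ('d starred chorded, int option) lmap" where
  "Psi_figure H = erase (range Base) (add_chords (star_rep H))"

text \<open>The same map with all its vertices regarded as labelled vertices of a figure.\<close>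

definition all_white :: "('d, int) lmap \<Rightarrow> ('d, int option) lmap" where
  "all_white B = \<lparr>darts = darts B, rot = rot B, opp = opp B, lab = (\<lambda>d. Some (lab B d))\<rparr>"


section \<open>Maps and hypermaps up to isomorphism\<close>

text \<open>Any finite map is isomorphic to one whose darts are natural numbers.\<close>

type_synonym nmap = "(nat, int) lmap"
type_synonym nhmap = "nat hmap"

definition suit_rel :: "nmap rel" where
  "suit_rel = {(B, B'). suitably_labelled B \<and> suitably_labelled B' \<and> lmap_isomorphic B B'}"

definition well_rel :: "nhmap rel" where
  "well_rel = {(H, H'). well_labelled H \<and> well_labelled H' \<and> hmap_isomorphic H H'}"

definition suit_maps :: "nmap set set" where
  "suit_maps = {B. suitably_labelled B} // suit_rel"

definition well_hmaps :: "nhmap set set" where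
  "well_hmaps = {H. well_labelled H} // well_rel"

definition Phi :: "nmap set \<Rightarrow> nhmap set" where
  "Phi X = {H. well_labelled H \<and> (\<exists>B\<in>X. lmap_isomorphic (star_rep H) (Phi_figure B))}"

definition Psi :: "nhmap set \<Rightarrow> nmap set" where
  "Psi Y = {B. suitably_labelled B \<and> (\<exists>H\<in>Y. lmap_isomorphic (all_white B) (Psi_figure H))}"


section \<open>Completion of cyclic sequences\<close>

text \<open>The last element is followed by the first one.\<close>

definition lower_completion_list :: "int list \<Rightarrow> int list" where
  "lower_completion_list xs =
     concat (map (\<lambda>k. let i = xs ! k; j = xs ! (Suc k mod length xs)
                      in i # (if j \<ge> i then [i - 1..j - 1] else []))
                 [0..<length xs])"

definition lower_completion :: "int list set \<Rightarrow> int list set" where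
  "lower_completion \<tau> = {rotate n (lower_completion_list xs) | n xs. xs \<in> \<tau>}"


section \<open>Corresponding vertices and faces\<close>

text \<open>
  Let \<open>g\<close> be an isomorphism from \<open>star_rep H\<close> to \<open>Phi_figure B\<close>. A vertex \<open>v\<close> of \<open>H\<close> corresponds to
  the vertex \<open>v'\<close> of \<open>B\<close> that is identified with it; since \<open>g\<close> preserves vertices, it suffices that
  one half-edge at \<open>v\<close> is sent to one at \<open>v'\<close>. Likewise, a dark face of \<open>H\<close> corresponds to the face
  of \<open>B\<close> containing the same black vertex.
\<close>

definition vertex_corr :: "(nat starred \<Rightarrow> nat starred) \<Rightarrow> nhmap \<Rightarrow> nat set \<Rightarrow> nat set \<Rightarrow> bool" where
  "vertex_corr g H v v' \<longleftrightarrow>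
     (\<exists>d\<in>v. \<exists>e\<in>v'. White d \<in> darts (star_rep H) \<and> g (White d) = White e)"

definition dark_face_corr :: "(nat starred \<Rightarrow> nat starred) \<Rightarrow> nhmap \<Rightarrow> nat set \<Rightarrow> nat set \<Rightarrow> bool" where
  "dark_face_corr g H f f' \<longleftrightarrow>
     (\<exists>d\<in>f. \<exists>e\<in>f'. Black d \<in> darts (star_rep H) \<and> g (Black d) = Black e)"

text \<open>
  A light face \<open>f\<close> of \<open>H\<close> corresponds to the local min vertices \<open>w\<close> of \<open>B\<close> drawn inside it. If \<open>e\<close>
  is a dart at \<open>w\<close> then \<open>opp B e\<close> is descending, and the half-edge \<open>White (opp B e)\<close> has the
  edge of \<open>e\<close> on its left. Hence \<open>w\<close> lies in the face to the left of this half-edge, and if the latter is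
  \<open>g (White d)\<close>, in the light face to the left of \<open>d\<close> in \<open>H\<close>, that is, to the right of \<open>opp H d\<close>.
\<close>

definition light_face_corr ::
    "(nat starred \<Rightarrow> nat starred) \<Rightarrow> nhmap \<Rightarrow> nmap \<Rightarrow> nat set \<Rightarrow> nat set \<Rightarrow> bool" where
  "light_face_corr g H B f w \<longleftrightarrow>
     (\<forall>e\<in>w. \<exists>d. White d \<in> darts (star_rep H) \<and> g (White d) = White (opp B e) \<and> opp H d \<in> f)"

end

theory Submission
  imports Defs "HOL-Combinatorics.Transposition"
begin

text \<open>
  Selecting the descending darts of a suitably labelled map \<open>B\<close>, or the darts of a hypermap \<open>H\<close> with a
  dark face on their right, yields a set with one dart per edge, and turning around vertices and faces
  induces two permutations \<open>w\<close> and \<open>b\<close> of this set. Both star figures encode just \<open>(w, b)\<close> and the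
  labels, and \<open>H\<close> is equivalent to this data because its colours alternate around each vertex. The
  light faces are the cycles of \<open>\<phi> = w\<^sup>-\<^sup>1 \<circ> b\<close>.

  From \<open>B\<close> to \<open>H\<close>: following leftmost descending paths sends every descending dart to a local min
  vertex, which is constant on the cycles of \<open>\<phi>\<close>. Hence \<open>\<phi>\<close> has at least as many cycles as there are
  local min vertices, and the genus inequality for \<open>(w, b)\<close> turns this into an equality, which is
  Euler's relation for \<open>H\<close>. It also shows that the local minima correspond to the light faces, and that
  leftmost paths, hence \<open>B\<close>, can be recovered from \<open>\<phi>\<close> and the labels, so \<open>\<Phi>\<close> is injective.

  From \<open>H\<close> to \<open>B\<close>: the map drawn by \<open>\<Psi>\<close> has the same \<open>(w, b)\<close>, so \<open>\<Phi> \<circ> \<Psi>\<close> is the identity. With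
  the injectivity of \<open>\<Phi>\<close> this makes the mappings inverse to each other.
\<close>

section \<open>Permutations of a finite set\<close>

text \<open>Planarity of \<open>B\<close> settles a point that no local argument gives: two cycles
  of \<phi> never lead to the same local minimum. Leftmost paths only show that the end point is
  constant on a cycle; injectivity is a count in which Euler's relation for \<open>B\<close> and the
  genus bound meet. The bound requires that \<open>w\<close> and \<open>b\<close> act transitively,
  which is not obvious once the local minima are gone, and is proved by induction on labels from the
  top.

  The labels recover \<open>B\<close> because the leftmost paths of consecutive elements of a cycle
  of \<phi> merge. Hence the next dart on the path of \<open>e\<close> is the first later element of
  the cycle with label one less: the successor rule of \<Psi> turns up in the analysis of \<Phi>. In
  the converse direction Euler's relation is a matter of bookkeeping: each light face, lost as a
  face, returns as a new vertex.

  Both kinds of objects satisfy the conditions collected in \<open>luk_map\<close>, so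
  \<open>hyper_of\<close> and \<open>psi_of\<close> start from the same data. Rotations matter on
  darts only, whence permutations are taken on a carrier.\<close>

definition perm_on :: "('a \<Rightarrow> 'a) \<Rightarrow> 'a set \<Rightarrow> bool" where
  "perm_on f D \<longleftrightarrow> finite D \<and> bij_betw f D D"

lemma perm_onI:
  assumes "finite D" "\<And>x. x \<in> D \<Longrightarrow> f x \<in> D" "inj_on f D"
  shows "perm_on f D"
  using assms endo_inj_surj[of D f] unfolding perm_on_def bij_betw_def by auto

lemma perm_on_mem: "perm_on f D \<Longrightarrow> x \<in> D \<Longrightarrow> f x \<in> D"
  unfolding perm_on_def bij_betw_def by auto

lemma perm_on_inj: "perm_on f D \<Longrightarrow> inj_on f D"
  unfolding perm_on_def bij_betw_def by auto

lemma perm_on_eq_iff: "perm_on f D \<Longrightarrow> x \<in> D \<Longrightarrow> y \<in> D \<Longrightarrow> f x = f y \<longleftrightarrow> x = y"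
  using perm_on_inj[of f D] by (auto dest: inj_onD)

lemma perm_on_funpow: "perm_on f D \<Longrightarrow> perm_on (f ^^ k) D"
proof (induction k)
  case 0
  then show ?case by (simp add: perm_on_def id_def[symmetric])
next
  case (Suc k)
  then show ?case using bij_betw_trans[of "f ^^ k" D D f D] by (simp add: perm_on_def comp_def)
qed

lemma funpow_mem: "perm_on f D \<Longrightarrow> x \<in> D \<Longrightarrow> (f ^^ k) x \<in> D"
  using perm_on_funpow perm_on_mem by metis

lemma funpow_add_apply: "(f ^^ k) ((f ^^ l) x) = (f ^^ (k + l)) x"
  by (simp add: funpow_add)

lemma funpow_eq_diff:
  assumes "perm_on f D" "x \<in> D" "y \<in> D" "(f ^^ k) x = (f ^^ l) y" "k \<le> l"
  shows "x = (f ^^ (l - k)) y"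
proof -
  have "(f ^^ l) y = (f ^^ k) ((f ^^ (l - k)) y)"
    using assms(5) by (simp add: funpow_add_apply)
  then show ?thesis
    using assms perm_on_eq_iff[OF perm_on_funpow[OF assms(1), of k], of x "(f ^^ (l - k)) y"]
      funpow_mem[OF assms(1,3)] by simp
qed

lemma funpow_recur:
  assumes "perm_on f D" "x \<in> D"
  shows "\<exists>k>0. (f ^^ k) x = x"
proof -
  have "\<not> inj (\<lambda>k. (f ^^ k) x)"
  proof
    assume "inj (\<lambda>k. (f ^^ k) x)"
    moreover have "range (\<lambda>k. (f ^^ k) x) \<subseteq> D" using funpow_mem[OF assms] by auto
    ultimately show False
      using assms(1) finite_imageD[of "\<lambda>k. (f ^^ k) x" UNIV] finite_subset infinite_UNIV_nat
      unfolding perm_on_def by blast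
  qed
  then obtain k l where "(f ^^ k) x = (f ^^ l) x" "k < l"
    unfolding inj_def by (auto simp: neq_iff) (metis that)
  then have "x = (f ^^ (l - k)) x" using funpow_eq_diff[OF assms(1) assms(2) assms(2)] by auto
  with \<open>k < l\<close> show ?thesis by (intro exI[of _ "l - k"]) simp
qed

lemma funpow_mem_orbit: "0 < k \<Longrightarrow> (f ^^ k) x \<in> orbit f x"
proof (induction k)
  case (Suc k)
  then show ?case by (cases k) (auto intro: orbit.intros)
qed simp

text \<open>\<open>orbit\<close> collects only positive iterates, so that it contains its starting
  point is a consequence of finiteness, through \<open>funpow_recur\<close>.\<close>

lemma self_mem_orbit:
  assumes "perm_on f D" "x \<in> D"
  shows "x \<in> orbit f x"
proof -
  obtain k where "k > 0" "(f ^^ k) x = x" using funpow_recur[OF assms] by auto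
  then show ?thesis using funpow_mem_orbit[of k f x] by simp
qed

lemma orbit_eq_funpow: "orbit f x = {(f ^^ k) x | k. 0 < k}"
proof (intro set_eqI iffI)
  fix y assume "y \<in> orbit f x"
  then show "y \<in> {(f ^^ k) x | k. 0 < k}"
  proof induction
    case base
    then show ?case by (auto intro!: exI[of _ "1::nat"])
  next
    case (step y)
    then obtain k where "0 < k" "y = (f ^^ k) x" by auto
    then show ?case by (auto intro!: exI[of _ "Suc k"])
  qed
qed (auto intro: funpow_mem_orbit)

lemma funpow_mem_orbit': "perm_on f D \<Longrightarrow> x \<in> D \<Longrightarrow> (f ^^ k) x \<in> orbit f x"
  using funpow_mem_orbit[of k f x] self_mem_orbit[of f D x] by (cases "k = 0") auto

lemma orbit_subset_dom: "perm_on f D \<Longrightarrow> x \<in> D \<Longrightarrow> orbit f x \<subseteq> D"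
  using funpow_mem by (auto simp: orbit_eq_funpow)

lemma orbit_trans: "y \<in> orbit f x \<Longrightarrow> z \<in> orbit f y \<Longrightarrow> z \<in> orbit f x"
proof (unfold orbit_eq_funpow, clarify)
  fix k l :: nat assume "0 < k" "0 < l"
  then show "\<exists>m. (f ^^ l) ((f ^^ k) x) = (f ^^ m) x \<and> 0 < m"
    by (intro exI[of _ "l + k"]) (simp add: funpow_add)
qed

lemma orbit_sym_on:
  assumes "perm_on f D" "x \<in> D" "y \<in> orbit f x"
  shows "x \<in> orbit f y"
proof -
  obtain k where k: "0 < k" "y = (f ^^ k) x" using assms(3) by (auto simp: orbit_eq_funpow)
  obtain p where p: "p > 0" "(f ^^ p) x = x" using funpow_recur[OF assms(1,2)] by auto
  have per: "(f ^^ (p * m)) x = x" for m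
    by (induction m) (simp_all add: funpow_add p)
  have "(f ^^ (p * k - k + p)) y = (f ^^ (p * k - k + p + k)) x" by (simp add: k(2) funpow_add)
  also have "k \<le> p * k" using p(1) by simp
  then have "p * k - k + p + k = p * k + p" by linarith
  then have "p * k - k + p + k = p * (k + 1)" by simp
  finally have "(f ^^ (p * k - k + p)) y = x" using per[of "Suc k"] by simp
  then show ?thesis using funpow_mem_orbit[of "p * k - k + p" f y] p(1)
    by (metis add_gr_0)
qed

lemma orbit_eq_on:
  assumes "perm_on f D" "x \<in> D" "y \<in> orbit f x"
  shows "orbit f y = orbit f x"
  using orbit_trans[OF assms(3)] orbit_trans[OF orbit_sym_on[OF assms]] by blast

lemma orbit_step_on: "perm_on f D \<Longrightarrow> x \<in> D \<Longrightarrow> orbit f (f x) = orbit f x"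
  using orbit_eq_on orbit.base by metis

lemma orbit_invariant:
  assumes "y \<in> orbit f x" "\<And>z. z \<in> D \<Longrightarrow> f z \<in> D \<and> P (f z) = P z" "x \<in> D"
  shows "y \<in> D \<and> P y = P x"
  using assms(1) by induction (use assms in auto)

lemma orbit_induct_on:
  assumes "perm_on f D" "x \<in> D" "y \<in> orbit f x" "P x" "\<And>z. z \<in> D \<Longrightarrow> P z \<Longrightarrow> P (f z)"
  shows "P y"
proof -
  have "y \<in> D \<and> P y" using assms(3)
    by induction (use assms in \<open>auto intro: perm_on_mem[OF assms(1)]\<close>)
  then show ?thesis ..
qed

lemma funpow_cong_on:
  assumes "perm_on f D" "\<And>x. x \<in> D \<Longrightarrow> g x = f x" "x \<in> D"
  shows "(g ^^ k) x = (f ^^ k) x"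
  using funpow_mem[OF assms(1,3)] by (induction k) (auto simp: assms)

lemma orbit_cong_on:
  assumes "perm_on f D" "\<And>x. x \<in> D \<Longrightarrow> g x = f x" "x \<in> D"
  shows "orbit g x = orbit f x"
  using funpow_cong_on[OF assms] by (auto simp: orbit_eq_funpow)

lemma inv_into_perm:
  assumes "perm_on f D"
  shows "perm_on (inv_into D f) D"
  using assms bij_betw_inv_into unfolding perm_on_def by blast

lemma inv_into_left: "perm_on f D \<Longrightarrow> x \<in> D \<Longrightarrow> inv_into D f (f x) = x"
  unfolding perm_on_def by (auto simp: bij_betw_inv_into_left)

lemma inv_into_right: "perm_on f D \<Longrightarrow> x \<in> D \<Longrightarrow> f (inv_into D f x) = x"
  unfolding perm_on_def by (auto simp: bij_betw_inv_into_right)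

lemma inv_into_mem: "perm_on f D \<Longrightarrow> x \<in> D \<Longrightarrow> inv_into D f x \<in> D"
  using inv_into_perm perm_on_mem by metis

lemma perm_on_surj: "perm_on f D \<Longrightarrow> y \<in> D \<Longrightarrow> \<exists>x\<in>D. y = f x"
  using inv_into_right[of f D y] inv_into_mem[of f D y] by metis

lemma orbit_inv_into:
  assumes "perm_on f D" "x \<in> D"
  shows "orbit (inv_into D f) x = orbit f x"
proof -
  have *: "orbit (inv_into D g) x \<subseteq> orbit g x" if g: "perm_on g D" for g
  proof
    fix y assume "y \<in> orbit (inv_into D g) x"
    then show "y \<in> orbit g x"
    proof (rule orbit_induct_on[OF inv_into_perm[OF g] assms(2)])
      show "x \<in> orbit g x" using self_mem_orbit[OF g assms(2)] .
      fix z assume z: "z \<in> D" "z \<in> orbit g x"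
      have "inv_into D g z \<in> orbit g z"
        using orbit_sym_on[OF g inv_into_mem[OF g z(1)]] orbit.base[of g "inv_into D g z"]
        by (simp add: inv_into_right[OF g z(1)])
      then show "inv_into D g z \<in> orbit g x" using z orbit_trans by metis
    qed
  qed
  \<comment> \<open>The inclusion holds for every permutation; applied to the inverse of
    \<open>f\<close> it gives the opposite one, since \<open>f\<close> agrees on \<open>D\<close>
    with its double inverse.\<close>
  have "orbit f x = orbit (inv_into D (inv_into D f)) x"
  proof (rule orbit_cong_on[OF inv_into_perm[OF inv_into_perm[OF assms(1)]] _ assms(2)])
    fix y assume y: "y \<in> D"
    have "inv_into D (inv_into D f) (inv_into D f (f y)) = f y"
      using inv_into_left[OF inv_into_perm[OF assms(1)]] perm_on_mem[OF assms(1) y] .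
    then show "f y = inv_into D (inv_into D f) y" by (simp add: inv_into_left[OF assms(1) y])
  qed
  with *[OF assms(1)] *[OF inv_into_perm[OF assms(1)]] show ?thesis by blast
qed

definition cycles :: "('a \<Rightarrow> 'a) \<Rightarrow> 'a set \<Rightarrow> 'a set set" where
  "cycles f D = orbit f ` D"

lemma cycles_eq_orbit: "perm_on f D \<Longrightarrow> c \<in> cycles f D \<Longrightarrow> x \<in> c \<Longrightarrow> c = orbit f x"
  unfolding cycles_def by (clarify, rule orbit_eq_on[symmetric])

lemma cycles_cong: "perm_on f D \<Longrightarrow> (\<And>x. x \<in> D \<Longrightarrow> g x = f x) \<Longrightarrow> cycles g D = cycles f D"
  unfolding cycles_def by (intro image_cong refl orbit_cong_on)

lemma finite_cycles: "perm_on f D \<Longrightarrow> finite (cycles f D)"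
  unfolding cycles_def perm_on_def by auto

lemma cycles_inv_into: "perm_on f D \<Longrightarrow> cycles (inv_into D f) D = cycles f D"
  unfolding cycles_def by (intro image_cong refl orbit_inv_into)

text \<open>A quantity that grows by one at every step cannot come back to its initial value on a
  finite cycle. Applied to labels along a face contour, this forces a descending dart in every
  face.\<close>

lemma orbit_meets_of_ascending:
  fixes L :: "'a \<Rightarrow> int"
  assumes "perm_on f D" "x \<in> D" "\<And>y. y \<in> D \<Longrightarrow> y \<notin> A \<Longrightarrow> L (f y) = L y + 1"
  shows "orbit f x \<inter> A \<noteq> {}"
proof
  assume *: "orbit f x \<inter> A = {}"
  have "L ((f ^^ k) x) = L x + int k" for k
  proof (induction k)
    case (Suc k)
    have "(f ^^ k) x \<notin> A" using * funpow_mem_orbit'[OF assms(1,2)] by blast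
    then show ?case using Suc assms(3)[OF funpow_mem[OF assms(1,2)]] by simp
  qed simp
  moreover obtain k where "k > 0" "(f ^^ k) x = x" using funpow_recur[OF assms(1,2)] by auto
  ultimately show False by (metis add_cancel_left_right of_nat_0_eq_iff less_irrefl)
qed

section \<open>Return maps\<close>

lemma next_in_eqI:
  assumes "0 < k" "(f ^^ k) x \<in> A" "\<And>j. 0 < j \<Longrightarrow> j < k \<Longrightarrow> (f ^^ j) x \<notin> A"
  shows "next_in f A x = (f ^^ k) x"
proof -
  have "(LEAST k. 0 < k \<and> (f ^^ k) x \<in> A) = k"
    by (rule Least_equality) (use assms in \<open>auto simp: not_less[symmetric]\<close>)
  then show ?thesis by (simp add: next_in_def)
qed

lemma next_in_obtain:
  assumes "0 < k" "(f ^^ k) x \<in> A"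
  obtains m where "0 < m" "m \<le> k" "next_in f A x = (f ^^ m) x" "(f ^^ m) x \<in> A"
    "\<And>j. 0 < j \<Longrightarrow> j < m \<Longrightarrow> (f ^^ j) x \<notin> A"
proof -
  define m where "m = (LEAST k. 0 < k \<and> (f ^^ k) x \<in> A)"
  have "0 < m \<and> (f ^^ m) x \<in> A" unfolding m_def by (rule LeastI[of _ k]) (use assms in auto)
  moreover have "m \<le> k" unfolding m_def by (rule Least_le) (use assms in auto)
  moreover have "(f ^^ j) x \<notin> A" if "0 < j" "j < m" for j
    using not_less_Least[of j "\<lambda>k. 0 < k \<and> (f ^^ k) x \<in> A"] that by (auto simp: m_def)
  ultimately show thesis using that by (auto simp: next_in_def m_def)
qed

lemma next_in_obtain_orbit:
  assumes "orbit f x \<inter> A \<noteq> {}"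
  obtains m where "0 < m" "next_in f A x = (f ^^ m) x" "(f ^^ m) x \<in> A"
    "\<And>j. 0 < j \<Longrightarrow> j < m \<Longrightarrow> (f ^^ j) x \<notin> A"
proof -
  obtain k where "0 < k" "(f ^^ k) x \<in> A" using assms by (auto simp: orbit_eq_funpow)
  then show thesis using that by (rule next_in_obtain)
qed

lemma next_in_mem: "orbit f x \<inter> A \<noteq> {} \<Longrightarrow> next_in f A x \<in> orbit f x \<inter> A"
  by (erule next_in_obtain_orbit) (auto simp: funpow_mem_orbit)

lemma next_in_mem': "perm_on f D \<Longrightarrow> A \<subseteq> D \<Longrightarrow> x \<in> A \<Longrightarrow> next_in f A x \<in> orbit f x \<inter> A"
  using self_mem_orbit[of f D x] by (intro next_in_mem) auto

lemma next_in_step: "f x \<in> A \<Longrightarrow> next_in f A x = f x"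
  using next_in_eqI[of 1 f x A] by auto

lemma next_in_skip:
  assumes "f x \<notin> A" "orbit f x \<inter> A \<noteq> {}"
  shows "next_in f A x = next_in f A (f x)"
proof -
  obtain m where m: "0 < m" "next_in f A x = (f ^^ m) x" "(f ^^ m) x \<in> A"
    "\<And>j. 0 < j \<Longrightarrow> j < m \<Longrightarrow> (f ^^ j) x \<notin> A"
    using assms(2) by (rule next_in_obtain_orbit) (rule that; assumption)
  have "m \<noteq> 1" using m(3) assms(1) by auto
  then obtain n where n: "m = Suc n" "0 < n" using m(1) by (cases m) auto
  have s: "(f ^^ j) (f x) = (f ^^ Suc j) x" for j by (simp only: funpow_Suc_right comp_apply)
  have "next_in f A (f x) = (f ^^ n) (f x)"
    by (rule next_in_eqI) (use m n in \<open>auto simp only: s Suc_less_eq\<close>)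
  then show ?thesis by (simp only: m(2) n(1) s)
qed

lemma next_in_perm:
  assumes "perm_on f D" "A \<subseteq> D"
  shows "perm_on (next_in f A) A"
proof (rule perm_onI)
  show "finite A" using assms finite_subset unfolding perm_on_def by blast
  show "next_in f A x \<in> A" if "x \<in> A" for x using next_in_mem'[OF assms that] by auto
  \<comment> \<open>If the return times differ, \<open>x\<close> is reached from \<open>y\<close>
    strictly before the first return of \<open>y\<close> to \<open>A\<close>, although
    \<open>x\<close> lies in \<open>A\<close>.\<close>
  have *: "x = y" if xy: "x \<in> A" "y \<in> A" "k \<le> l" "(f ^^ k) x = (f ^^ l) y" 
    "\<And>j. 0 < j \<Longrightarrow> j < l \<Longrightarrow> (f ^^ j) y \<notin> A" "0 < k" for x y k l
  proof (rule ccontr)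
    assume "x \<noteq> y"
    have "x = (f ^^ (l - k)) y" using funpow_eq_diff[OF assms(1)] xy assms(2) by blast
    with \<open>x \<noteq> y\<close> have "0 < l - k" by (cases "l - k = 0") auto
    with xy(5)[of "l - k"] xy(1,6) \<open>x = (f ^^ (l - k)) y\<close> show False by auto
  qed
  show "inj_on (next_in f A) A"
  proof (rule inj_onI)
    fix x y assume xy: "x \<in> A" "y \<in> A" "next_in f A x = next_in f A y"
    have "orbit f x \<inter> A \<noteq> {}" "orbit f y \<inter> A \<noteq> {}"
      using xy self_mem_orbit[OF assms(1)] assms(2) by auto
    obtain k where k: "0 < k" "next_in f A x = (f ^^ k) x" 
        "\<And>j. 0 < j \<Longrightarrow> j < k \<Longrightarrow> (f ^^ j) x \<notin> A"
      using \<open>orbit f x \<inter> A \<noteq> {}\<close> by (rule next_in_obtain_orbit) (rule that; assumption)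
    obtain l where l: "0 < l" "next_in f A y = (f ^^ l) y" 
        "\<And>j. 0 < j \<Longrightarrow> j < l \<Longrightarrow> (f ^^ j) y \<notin> A"
      using \<open>orbit f y \<inter> A \<noteq> {}\<close> by (rule next_in_obtain_orbit) (rule that; assumption)
    show "x = y"
    proof (cases "k \<le> l")
      case True
      then show ?thesis using *[of x y k l] xy k l by simp
    next
      case False
      then show ?thesis using *[of y x l k] xy k l by simp
    qed
  qed
qed

lemma orbit_next_in:
  assumes "perm_on f D" "A \<subseteq> D" "x \<in> A"
  shows "orbit (next_in f A) x = orbit f x \<inter> A"
proof
  note P = next_in_perm[OF assms(1,2)]
  show "orbit (next_in f A) x \<subseteq> orbit f x \<inter> A"
  proof
    fix y assume "y \<in> orbit (next_in f A) x"
    then show "y \<in> orbit f x \<inter> A"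
    proof (rule orbit_induct_on[OF P assms(3)])
      show "x \<in> orbit f x \<inter> A" using self_mem_orbit[OF assms(1)] assms by auto
      fix z assume "z \<in> A" "z \<in> orbit f x \<inter> A"
      then show "next_in f A z \<in> orbit f x \<inter> A"
        using next_in_mem'[OF assms(1,2)] orbit_trans[of z f x] by blast
    qed
  qed
  \<comment> \<open>Induction on the number of steps of \<open>f\<close>, of which the first return
    to \<open>A\<close> consumes a positive number.\<close>
  have "\<And>x. x \<in> A \<Longrightarrow> (f ^^ n) x \<in> A \<Longrightarrow> (f ^^ n) x \<in> orbit (next_in f A) x" for n
  proof (induction n rule: less_induct)
    case (less n)
    show ?case
    proof (cases "n = 0")
      case True
      then show ?thesis using self_mem_orbit[OF P less.prems(1)] by simp
    next
      case False
      then obtain m where m: "0 < m" "m \<le> n" "next_in f A x = (f ^^ m) x" "(f ^^ m) x \<in> A"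
        using next_in_obtain[of n f x A] less.prems by auto
      have "(f ^^ n) x = (f ^^ (n - m)) ((f ^^ m) x)" using m(2) 
        by (simp add: funpow_add_apply)
      then have "(f ^^ n) x \<in> orbit (next_in f A) (next_in f A x)"
        using less.IH[of "n - m" "(f ^^ m) x"] m less.prems by auto
      then show ?thesis using orbit_step_on[OF P less.prems(1)] by simp
    qed
  qed
  then show "orbit f x \<inter> A \<subseteq> orbit (next_in f A) x" using assms(3) by (auto simp: orbit_eq_funpow)
qed

text \<open>Passing to the return map loses only the cycles that miss \<open>A\<close>. For the
  rotation of a suitably labelled map and its descending darts these are the local minima.\<close>

lemma bij_betw_cycles_next_in:
  assumes "perm_on f D" "A \<subseteq> D"
  shows "bij_betw (\<lambda>c. c \<inter> A) {c \<in> cycles f D. c \<inter> A \<noteq> {}} (cycles (next_in f A) A)"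
proof (rule bij_betw_imageI)
  show "inj_on (\<lambda>c. c \<inter> A) {c \<in> cycles f D. c \<inter> A \<noteq> {}}"
  proof (rule inj_onI)
    fix c c' assume c: "c \<in> {c \<in> cycles f D. c \<inter> A \<noteq> {}}" "c' \<in> {c \<in> cycles f D. c \<inter> A \<noteq> {}}"
      "c \<inter> A = c' \<inter> A"
    then obtain x where "x \<in> c" "x \<in> c'" by auto
    with c cycles_eq_orbit[OF assms(1), of _ x] show "c = c'" by blast
  qed
  show "(\<lambda>c. c \<inter> A) ` {c \<in> cycles f D. c \<inter> A \<noteq> {}} = cycles (next_in f A) A"
  proof (intro equalityI subsetI)
    fix c assume "c \<in> (\<lambda>c. c \<inter> A) ` {c \<in> cycles f D. c \<inter> A \<noteq> {}}"
    then obtain x y where "x \<in> D" "c = orbit f x \<inter> A" "y \<in> c" unfolding cycles_def by auto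
    then have "c = orbit (next_in f A) y"
      using orbit_next_in[OF assms, of y] orbit_eq_on[OF assms(1), of x y] by simp
    then show "c \<in> cycles (next_in f A) A" using \<open>y \<in> c\<close> \<open>c = _ \<inter> A\<close> by (auto simp: cycles_def)
  next
    fix c assume "c \<in> cycles (next_in f A) A"
    then obtain x where x: "x \<in> A" "c = orbit f x \<inter> A"
      unfolding cycles_def using orbit_next_in[OF assms] by auto
    then have "x \<in> orbit f x" using self_mem_orbit[OF assms(1)] assms(2) by auto
    with x assms(2) show "c \<in> (\<lambda>c. c \<inter> A) ` {c \<in> cycles f D. c \<inter> A \<noteq> {}}" 
      by (auto simp: cycles_def)
  qed
qed

lemma card_cycles_next_in:
  assumes "perm_on f D" "A \<subseteq> D"
  shows "card (cycles (next_in f A) A) = card {c \<in> cycles f D. c \<inter> A \<noteq> {}}"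
  using bij_betw_same_card[OF bij_betw_cycles_next_in[OF assms]] by simp

text \<open>\<open>add_stars\<close> orders the half-edges around a black vertex by the first return
  of the inverse of \<open>cw\<close>, because contours run clockwise and rotations
  counterclockwise. This identifies that return map with the inverse of
  \<open>fnext\<close>.\<close>

lemma next_in_inv_into:
  assumes "perm_on f D" "A \<subseteq> D" "x \<in> A"
  shows "next_in (inv_into D f) A (next_in f A x) = x"
proof -
  have "orbit f x \<inter> A \<noteq> {}" using self_mem_orbit[OF assms(1)] assms by auto
  then obtain k where k: "0 < k" "next_in f A x = (f ^^ k) x" "(f ^^ k) x \<in> A"
        "\<And>j. 0 < j \<Longrightarrow> j < k \<Longrightarrow> (f ^^ j) x \<notin> A"
    by (rule next_in_obtain_orbit) (rule that; assumption)
  have inv: "(inv_into D f ^^ j) ((f ^^ k) x) = (f ^^ (k - j)) x" if "j \<le> k" for j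
    using that
  proof (induction j)
    case (Suc j)
    then have "(f ^^ (k - j)) x = (f ^^ Suc (k - Suc j)) x" by (simp add: Suc_diff_Suc)
    also have "\<dots> = f ((f ^^ (k - Suc j)) x)" by simp
    finally have "(f ^^ (k - j)) x = f ((f ^^ (k - Suc j)) x)" .
    then show ?case using Suc inv_into_left[OF assms(1) funpow_mem[OF assms(1)]] assms by auto
  qed simp
  have "next_in (inv_into D f) A ((f ^^ k) x) = (inv_into D f ^^ k) ((f ^^ k) x)"
  proof (rule next_in_eqI[OF k(1)])
    show "(inv_into D f ^^ k) ((f ^^ k) x) \<in> A" using inv[of k] assms by simp
    fix j assume "0 < j" "j < k"
    then show "(inv_into D f ^^ j) ((f ^^ k) x) \<notin> A" using inv[of j] k(4)[of "k - j"] by simp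
  qed
  then show ?thesis using inv[of k] k by simp
qed

lemma next_in_conj:
  assumes "\<And>x. x \<in> D \<Longrightarrow> f x \<in> D \<and> g (f x) = f' (g x)" "inj_on g D" "A \<subseteq> D" "x \<in> D"
  shows "g (next_in f A x) = next_in f' (g ` A) (g x)"
proof -
  have *: "(f ^^ k) x \<in> D \<and> g ((f ^^ k) x) = (f' ^^ k) (g x)" for k
    by (induction k) (use assms in auto)
  then have "(f' ^^ k) (g x) \<in> g ` A \<longleftrightarrow> (f ^^ k) x \<in> A" for k
    using inj_on_image_mem_iff[OF assms(2) _ assms(3), of "(f ^^ k) x"] by simp
  then show ?thesis unfolding next_in_def using * by simp
qed

lemma orbit_conj:
  assumes "\<And>x. x \<in> D \<Longrightarrow> f x \<in> D \<and> g (f x) = f' (g x)" "x \<in> D"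
  shows "g ` orbit f x = orbit f' (g x)"
proof -
  have "(f ^^ k) x \<in> D \<and> g ((f ^^ k) x) = (f' ^^ k) (g x)" for k
    by (induction k) (use assms in auto)
  then show ?thesis unfolding orbit_eq_funpow by (auto intro!: image_eqI) 
qed

section \<open>The genus inequality\<close>

definition conn :: "('a \<times> 'a) set \<Rightarrow> ('a \<times> 'a) set" where
  "conn R = (R \<union> R\<inverse>)\<^sup>*"

definition comps :: "'a set \<Rightarrow> ('a \<times> 'a) set \<Rightarrow> nat" where
  "comps E R = card ((\<lambda>x. conn R `` {x}) ` E)"

definition graph_on :: "('a \<Rightarrow> 'a) \<Rightarrow> 'a set \<Rightarrow> ('a \<times> 'a) set" where
  "graph_on f E = (\<lambda>x. (x, f x)) ` E"

lemma conn_refl [simp]: "(x, x) \<in> conn R"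
  by (simp add: conn_def)

lemma conn_incl: "(x, y) \<in> R \<Longrightarrow> (x, y) \<in> conn R"
  by (auto simp: conn_def)

lemma conn_sym: "(x, y) \<in> conn R \<Longrightarrow> (y, x) \<in> conn R"
  unfolding conn_def by (meson sym_Un_converse sym_rtrancl symD)

lemma conn_trans: "(x, y) \<in> conn R \<Longrightarrow> (y, z) \<in> conn R \<Longrightarrow> (x, z) \<in> conn R"
  unfolding conn_def by (rule rtrancl_trans)

lemma conn_subset: 
  assumes "R \<subseteq> conn S"
  shows "conn R \<subseteq> conn S"
proof -
  have "R \<union> R\<inverse> \<subseteq> conn S" using assms conn_sym by fastforce
  then have "conn R \<subseteq> (conn S)\<^sup>*" unfolding conn_def[of R] by (rule rtrancl_mono)
  then show ?thesis by (simp add: conn_def)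
qed

lemma conn_mono: "R \<subseteq> S \<Longrightarrow> conn R \<subseteq> conn S"
  by (rule conn_subset) (auto intro: conn_incl)

lemma conn_class_eq: "conn R `` {x} = conn R `` {y} \<longleftrightarrow> (x, y) \<in> conn R"
proof
  assume "(x, y) \<in> conn R"
  then show "conn R `` {x} = conn R `` {y}" using conn_sym conn_trans by fast
next
  assume "conn R `` {x} = conn R `` {y}"
  moreover have "y \<in> conn R `` {y}" by simp
  ultimately have "y \<in> conn R `` {x}" by simp
  then show "(x, y) \<in> conn R" by simp
qed

lemma conn_insert_same: "(x, y) \<in> conn R \<Longrightarrow> conn (insert (x, y) R) = conn R"
  using conn_subset[of "insert (x, y) R" R] conn_mono[of R "insert (x, y) R"] conn_incl by fast

text \<open>A path that uses the new pair several times can be shortened to one that uses it at most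
  once, in one of the two directions.\<close>

lemma conn_insert_cases:
  assumes "(u, v) \<in> conn (insert (x, y) R)"
  shows "(u, v) \<in> conn R \<or> (u, x) \<in> conn R \<and> (y, v) \<in> conn R \<or> (u, y) \<in> conn R \<and> (x, v) \<in> conn R"
  using assms unfolding conn_def[of "insert (x, y) R"]
proof (induction rule: rtrancl_induct)
  case (step v z)
  then consider "(v, z) \<in> conn R" | "v = x" "z = y" | "v = y" "z = x" 
    by (auto intro: conn_incl conn_sym)
  then show ?case
  proof cases
    case 1
    then show ?thesis using step.IH conn_trans[of _ v R z] by blast
  next
    case 2
    then show ?thesis using step.IH by auto
  next
    case 3
    then show ?thesis using step.IH by auto
  qed
qed simp

text \<open>The classes of \<open>x\<close> and \<open>y\<close>, distinct before, are fused into
  their union, and all others persist.\<close>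

lemma comps_insert:
  assumes "finite E" "x \<in> E" "y \<in> E" "(x, y) \<notin> conn R"
  shows "comps E (insert (x, y) R) + 1 = comps E R"
proof -
  let ?c = "\<lambda>x. conn R `` {x}" and ?c' = "\<lambda>z. conn (insert (x, y) R) `` {z}"
  let ?C = "?c ` E - {?c x, ?c y}"
  note mono = conn_mono[of R "insert (x, y) R", OF subset_insertI]
  have xy: "(x, y) \<in> conn (insert (x, y) R)" by (auto intro: conn_incl)
  have c1: "?c' z = ?c x \<union> ?c y" if "(x, z) \<in> conn R \<or> (y, z) \<in> conn R" for z
  proof -
    have "?c' z = ?c' x"
      using that xy mono conn_sym conn_trans unfolding conn_class_eq by (metis subsetD)
    moreover have "?c' x = ?c x \<union> ?c y"
      using conn_insert_cases[of x _ x y R] mono conn_trans[OF xy] by blast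
    ultimately show ?thesis by simp
  qed
  have c2: "?c' z = ?c z" if "(x, z) \<notin> conn R" "(y, z) \<notin> conn R" for z
    using conn_insert_cases[of z _ x y R] that conn_sym[of z] mono by blast
  have c3: "z \<in> E \<Longrightarrow> ?c z \<in> ?C \<longleftrightarrow> (x, z) \<notin> conn R \<and> (y, z) \<notin> conn R" for z
    using conn_class_eq[of R] conn_sym[of _ z R] conn_sym[of z _ R] by auto
  have "?c' ` E = insert (?c x \<union> ?c y) ?C"
  proof (intro equalityI subsetI)
    fix k assume "k \<in> ?c' ` E"
    then obtain z where z: "z \<in> E" "k = ?c' z" by auto
    then show "k \<in> insert (?c x \<union> ?c y) ?C" 
      using c1[of z] c2[of z] c3[of z] by (cases "(x, z) \<in> conn R \<or> (y, z) \<in> conn R") auto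
  next
    fix k assume "k \<in> insert (?c x \<union> ?c y) ?C"
    then show "k \<in> ?c' ` E"
    proof
      assume "k = ?c x \<union> ?c y"
      then show ?thesis using c1[of x] assms(2) by auto
    next
      assume k: "k \<in> ?C"
      then obtain z where "z \<in> E" "k = ?c z" by blast
      then show ?thesis using k c2[of z] c3[of z] by auto
    qed
  qed
  moreover have "?c x \<union> ?c y \<notin> ?C"
  proof
    assume *: "?c x \<union> ?c y \<in> ?C"
    then obtain z where z: "z \<in> E" "?c x \<union> ?c y = ?c z" by blast
    have "x \<in> ?c x" by simp
    then have "x \<in> ?c z" using z(2) by blast
    then have "(x, z) \<in> conn R" using conn_sym[of z x R] by simp
    moreover have "?c z \<in> ?C" using * unfolding z(2) .
    ultimately show False using c3[OF z(1)] by blast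
  qed
  moreover have "card ?C = card (?c ` E) - 2"
  proof -
    have "?c x \<noteq> ?c y" using conn_class_eq[of R x y] assms(4) by simp
    then show ?thesis using assms by (subst card_Diff_subset) auto
  qed
  moreover have "card (?c ` E) \<ge> 2"
  proof -
    have "?c x \<noteq> ?c y" using conn_class_eq[of R x y] assms(4) by simp
    then have "card {?c x, ?c y} = 2" by simp
    then show ?thesis using card_mono[of "?c ` E" "{?c x, ?c y}"] assms by auto
  qed
  ultimately show ?thesis using assms(1) unfolding comps_def by simp
qed

lemma comps_insert_le:
  assumes "finite E" "x \<in> E" "y \<in> E"
  shows "comps E (insert (x, y) R) \<le> comps E R" "comps E R \<le> comps E (insert (x, y) R) + 1"
  using comps_insert[OF assms, of R] conn_insert_same[of x y R]
  by (cases "(x, y) \<in> conn R"; simp add: comps_def)+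

text \<open>A step backwards in the graph of a permutation of a finite set is a positive number of
  steps forwards. Counting cycles thus becomes counting components, where the effect of a single
  added pair is known.\<close>

lemma conn_graph_on:
  assumes "perm_on f E" "x \<in> E"
  shows "conn (graph_on f E) `` {x} = orbit f x"
proof (intro equalityI subsetI)
  fix y assume "y \<in> conn (graph_on f E) `` {x}"
  then have "(x, y) \<in> (graph_on f E \<union> (graph_on f E)\<inverse>)\<^sup>*" by (simp add: conn_def)
  then show "y \<in> orbit f x"
  proof (induction rule: rtrancl_induct)
    case base
    show ?case using self_mem_orbit[OF assms] .
  next
    case (step y z)
    then consider "z = f y" | "y = f z" "z \<in> E" by (auto simp: graph_on_def)
    then show ?case
    proof cases
      case 1
      then show ?thesis using step by (auto intro: orbit.step)
    next
      case 2
      then have "z \<in> orbit f y" using orbit_sym_on[OF assms(1), of z y] orbit.base[of f z] by simp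
      then show ?thesis using step orbit_trans by metis
    qed
  qed
next
  fix y assume "y \<in> orbit f x"
  then show "y \<in> conn (graph_on f E) `` {x}"
  proof (rule orbit_induct_on[OF assms])
    fix z assume "z \<in> E" "z \<in> conn (graph_on f E) `` {x}"
    then show "f z \<in> conn (graph_on f E) `` {x}"
      using conn_incl[of z "f z" "graph_on f E"] conn_trans[of x z _ "f z"] 
      by (auto simp: graph_on_def)
  qed simp
qed

lemma card_cycles_comps: "perm_on f E \<Longrightarrow> card (cycles f E) = comps E (graph_on f E)"
  unfolding cycles_def comps_def using conn_graph_on[of f E] by simp

section \<open>Effect of a transposition on cycles and components\<close>

lemma perm_on_transpose:
  assumes "perm_on f E" "x \<in> E" "y \<in> E"
  shows "perm_on (f \<circ> transpose x y) E"
proof -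
  have "bij_betw (transpose x y) E E" 
    by (rule bij_betw_byWitness[of _ "transpose x y"]) (use assms in \<open>auto simp: transpose_def\<close>)
  then show ?thesis using assms bij_betw_trans unfolding perm_on_def by blast
qed

text \<open>Once \<open>x\<close> and \<open>y\<close> are linked, each arrow of
  \<open>f \<circ> transpose x y\<close> is the link, if required, followed by an arrow of
  \<open>f\<close>, and vice versa because the transposition is an involution. The set
  \<open>S\<close> leaves room for the graph of the other permutation in the genus
  inequality.\<close>

lemma conn_graph_transpose:
  assumes "x \<in> E" "y \<in> E"
  shows "conn (insert (x, y) (S \<union> graph_on (f \<circ> transpose x y) E)) 
       = conn (insert (x, y) (S \<union> graph_on f E))"
proof -
  have *: "conn (insert (x, y) (S \<union> graph_on (g \<circ> transpose x y) E)) 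
       \<subseteq> conn (insert (x, y) (S \<union> graph_on g E))" for g
  proof (rule conn_subset)
    let ?R = "insert (x, y) (S \<union> graph_on g E)"
    have xy: "(x, y) \<in> conn ?R" "(y, x) \<in> conn ?R" using conn_incl[of x y ?R] conn_sym[of x y ?R] by auto
    have "(z, g (transpose x y z)) \<in> conn ?R" if "z \<in> E" for z
    proof -
      have "(z, transpose x y z) \<in> conn ?R" using xy by (auto simp: transpose_def)
      moreover have "(transpose x y z, g (transpose x y z)) \<in> conn ?R"
        using that assms by (intro conn_incl) (auto simp: graph_on_def transpose_def)
      ultimately show ?thesis by (rule conn_trans)
    qed
    moreover have "insert (x, y) S \<subseteq> conn ?R" by (auto intro: conn_incl)
    ultimately show "insert (x, y) (S \<union> graph_on (g \<circ> transpose x y) E) \<subseteq> conn ?R"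
      by (auto simp: graph_on_def)
  qed
  have "(f \<circ> transpose x y) \<circ> transpose x y = f" by (simp add: fun_eq_iff)
  then show ?thesis using *[of f] *[of "f \<circ> transpose x y"] by simp
qed

text \<open>The new image of \<open>x\<close> is \<open>f y\<close>; from there the old cycle of
  \<open>y\<close>, which avoids \<open>x\<close>, is followed until it closes up at
  \<open>y\<close>.\<close>

lemma transpose_merges:
  assumes "perm_on f E" "x \<in> E" "y \<in> E" "(x, y) \<notin> conn (graph_on f E)"
  shows "(x, y) \<in> conn (graph_on (f \<circ> transpose x y) E)"
proof -
  let ?g = "f \<circ> transpose x y"
  define R where "R = graph_on ?g E"
  have "x \<notin> orbit f y" using assms conn_graph_on[OF assms(1,3)] conn_sym[of y x] by blast
  have base: "(x, f y) \<in> conn R" using assms(2) by (intro conn_incl) (auto simp: R_def graph_on_def)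
  have "(x, (f ^^ Suc j) y) \<in> conn R" for j
  proof (induction j)
    case 0
    then show ?case using base by simp
  next
    case (Suc j)
    let ?z = "(f ^^ Suc j) y"
    have "?z \<in> E" "?z \<noteq> x" 
      using funpow_mem[OF assms(1,3), of "Suc j"] funpow_mem_orbit[of "Suc j" f y] 
        \<open>x \<notin> orbit f y\<close> by auto
    show ?case
    proof (cases "?z = y")
      case True
      then show ?thesis using base by simp
    next
      case False
      with \<open>?z \<noteq> x\<close> have "?g ?z = f ?z" by (simp add: transpose_def)
      then have "(?z, f ?z) \<in> conn R" using \<open>?z \<in> E\<close> 
        by (intro conn_incl) (auto simp: R_def graph_on_def)
      then show ?thesis using Suc conn_trans[of x ?z _ "f ?z"] by simp
    qed
  qed
  moreover obtain k where "k > 0" "(f ^^ k) y = y" using funpow_recur[OF assms(1,3)] by auto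
  ultimately show ?thesis unfolding R_def by (metis Suc_pred)
qed

text \<open>After the pair \<open>(x, y)\<close> is added both permutations have the same
  components, and adding a pair costs at most one component. If \<open>x\<close> and
  \<open>y\<close> lie on different cycles, it costs one for \<open>f\<close> and, by
  \<open>transpose_merges\<close>, none for the product.\<close>

lemma card_cycles_transpose:
  assumes "perm_on f E" "x \<in> E" "y \<in> E"
  shows "card (cycles (f \<circ> transpose x y) E) \<le> card (cycles f E) + 1"
    and "(x, y) \<notin> conn (graph_on f E) \<Longrightarrow>
      card (cycles (f \<circ> transpose x y) E) + 1 = card (cycles f E)"
proof -
  let ?g = "f \<circ> transpose x y"
  have fin: "finite E" using assms(1) by (simp add: perm_on_def)
  have eq: "comps E (insert (x, y) (graph_on ?g E)) = comps E (insert (x, y) (graph_on f E))"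
    using conn_graph_transpose[OF assms(2,3), of "{}" f] by (simp add: comps_def)
  note c = card_cycles_comps[OF assms(1)] card_cycles_comps[OF perm_on_transpose[OF assms]]
  show "card (cycles ?g E) \<le> card (cycles f E) + 1"
    using comps_insert_le[OF fin assms(2,3), of "graph_on f E"] 
      comps_insert_le[OF fin assms(2,3), of "graph_on ?g E"] eq c by simp
  assume *: "(x, y) \<notin> conn (graph_on f E)"
  have "comps E (insert (x, y) (graph_on ?g E)) = comps E (graph_on ?g E)"
    using conn_insert_same[OF transpose_merges[OF assms *]] by (simp add: comps_def)
  then show "card (cycles ?g E) + 1 = card (cycles f E)" 
    using comps_insert[OF fin assms(2,3) *] eq c by simp
qed

lemma perm_on_comp: "perm_on f E \<Longrightarrow> perm_on g E \<Longrightarrow> perm_on (f \<circ> g) E"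
  using bij_betw_trans[of g E E f E] by (auto simp: perm_on_def)

lemma orbit_fixed: "f x = x \<Longrightarrow> orbit f x = {x}"
proof -
  assume "f x = x"
  then have "(f ^^ k) x = x" for k by (induction k) auto
  then show ?thesis by (auto simp: orbit_eq_funpow)
qed

text \<open>
  Induction on the number of points moved by \<open>w\<close>: multiplying \<open>w\<close> by a transposition \<open>(x y)\<close>
  splits off the fixed point \<open>y\<close>. The number of cycles of \<open>b \<circ> w\<close> changes by at most one, and if a
  component is split, then its two halves are merged in \<open>b \<circ> w\<close>.
\<close>

lemma genus_inequality:
  assumes "perm_on b E" "perm_on w E"
  shows "card (cycles b E) + card (cycles w E) + card (cycles (b \<circ> w) E)
    \<le> card E + 2 * comps E (graph_on b E \<union> graph_on w E)"
  using assms(2)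
proof (induction "card {x \<in> E. w x \<noteq> x}" arbitrary: w rule: less_induct)
  case less
  note b = assms(1) and w = less.prems
  have fin: "finite E" using w by (simp add: perm_on_def)
  show ?case
  proof (cases "\<exists>x\<in>E. w x \<noteq> x")
    case False
    \<comment> \<open>For trivial \<open>w\<close> both sides are the size of \<open>E\<close> plus
      twice the number of cycles of \<open>b\<close>.\<close>
    then have id: "\<And>x. x \<in> E \<Longrightarrow> w x = x" by auto
    then have "cycles w E = (\<lambda>x. {x}) ` E" unfolding cycles_def using orbit_fixed[of w] by auto
    then have "card (cycles w E) = card E" by (simp add: card_image)
    moreover have "cycles (b \<circ> w) E = cycles b E" using id by (intro cycles_cong[OF b]) auto
    moreover have "conn (graph_on b E \<union> graph_on w E) = conn (graph_on b E)"
      using id by (intro equalityI conn_mono conn_subset) (auto simp: graph_on_def intro: conn_incl)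
    then have "comps E (graph_on b E \<union> graph_on w E) = card (cycles b E)"
      using card_cycles_comps[OF b] by (simp add: comps_def)
    ultimately show ?thesis by simp
  next
    case True
    then obtain x where x: "x \<in> E" "w x \<noteq> x" by auto
    define y where "y = w x"
    have y: "y \<in> E" "y \<noteq> x" using x perm_on_mem[OF w] by (auto simp: y_def)
    define w' where "w' = w \<circ> transpose x y"
    have w': "perm_on w' E" unfolding w'_def using perm_on_transpose[OF w] x y by auto
    have w_eq: "w = w' \<circ> transpose x y" by (simp add: w'_def fun_eq_iff)
    have w'y: "w' y = y" by (simp add: w'_def y_def)
    have "w y \<noteq> y" using perm_on_eq_iff[OF w x(1) y(1)] y by (simp add: y_def)
    have "{x \<in> E. w' x \<noteq> x} \<subset> {x \<in> E. w x \<noteq> x}"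
    proof
      show "{x \<in> E. w' x \<noteq> x} \<subseteq> {x \<in> E. w x \<noteq> x}"
        using x(2) \<open>w y \<noteq> y\<close> by (auto simp: w'_def transpose_def split: if_splits)
      show "{x \<in> E. w' x \<noteq> x} \<noteq> {x \<in> E. w x \<noteq> x}" using w'y \<open>w y \<noteq> y\<close> y by blast
    qed
    then have IH: "card (cycles b E) + card (cycles w' E) + card (cycles (b \<circ> w') E)
      \<le> card E + 2 * comps E (graph_on b E \<union> graph_on w' E)"
      using less.hyps[of w'] w' fin psubset_card_mono[of "{x \<in> E. w x \<noteq> x}"] by simp
    have "x \<notin> conn (graph_on w' E) `` {y}"
      unfolding conn_graph_on[OF w' y(1)] orbit_fixed[of w' y, OF w'y] using y by simp
    then have "(y, x) \<notin> conn (graph_on w' E)" by simp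
    then have cw: "card (cycles w E) + 1 = card (cycles w' E)"
      using card_cycles_transpose(2)[OF w' x(1) y(1)] conn_sym[of x y] w_eq by auto
    have bw: "b \<circ> w = (b \<circ> w') \<circ> transpose x y" by (simp add: w_eq comp_assoc)
    \<comment> \<open>\<open>w\<close> itself links \<open>x\<close> to \<open>y = w x\<close>, so
      the components for \<open>w\<close> are those for \<open>w'\<close> with the pair
      added.\<close>
    have "(x, y) \<in> conn (graph_on b E \<union> graph_on w E)"
      using x by (intro conn_incl) (auto simp: graph_on_def y_def)
    then have k: "comps E (graph_on b E \<union> graph_on w E) 
        = comps E (insert (x, y) (graph_on b E \<union> graph_on w' E))"
      using conn_insert_same[of x y "graph_on b E \<union> graph_on w E"] 
        conn_graph_transpose[OF x(1) y(1), of "graph_on b E" w] unfolding comps_def w'_def by simp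
    note p = perm_on_comp[OF b w']
    show ?thesis
    proof (cases "(x, y) \<in> conn (graph_on b E \<union> graph_on w' E)")
      case True
      then have "comps E (graph_on b E \<union> graph_on w E) = comps E (graph_on b E \<union> graph_on w' E)"
        using k conn_insert_same[OF True] by (simp add: comps_def)
      moreover have "card (cycles (b \<circ> w) E) \<le> card (cycles (b \<circ> w') E) + 1"
        unfolding bw using card_cycles_transpose(1)[OF p x(1) y(1)] .
      ultimately show ?thesis using IH cw by simp
    next
      case False
      \<comment> \<open>Here a component is lost and the right-hand side drops by 2. On the left
        \<open>w\<close> has one cycle fewer than \<open>w'\<close>, and so has the composite, since
        points in different components lie on different cycles of
        \<open>b \<circ> w'\<close>.\<close>
      have "graph_on (b \<circ> w') E \<subseteq> conn (graph_on b E \<union> graph_on w' E)"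
      proof
        fix e assume "e \<in> graph_on (b \<circ> w') E"
        then obtain z where z: "z \<in> E" "e = (z, b (w' z))" by (auto simp: graph_on_def)
        have "(z, w' z) \<in> conn (graph_on b E \<union> graph_on w' E)"
             "(w' z, b (w' z)) \<in> conn (graph_on b E \<union> graph_on w' E)"
          using z(1) perm_on_mem[OF w' z(1)] by (auto intro!: conn_incl simp: graph_on_def)
        then show "e \<in> conn (graph_on b E \<union> graph_on w' E)" unfolding z(2) by (rule conn_trans)
      qed
      then have "(x, y) \<notin> conn (graph_on (b \<circ> w') E)" using conn_subset False by blast
      then have "card (cycles (b \<circ> w) E) + 1 = card (cycles (b \<circ> w') E)"
        unfolding bw using card_cycles_transpose(2)[OF p x(1) y(1)] by simp
      then show ?thesis using IH cw k comps_insert[OF fin x(1) y(1) False] by simp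
    qed
  qed
qed

section \<open>Maps with one dart selected on each edge\<close>

text \<open>
  Selecting one dart on each edge reduces a map to two permutations of the set \<open>A\<close> of selected darts:
  \<open>vnext\<close> turns around vertices and \<open>fnext\<close> around faces, both skipping the darts outside \<open>A\<close>.
  The figure \<open>star_figure M A\<close> encodes this pair, so that its faces are the cycles of \<open>lnext\<close>.
\<close>

definition vnext :: "('d, 'l, 'z) lmap_scheme \<Rightarrow> 'd set \<Rightarrow> 'd \<Rightarrow> 'd" where
  "vnext M A = next_in (rot M) A"

definition fnext :: "('d, 'l, 'z) lmap_scheme \<Rightarrow> 'd set \<Rightarrow> 'd \<Rightarrow> 'd" where
  "fnext M A = next_in (cw M) A"

definition lnext :: "('d, 'l, 'z) lmap_scheme \<Rightarrow> 'd set \<Rightarrow> 'd \<Rightarrow> 'd" where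
  "lnext M A d = inv_into A (vnext M A) (fnext M A d)"

definition star_figure :: 
    "('d, 'l, 'z) lmap_scheme \<Rightarrow> 'd set \<Rightarrow> ('d starred, 'l option) lmap" where
  "star_figure M A = erase (range Old) (add_stars A M)"

text \<open>Isomorphism of the reduced data. By \<open>star_figure_iso\<close> and
  \<open>star_figure_isoE\<close> it amounts to isomorphism of the star figures.\<close>

definition half_iso :: "('d \<Rightarrow> 'e) \<Rightarrow> ('d, 'l, 'y) lmap_scheme \<Rightarrow> 'd set 
    \<Rightarrow> ('e, 'l, 'z) lmap_scheme \<Rightarrow> 'e set \<Rightarrow> bool" where
  "half_iso h M A M' A' \<longleftrightarrow> bij_betw h A A' \<and>
     (\<forall>d\<in>A. h (vnext M A d) = vnext M' A' (h d) \<and> h (fnext M A d) = fnext M' A' (h d) \<and>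
        lab M' (h d) = lab M d)"

definition half_conn :: "('d, 'l, 'z) lmap_scheme \<Rightarrow> 'd set \<Rightarrow> ('d \<times> 'd) set" where
  "half_conn M A = conn (graph_on (vnext M A) A \<union> graph_on (fnext M A) A)"

text \<open>Connectedness and Euler's relation are kept out, because \<open>hyper_of\<close> and
  \<open>psi_of\<close> are shown to be instances first and planar afterwards.\<close>

locale half_map =
  fixes M :: "('d, 'l, 'z) lmap_scheme" and A :: "'d set"
  assumes fin: "finite (darts M)"
    and bij_rot: "bij_betw (rot M) (darts M) (darts M)"
    and opp: "\<And>d. d \<in> darts M \<Longrightarrow> opp M d \<in> darts M" "\<And>d. d \<in> darts M \<Longrightarrow> opp M (opp M d) = d"
    and lab_rot: "\<And>d. d \<in> darts M \<Longrightarrow> lab M (rot M d) = lab M d"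
    and sub: "A \<subseteq> darts M"
    and opp_iff: "\<And>d. d \<in> darts M \<Longrightarrow> opp M d \<in> A \<longleftrightarrow> d \<notin> A"
begin

lemma darts_mem: "d \<in> A \<Longrightarrow> d \<in> darts M"
  using sub by blast

lemma finA: "finite A"
  using fin sub finite_subset by blast

lemma perm_rot: "perm_on (rot M) (darts M)"
  using fin bij_rot by (simp add: perm_on_def)

lemma perm_opp: "perm_on (opp M) (darts M)"
  by (intro perm_onI fin opp(1) inj_on_inverseI[of _ "opp M"] opp(2))

lemma perm_cw: "perm_on (cw M) (darts M)"
proof -
  have "cw M = rot M \<circ> opp M" by (simp add: cw_def fun_eq_iff)
  then show ?thesis using perm_on_comp[OF perm_rot perm_opp] by simp
qed

lemma perm_vnext: "perm_on (vnext M A) A"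
  unfolding vnext_def using next_in_perm[OF perm_rot sub] .

lemma perm_fnext: "perm_on (fnext M A) A"
  unfolding fnext_def using next_in_perm[OF perm_cw sub] .

lemma perm_lnext: "perm_on (lnext M A) A"
proof -
  have "lnext M A = inv_into A (vnext M A) \<circ> fnext M A" by (simp add: fun_eq_iff lnext_def)
  then show ?thesis using perm_on_comp[OF inv_into_perm[OF perm_vnext] perm_fnext] by simp
qed

lemmas vnext_mem = perm_on_mem[OF perm_vnext]
lemmas fnext_mem = perm_on_mem[OF perm_fnext]
lemmas lnext_mem = perm_on_mem[OF perm_lnext]
lemmas rot_mem = perm_on_mem[OF perm_rot]
lemmas cw_mem = perm_on_mem[OF perm_cw]

lemma vnext_lnext: "d \<in> A \<Longrightarrow> vnext M A (lnext M A d) = fnext M A d"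
  unfolding lnext_def using inv_into_right[OF perm_vnext fnext_mem] .

lemma lab_orbit: "d \<in> darts M \<Longrightarrow> e \<in> orbit (rot M) d \<Longrightarrow> lab M e = lab M d"
  using orbit_invariant[of e "rot M" d "darts M" "lab M"] rot_mem lab_rot by blast

lemma vnext_orbit: "d \<in> A \<Longrightarrow> vnext M A d \<in> orbit (rot M) d"
  unfolding vnext_def using next_in_mem'[OF perm_rot sub] by blast

lemma fnext_orbit: "d \<in> A \<Longrightarrow> fnext M A d \<in> orbit (cw M) d"
  unfolding fnext_def using next_in_mem'[OF perm_cw sub] by blast

lemma lab_vnext: "d \<in> A \<Longrightarrow> lab M (vnext M A d) = lab M d"
  using lab_orbit vnext_orbit sub by blast

lemma lab_lnext: "d \<in> A \<Longrightarrow> lab M (lnext M A d) = lab M (fnext M A d)"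
  using lab_vnext[OF lnext_mem] vnext_lnext by simp

lemma vertices_eq: "vertices M = cycles (rot M) (darts M)"
  by (simp add: vertices_def cycles_def)

lemma faces_eq: "faces M = cycles (cw M) (darts M)"
  by (simp add: faces_def right_face_def[abs_def] cycles_def)

lemma vertexE:
  assumes "v \<in> vertices M" "d \<in> v"
  shows "v = orbit (rot M) d" "d \<in> darts M"
proof -
  show "v = orbit (rot M) d" using assms cycles_eq_orbit[OF perm_rot, of v d] by (simp add: vertices_eq)
  obtain x where "x \<in> darts M" "v = orbit (rot M) x" using assms(1) by (auto simp: vertices_def)
  then show "d \<in> darts M" using orbit_subset_dom[OF perm_rot] assms(2) by blast
qed

lemma faceE:
  assumes "f \<in> faces M" "d \<in> f"
  shows "f = orbit (cw M) d" "d \<in> darts M"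
proof -
  show "f = orbit (cw M) d" using assms cycles_eq_orbit[OF perm_cw, of f d] by (simp add: faces_eq)
  obtain x where "x \<in> darts M" "f = orbit (cw M) x" using assms(1) by (auto simp: faces_eq cycles_def)
  then show "d \<in> darts M" using orbit_subset_dom[OF perm_cw] assms(2) by blast
qed

lemma vertex_of: "d \<in> darts M \<Longrightarrow> orbit (rot M) d \<in> vertices M" "d \<in> darts M \<Longrightarrow> d \<in> orbit (rot M) d"
  using self_mem_orbit[OF perm_rot] by (auto simp: vertices_def)

lemma face_of: "d \<in> darts M \<Longrightarrow> orbit (cw M) d \<in> faces M" "d \<in> darts M \<Longrightarrow> d \<in> orbit (cw M) d"
  using self_mem_orbit[OF perm_cw] by (auto simp: faces_eq cycles_def)

lemma vlab_vertex: "v \<in> vertices M \<Longrightarrow> d \<in> v \<Longrightarrow> vlab M v = lab M d"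
proof -
  assume *: "v \<in> vertices M" "d \<in> v"
  have "lab M e = lab M d" if "e \<in> v" for e
    using lab_orbit[OF vertexE(2)[OF *], of e] vertexE(1)[OF *] that by blast
  then have "lab M ` v = (\<lambda>_. lab M d) ` v" by (rule image_cong[OF refl])
  also have "\<dots> = {lab M d}" using *(2) by (rule image_constant)
  finally have "lab M ` v = {lab M d}" .
  then show ?thesis by (simp add: vlab_def)
qed

lemma card_edges: "card (edges M) = card A"
proof -
  have "bij_betw (\<lambda>d. {d, opp M d}) A (edges M)"
  proof (rule bij_betw_imageI)
    show "inj_on (\<lambda>d. {d, opp M d}) A"
    proof (rule inj_onI)
      fix d e assume *: "d \<in> A" "e \<in> A" "{d, opp M d} = {e, opp M e}"
      then have "opp M e \<notin> A" using opp_iff darts_mem by blast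
      then show "d = e" using * by (auto simp: doubleton_eq_iff)
    qed
    show "(\<lambda>d. {d, opp M d}) ` A = edges M"
    proof (unfold edges_def, intro equalityI subsetI)
      fix x assume "x \<in> (\<lambda>d. {d, opp M d}) ` darts M"
      then obtain d where d: "d \<in> darts M" "x = {d, opp M d}" by auto
      show "x \<in> (\<lambda>d. {d, opp M d}) ` A"
      proof (cases "d \<in> A")
        case False
        then have "opp M d \<in> A" "x = {opp M d, opp M (opp M d)}" using d opp opp_iff by auto
        then show ?thesis by blast
      qed (use d in auto)
    qed (use sub in auto)
  qed
  then show ?thesis using bij_betw_same_card by fastforce
qed

lemma card_cycles_vnext: "card (cycles (vnext M A) A) = card {v \<in> vertices M. v \<inter> A \<noteq> {}}"
  unfolding vnext_def vertices_eq using card_cycles_next_in[OF perm_rot sub] .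

lemma card_cycles_fnext: "card (cycles (fnext M A) A) = card {f \<in> faces M. f \<inter> A \<noteq> {}}"
  unfolding fnext_def faces_eq using card_cycles_next_in[OF perm_cw sub] .

lemma half_conn_vnext: "d \<in> A \<Longrightarrow> (d, vnext M A d) \<in> half_conn M A"
  unfolding half_conn_def by (rule conn_incl) (auto simp: graph_on_def)

lemma half_conn_fnext: "d \<in> A \<Longrightarrow> (d, fnext M A d) \<in> half_conn M A"
  unfolding half_conn_def by (rule conn_incl) (auto simp: graph_on_def)

lemma half_conn_trans: "(x, y) \<in> half_conn M A \<Longrightarrow> (y, z) \<in> half_conn M A \<Longrightarrow> (x, z) \<in> half_conn M A"
  unfolding half_conn_def by (rule conn_trans)

lemma half_conn_sym: "(x, y) \<in> half_conn M A \<Longrightarrow> (y, x) \<in> half_conn M A"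
  unfolding half_conn_def by (rule conn_sym)

lemma half_conn_lnext: "d \<in> A \<Longrightarrow> (d, lnext M A d) \<in> half_conn M A"
  using half_conn_fnext[of d] half_conn_vnext[OF lnext_mem, of d] vnext_lnext[of d]
    half_conn_sym half_conn_trans by metis

text \<open>Reachability in \<open>connected_map\<close> is directed, but a step of
  \<open>vnext\<close> or \<open>fnext\<close> taken in either direction can be realised by going on
  around the vertex or the face. An unselected dart is reached from its reverse.\<close>

lemma connected_mapI:
  assumes "\<And>d e. d \<in> A \<Longrightarrow> e \<in> A \<Longrightarrow> (d, e) \<in> half_conn M A"
  shows "connected_map M"
proof -
  define R where "R = {(x, y). x \<in> darts M \<and> (y = rot M x \<or> y = opp M x)}\<^sup>*"
  have ro: "(x, y) \<in> R" if "x \<in> darts M" "y \<in> orbit (rot M) x" for x y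
    using that(2) orbit_induct_on[OF perm_rot that, of "\<lambda>y. (x, y) \<in> R"]
    unfolding R_def by (auto intro: rtrancl_into_rtrancl)
  have cwR: "(z, cw M z) \<in> R" if "z \<in> darts M" for z
  proof -
    have "(z, opp M z) \<in> R" "(opp M z, cw M z) \<in> R" 
      using that opp unfolding R_def cw_def by auto
    then show ?thesis unfolding R_def by (rule rtrancl_trans)
  qed
  have fo: "(x, y) \<in> R" if "x \<in> darts M" "y \<in> orbit (cw M) x" for x y
  proof (rule orbit_induct_on[OF perm_cw that])
    show "(x, x) \<in> R" by (simp add: R_def)
    fix z assume "z \<in> darts M" "(x, z) \<in> R"
    then show "(x, cw M z) \<in> R" using cwR[of z] unfolding R_def by auto
  qed
  let ?G = "graph_on (vnext M A) A \<union> graph_on (fnext M A) A"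
  have step: "(d, e) \<in> R" if "(d, e) \<in> ?G \<union> ?G\<inverse>" for d e
  proof -
    from that consider "d \<in> A" "e = vnext M A d" | "e \<in> A" "d = vnext M A e" 
        | "d \<in> A" "e = fnext M A d" | "e \<in> A" "d = fnext M A e"
      by (auto simp: graph_on_def)
    then show ?thesis
    proof cases
      case 1 then show ?thesis using ro vnext_orbit sub by blast
    next
      case 2 then show ?thesis using ro[of d e] vnext_orbit[of e] orbit_sym_on[OF perm_rot, of e d] sub vnext_mem by blast
    next
      case 3 then show ?thesis using fo fnext_orbit sub by blast
    next
      case 4 then show ?thesis using fo[of d e] fnext_orbit[of e] orbit_sym_on[OF perm_cw, of e d] sub fnext_mem by blast
    qed
  qed
  have AR: "(d, e) \<in> R" if "d \<in> A" "e \<in> A" for d e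
  proof -
    have "(d, e) \<in> conn (graph_on (vnext M A) A \<union> graph_on (fnext M A) A)" 
      using assms[OF that] by (simp add: half_conn_def)
    then show ?thesis unfolding conn_def
    proof (induction rule: rtrancl_induct)
      case base
      then show ?case by (simp add: R_def)
    next
      case (step y z)
      then show ?case using \<open>\<And>e d. (d, e) \<in> ?G \<union> ?G\<inverse> \<Longrightarrow> (d, e) \<in> R\<close>[of y z] 
        unfolding R_def by (meson rtrancl_trans)
    qed
  qed
  have op: "(x, opp M x) \<in> R" if "x \<in> darts M" for x using that unfolding R_def by auto
  have "(d, e) \<in> R" if de: "d \<in> darts M" "e \<in> darts M" for d e
  proof -
    obtain d' where d': "d' \<in> A" "(d, d') \<in> R"
      using op[OF de(1)] opp_iff[OF de(1)] by (cases "d \<in> A") (auto simp: R_def)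
    obtain e' where e': "e' \<in> A" "(e', e) \<in> R"
    proof (cases "e \<in> A")
      case True
      then show ?thesis using that[of e] by (simp add: R_def)
    next
      case False
      then show ?thesis 
        using that[of "opp M e"] op[of "opp M e"] opp[OF de(2)] opp_iff[OF de(2)] by simp
    qed
    show ?thesis using d'(2) AR[OF d'(1) e'(1)] e'(2) unfolding R_def by (meson rtrancl_trans)
  qed
  then show ?thesis unfolding connected_map_def R_def by blast
qed

text \<open>Each dart is represented by the selected dart of its edge. Steps along
  \<open>opp\<close> then do not move the representative, and only the rotation steps have to be
  checked.\<close>

lemma half_connI:
  assumes "connected_map M" "d \<in> A" "e \<in> A"
    and step: "\<And>x. x \<in> darts M \<Longrightarrow>
      (if x \<in> A then x else opp M x, if rot M x \<in> A then rot M x else opp M (rot M x)) \<in> half_conn M A"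
  shows "(d, e) \<in> half_conn M A"
proof -
  let ?k = "\<lambda>x. if x \<in> A then x else opp M x"
  have "(d, e) \<in> {(x, y). x \<in> darts M \<and> (y = rot M x \<or> y = opp M x)}\<^sup>*"
    using assms sub unfolding connected_map_def by blast
  then have "(?k d, ?k e) \<in> half_conn M A"
  proof (induction rule: rtrancl_induct)
    case base
    then show ?case by (simp add: half_conn_def)
  next
    case (step y z)
    then consider "y \<in> darts M" "z = rot M y" | "y \<in> darts M" "z = opp M y" by auto
    then show ?case
    proof cases
      case 1
      then show ?thesis using assms(4)[of y] step.IH half_conn_trans by blast
    next
      case 2
      then have "?k z = ?k y" using opp[of y] opp_iff[of y] by auto
      then show ?thesis using step.IH by simp
    qed
  qed
  then show ?thesis using assms by simp
qed

text \<open>\<open>lnext\<close> is the composite of \<open>fnext\<close> and the inverse of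
  \<open>vnext\<close>; with a single component the genus inequality has the constant 2.\<close>

lemma genus:
  assumes "A \<noteq> {}" "\<And>d e. d \<in> A \<Longrightarrow> e \<in> A \<Longrightarrow> (d, e) \<in> half_conn M A"
  shows "card (cycles (vnext M A) A) + card (cycles (fnext M A) A) + card (cycles (lnext M A) A)
    \<le> card A + 2"
proof -
  let ?w = "inv_into A (vnext M A)"
  have "lnext M A = ?w \<circ> fnext M A" by (simp add: fun_eq_iff lnext_def)
  moreover have "comps A (graph_on ?w A \<union> graph_on (fnext M A) A) = 1"
  proof -
    let ?R = "graph_on ?w A \<union> graph_on (fnext M A) A"
    have "(d, e) \<in> conn ?R" if "d \<in> A" "e \<in> A" for d e
    proof -
      have "(x, vnext M A x) \<in> conn ?R" if "x \<in> A" for x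
      proof -
        have "(vnext M A x, ?w (vnext M A x)) \<in> ?R" 
          using vnext_mem[OF that] by (auto simp: graph_on_def)
        then show ?thesis using conn_sym[OF conn_incl] inv_into_left[OF perm_vnext that] by metis
      qed
      then have "graph_on (vnext M A) A \<union> graph_on (fnext M A) A \<subseteq> conn ?R" 
        by (auto simp: graph_on_def intro: conn_incl)
      then show ?thesis using conn_subset assms(2)[OF that] unfolding half_conn_def by blast
    qed
    then have *: "conn ?R `` {d} = conn ?R `` {e}" if "d \<in> A" "e \<in> A" for d e
      using conn_class_eq[of ?R d e] that by simp
    obtain a where a: "a \<in> A" using assms(1) by auto
    have "(\<lambda>x. conn ?R `` {x}) ` A = (\<lambda>_. conn ?R `` {a}) ` A"
      using *[OF _ a] by (rule image_cong[OF refl])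
    also have "\<dots> = {conn ?R `` {a}}" using a by (rule image_constant)
    finally have "(\<lambda>x. conn ?R `` {x}) ` A = {conn ?R `` {a}}" .
    then show ?thesis by (simp add: comps_def)
  qed
  ultimately show ?thesis
    using genus_inequality[OF inv_into_perm[OF perm_vnext] perm_fnext] 
      cycles_inv_into[OF perm_vnext] by simp
qed

section \<open>The rotation of the star figure\<close>

lemma darts_star_figure: "darts (star_figure M A) = White ` A \<union> Black ` A"
  unfolding star_figure_def erase_def add_stars_def by auto

lemma opp_star_figure: "opp (star_figure M A) (White d) = Black d" "opp (star_figure M A) (Black d) = White d"
  unfolding star_figure_def erase_def add_stars_def by auto

lemma lab_star_figure: "lab (star_figure M A) (White d) = Some (lab M d)" "lab (star_figure M A) (Black d) = None"
  unfolding star_figure_def erase_def add_stars_def by auto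

lemma rot_star_figure: 
  "rot (star_figure M A) x = next_in (rot (add_stars A M)) (White ` A \<union> Black ` A) x"
proof -
  have "darts (add_stars A M) - range Old = White ` A \<union> Black ` A" by (auto simp: add_stars_def)
  then show ?thesis by (simp add: star_figure_def erase_def)
qed

lemma rot_star_White:
  assumes "d \<in> A"
  shows "rot (star_figure M A) (White d) = White (vnext M A d)"
proof -
  let ?r = "rot (add_stars A M)" and ?X = "White ` A \<union> Black ` A"
  have r: "?r (White d) = Old d" "?r (Old d) = (if rot M d \<in> A then White (rot M d) else Old (rot M d))" for d
    by (auto simp: add_stars_def)
  have "orbit (rot M) d \<inter> A \<noteq> {}" using assms vertex_of darts_mem by blast
  then obtain k where k: "0 < k" "vnext M A d = (rot M ^^ k) d" "(rot M ^^ k) d \<in> A" 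
      "\<And>j. 0 < j \<Longrightarrow> j < k \<Longrightarrow> (rot M ^^ j) d \<notin> A"
    by (rule next_in_obtain_orbit) (rule that; (assumption | simp add: vnext_def))
  \<comment> \<open>The first step leads from \<open>White d\<close> to \<open>Old d\<close>, which
    delays the position by one with respect to \<open>rot M\<close>.\<close>
  have *: "(?r ^^ Suc j) (White d) = Old ((rot M ^^ j) d)" if "j < k" for j
    using that
  proof (induction j)
    case (Suc j)
    then show ?case using k(4)[of "Suc j"] r(2)[of "(rot M ^^ j) d"] by simp
  qed (simp add: r)
  have last: "(?r ^^ Suc k) (White d) = White ((rot M ^^ k) d)"
    using *[of "k - 1"] k(1,3) r(2)[of "(rot M ^^ (k - 1)) d"] by (cases k) simp_all
  have "next_in ?r ?X (White d) = (?r ^^ Suc k) (White d)"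
  proof (rule next_in_eqI)
    show "(?r ^^ Suc k) (White d) \<in> ?X" using last k(3) by simp
    fix j assume "0 < j" "j < Suc k"
    then show "(?r ^^ j) (White d) \<notin> ?X" using *[of "j - 1"] by auto
  qed simp
  then show ?thesis using last k(2) by (simp add: rot_star_figure)
qed

lemma rot_star_Black:
  assumes "d \<in> A"
  shows "rot (star_figure M A) (Black (fnext M A d)) = Black d"
proof -
  have "next_in (inv_into (darts M) (cw M)) A (fnext M A d) = d"
    using next_in_inv_into[OF perm_cw sub assms] by (simp add: fnext_def)
  then have "rot (add_stars A M) (Black (fnext M A d)) = Black d" by (simp add: add_stars_def)
  then show ?thesis using assms by (simp add: rot_star_figure next_in_step)
qed

end

section \<open>Isomorphisms of star figures and of the reduced data\<close>

lemma half_iso_sym: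
  assumes "half_map M A" "half_iso h M A M' A'"
  shows "half_iso (inv_into A h) M' A' M A"
proof -
  interpret half_map M A by fact
  have h: "bij_betw h A A'" and hd: "\<And>d. d \<in> A \<Longrightarrow> h (vnext M A d) = vnext M' A' (h d) 
      \<and> h (fnext M A d) = fnext M' A' (h d) \<and> lab M' (h d) = lab M d"
    using assms(2) by (auto simp: half_iso_def)
  show ?thesis unfolding half_iso_def
  proof (intro conjI ballI)
    show "bij_betw (inv_into A h) A' A" using bij_betw_inv_into[OF h] .
    fix d' assume "d' \<in> A'"
    then obtain d where d: "d \<in> A" "d' = h d" using h by (auto simp: bij_betw_def)
    have i: "inv_into A h (h e) = e" if "e \<in> A" for e using bij_betw_inv_into_left[OF h that] .
    show "inv_into A h (vnext M' A' d') = vnext M A (inv_into A h d')"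
      using hd[OF d(1)] i[OF d(1)] i[OF vnext_mem[OF d(1)]] d(2) by metis
    show "inv_into A h (fnext M' A' d') = fnext M A (inv_into A h d')"
      using hd[OF d(1)] i[OF d(1)] i[OF fnext_mem[OF d(1)]] d(2) by metis
    show "lab M (inv_into A h d') = lab M' d'" using hd[OF d(1)] i[OF d(1)] d(2) by metis
  qed
qed

lemma half_iso_trans:
  assumes "half_iso h M A M' A'" "half_iso h' M' A' M'' A''"
  shows "half_iso (h' \<circ> h) M A M'' A''"
  using assms bij_betw_trans[of h A A' h' A''] bij_betwE[of h A A'] unfolding half_iso_def by auto

lemma half_iso_lnext:
  assumes "half_map M A" "half_map M' A'" "half_iso h M A M' A'" "d \<in> A"
  shows "h (lnext M A d) = lnext M' A' (h d)"
proof -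
  interpret m: half_map M A by fact
  interpret m': half_map M' A' by fact
  have hd: "d \<in> A \<Longrightarrow> h d \<in> A' \<and> h (vnext M A d) = vnext M' A' (h d) \<and> h (fnext M A d) = fnext M' A' (h d)" for d
    using assms(3) bij_betwE unfolding half_iso_def by blast
  have "vnext M' A' (h (lnext M A d)) = vnext M' A' (lnext M' A' (h d))"
    using hd[OF assms(4)] hd[OF m.lnext_mem[OF assms(4)]] m.vnext_lnext[OF assms(4)]
      m'.vnext_lnext[of "h d"] by simp
  then show ?thesis
    using perm_on_eq_iff[OF m'.perm_vnext] hd m.lnext_mem[OF assms(4)] m'.lnext_mem assms(4) by blast
qed

lemma star_figure_iso:
  assumes "half_map M A" "half_map M' A'" "half_iso h M A M' A'"
  shows "lmap_iso (\<lambda>x. case x of White d \<Rightarrow> White (h d) | Black d \<Rightarrow> Black (h d) | Old d \<Rightarrow> Old (h d))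
    (star_figure M A) (star_figure M' A')" (is "lmap_iso ?g _ _")
proof -
  interpret m: half_map M A by fact
  interpret m': half_map M' A' by fact
  have h: "bij_betw h A A'" and hd: "\<And>d. d \<in> A \<Longrightarrow> h (vnext M A d) = vnext M' A' (h d) 
      \<and> h (fnext M A d) = fnext M' A' (h d) \<and> lab M' (h d) = lab M d"
    using assms(3) by (auto simp: half_iso_def)
  have hA: "h ` A = A'" "inj_on h A" "\<And>d. d \<in> A \<Longrightarrow> h d \<in> A'" using h by (auto simp: bij_betw_def)
  show ?thesis unfolding lmap_iso_def m.darts_star_figure m'.darts_star_figure
  proof (intro conjI)
    show "bij_betw ?g (White ` A \<union> Black ` A) (White ` A' \<union> Black ` A')"
    proof (rule bij_betw_imageI)
      have "h x = h y \<longleftrightarrow> x = y" if "x \<in> A" "y \<in> A" for x y using inj_on_eq_iff[OF hA(2) that] .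
      then show "inj_on ?g (White ` A \<union> Black ` A)" unfolding inj_on_def by fastforce
      show "?g ` (White ` A \<union> Black ` A) = White ` A' \<union> Black ` A'"
        by (simp add: image_Un image_image flip: hA(1))
    qed
    have b: "?g (rot (star_figure M A) (Black d)) = rot (star_figure M' A') (?g (Black d))" if "d \<in> A" for d
    proof -
      obtain e where e: "e \<in> A" "d = fnext M A e" 
        using perm_on_surj[OF m.perm_fnext \<open>d \<in> A\<close>] by blast
      then show ?thesis using m.rot_star_Black[of e] m'.rot_star_Black[of "h e"] hd[of e] hA(3) by simp
    qed
    show "\<forall>d\<in>White ` A \<union> Black ` A. ?g (rot (star_figure M A) d) = rot (star_figure M' A') (?g d) \<and>
       ?g (opp (star_figure M A) d) = opp (star_figure M' A') (?g d) \<and> 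
       lab (star_figure M' A') (?g d) = lab (star_figure M A) d"
      using b hA(3) hd
      by (auto simp: m.opp_star_figure m'.opp_star_figure m.lab_star_figure m'.lab_star_figure
          m.rot_star_White m'.rot_star_White)
  qed
qed

text \<open>Only black half-edges carry the label \<open>None\<close>, so an isomorphism maps white
  half-edges to white ones; commuting with \<open>opp\<close>, it acts on the black ones by the same
  map of darts.\<close>

lemma star_figure_isoE:
  assumes "half_map M A" "half_map M' A'" "lmap_iso g (star_figure M A) (star_figure M' A')"
  obtains h where "half_iso h M A M' A'" 
    "\<And>d. d \<in> A \<Longrightarrow> g (White d) = White (h d)" "\<And>d. d \<in> A \<Longrightarrow> g (Black d) = Black (h d)"
proof -
  interpret m: half_map M A by fact
  interpret m': half_map M' A' by fact
  let ?S = "star_figure M A" and ?S' = "star_figure M' A'"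
  have bij: "bij_betw g (White ` A \<union> Black ` A) (White ` A' \<union> Black ` A')" 
    and gd: "\<And>x. x \<in> White ` A \<union> Black ` A \<Longrightarrow>
      g (rot ?S x) = rot ?S' (g x) \<and> g (opp ?S x) = opp ?S' (g x) \<and> lab ?S' (g x) = lab ?S x"
    using assms(3) unfolding lmap_iso_def m.darts_star_figure m'.darts_star_figure by auto
  have "\<exists>e\<in>A'. g (White d) = White e" if "d \<in> A" for d
  proof -
    have "g (White d) \<in> White ` A' \<union> Black ` A'" using that bij by (auto simp: bij_betw_def)
    moreover have "lab ?S' (g (White d)) \<noteq> None" using gd[of "White d"] that by (simp add: m.lab_star_figure)
    ultimately show ?thesis by (auto simp: m'.lab_star_figure)
  qed
  then obtain h where h: "\<And>d. d \<in> A \<Longrightarrow> h d \<in> A' \<and> g (White d) = White (h d)" by metis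
  have hB: "g (Black d) = Black (h d)" if "d \<in> A" for d
    using gd[of "White d"] h[OF that] that by (simp add: m.opp_star_figure m'.opp_star_figure)
  have "bij_betw h A A'"
  proof (rule bij_betw_imageI)
    show "inj_on h A"
    proof (rule inj_onI)
      fix x y assume "x \<in> A" "y \<in> A" "h x = h y"
      then have "g (White x) = g (White y)" using h by simp
      then show "x = y" using bij \<open>x \<in> A\<close> \<open>y \<in> A\<close> unfolding bij_betw_def by (auto dest: inj_onD)
    qed
    show "h ` A = A'"
    proof (intro equalityI subsetI)
      fix e assume "e \<in> A'"
      then have "White e \<in> g ` (White ` A \<union> Black ` A)" using bij by (auto simp: bij_betw_def)
      then show "e \<in> h ` A" using h hB by auto
    qed (use h in auto)
  qed
  moreover have "h (vnext M A d) = vnext M' A' (h d) \<and> h (fnext M A d) = fnext M' A' (h d) \<and>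
      lab M' (h d) = lab M d" if "d \<in> A" for d
  proof (intro conjI)
    have "White (h (vnext M A d)) = White (vnext M' A' (h d))"
      using gd[of "White d"] that h[OF that] h[OF m.vnext_mem[OF that]] 
        m.rot_star_White[OF that] m'.rot_star_White[of "h d"] by simp
    then show "h (vnext M A d) = vnext M' A' (h d)" by simp
    have f: "fnext M A d \<in> A" using m.fnext_mem[OF that] .
    obtain e where e: "e \<in> A'" "h (fnext M A d) = fnext M' A' e"
      using perm_on_surj[OF m'.perm_fnext] h[OF f] by blast
    have "g (Black d) = rot ?S' (g (Black (fnext M A d)))"
      using gd[of "Black (fnext M A d)"] f m.rot_star_Black[OF that] by simp
    then have "Black (h d) = Black e" using hB[OF that] hB[OF f] e m'.rot_star_Black[OF e(1)] by simp
    then show "h (fnext M A d) = fnext M' A' (h d)" using e by simp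
    show "lab M' (h d) = lab M d" using gd[of "White d"] that h[OF that] 
      by (simp add: m.lab_star_figure m'.lab_star_figure)
  qed
  ultimately have "half_iso h M A M' A'" unfolding half_iso_def by blast
  then show thesis using that h hB by blast
qed

lemma half_iso_of_lmap_iso:
  assumes "half_map M A" "half_map M' A'" "lmap_iso g M M'" "g ` A = A'"
  shows "half_iso g M A M' A'"
proof -
  interpret m: half_map M A by fact
  interpret m': half_map M' A' by fact
  have bij: "inj_on g (darts M)" and g: "\<And>d. d \<in> darts M \<Longrightarrow> g (rot M d) = rot M' (g d) \<and>
      g (opp M d) = opp M' (g d) \<and> lab M' (g d) = lab M d"
    using assms(3) unfolding lmap_iso_def bij_betw_def by auto
  show ?thesis unfolding half_iso_def
  proof (intro conjI ballI)
    show "bij_betw g A A'" using assms(4) bij m.sub by (auto simp: bij_betw_def inj_on_subset)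
    fix d assume "d \<in> A"
    then have d: "d \<in> darts M" using m.sub by blast
    show "g (vnext M A d) = vnext M' A' (g d)" unfolding vnext_def assms(4)[symmetric]
      by (rule next_in_conj[OF _ bij m.sub d]) (use g m.rot_mem in auto)
    show "g (fnext M A d) = fnext M' A' (g d)" unfolding fnext_def assms(4)[symmetric]
      by (rule next_in_conj[OF _ bij m.sub d]) (use g m.cw_mem m.opp in \<open>auto simp: cw_def\<close>)
    show "lab M' (g d) = lab M d" using g d by simp
  qed
qed

lemma lmap_iso_sym:
  assumes "half_map M A" "lmap_iso g M M'"
  shows "lmap_iso (inv_into (darts M) g) M' M"
proof -
  interpret half_map M A by fact
  have bij: "bij_betw g (darts M) (darts M')" and g: "\<And>d. d \<in> darts M \<Longrightarrow> g (rot M d) = rot M' (g d) \<and>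
      g (opp M d) = opp M' (g d) \<and> lab M' (g d) = lab M d"
    using assms(2) unfolding lmap_iso_def by auto
  show ?thesis unfolding lmap_iso_def
  proof (intro conjI ballI)
    show "bij_betw (inv_into (darts M) g) (darts M') (darts M)" using bij_betw_inv_into[OF bij] .
    fix d' assume "d' \<in> darts M'"
    then obtain d where d: "d \<in> darts M" "d' = g d" using bij by (auto simp: bij_betw_def)
    have i: "inv_into (darts M) g (g e) = e" if "e \<in> darts M" for e 
      using bij_betw_inv_into_left[OF bij that] .
    show "inv_into (darts M) g (rot M' d') = rot M (inv_into (darts M) g d')"
      using g[OF d(1)] i[OF d(1)] i[OF rot_mem[OF d(1)]] d(2) by metis
    show "inv_into (darts M) g (opp M' d') = opp M (inv_into (darts M) g d')"
      using g[OF d(1)] i[OF d(1)] i[OF opp(1)[OF d(1)]] d(2) by metis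
    show "lab M (inv_into (darts M) g d') = lab M' d'" using g[OF d(1)] i[OF d(1)] d(2) by metis
  qed
qed

lemma lmap_iso_trans:
  assumes "lmap_iso g M M'" "lmap_iso g' M' M''"
  shows "lmap_iso (g' \<circ> g) M M''"
  using assms bij_betw_trans[of g "darts M" "darts M'" g' "darts M''"] bij_betwE[of g "darts M"] 
  unfolding lmap_iso_def by auto

text \<open>The only extension to all darts of a map of the selected ones that can commute with
  \<open>opp\<close>. The uniqueness theorems for maps and for hypermaps amount to showing that it
  also respects rotation and labels.\<close>

definition extend_half :: "('d \<Rightarrow> 'e) \<Rightarrow> ('d, 'l, 'y) lmap_scheme \<Rightarrow> 'd set \<Rightarrow> ('e, 'l, 'z) lmap_scheme
    \<Rightarrow> 'd \<Rightarrow> 'e" where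
  "extend_half h M A M' x = (if x \<in> A then h x else opp M' (h (opp M x)))"

lemma extend_half:
  assumes "half_map M A" "half_map M' A'" "bij_betw h A A'"
  defines "g \<equiv> extend_half h M A M'"
  shows "\<And>x. x \<in> A \<Longrightarrow> g x = h x"
    and "\<And>x. x \<in> A \<Longrightarrow> g (opp M x) = opp M' (h x)"
    and "\<And>x. x \<in> darts M \<Longrightarrow> g (opp M x) = opp M' (g x)"
    and "bij_betw g (darts M) (darts M')"
proof -
  interpret m: half_map M A by fact
  interpret m': half_map M' A' by fact
  have hA: "h ` A = A'" "inj_on h A" "\<And>d. d \<in> A \<Longrightarrow> h d \<in> A'" 
    using assms(3) by (auto simp: bij_betw_def)
  show gA: "g x = h x" if "x \<in> A" for x using that by (simp add: g_def extend_half_def)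
  show gO: "g (opp M x) = opp M' (h x)" if "x \<in> A" for x
    using that m.opp_iff[OF m.darts_mem] m.opp(2)[OF m.darts_mem] by (simp add: g_def extend_half_def)
  have DO: "\<exists>y\<in>A. x = opp M y" if "x \<in> darts M" "x \<notin> A" for x
    using that m.opp_iff[OF that(1)] m.opp(2)[OF that(1)] by (intro bexI[of _ "opp M x"]) auto
  have DO': "\<exists>y\<in>A'. x = opp M' y" if "x \<in> darts M'" "x \<notin> A'" for x
    using that m'.opp_iff[OF that(1)] m'.opp(2)[OF that(1)] by (intro bexI[of _ "opp M' x"]) auto
  have oh: "opp M' (opp M' (h y)) = h y" "opp M' (h y) \<in> darts M'" "opp M' (h y) \<notin> A'" if "y \<in> A" for y
    using m'.opp m'.opp_iff m'.darts_mem hA(3)[OF that] by auto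
  show "g (opp M x) = opp M' (g x)" if x: "x \<in> darts M" for x
  proof (cases "x \<in> A")
    case False
    then obtain y where y: "y \<in> A" "x = opp M y" using DO[OF x] by blast
    then show ?thesis using gO[OF y(1)] gA[OF y(1)] oh(1)[OF y(1)] m.opp(2)[OF m.darts_mem] by simp
  qed (simp add: gO gA)
  have giff: "g x \<in> A' \<longleftrightarrow> x \<in> A" if x: "x \<in> darts M" for x
  proof (cases "x \<in> A")
    case False
    then obtain y where y: "y \<in> A" "x = opp M y" using DO[OF x] by blast
    then show ?thesis using gO[OF y(1)] oh(3)[OF y(1)] False by simp
  qed (simp add: gA hA(3))
  show "bij_betw g (darts M) (darts M')"
  proof (rule bij_betw_imageI)
    show "inj_on g (darts M)"
    proof (rule inj_onI)
      fix x y assume xy: "x \<in> darts M" "y \<in> darts M" "g x = g y"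
      show "x = y"
      proof (cases "x \<in> A")
        case True
        then have "y \<in> A" using giff[OF xy(1)] giff[OF xy(2)] xy(3) by simp
        then show ?thesis using True xy(3) gA inj_onD[OF hA(2)] by simp
      next
        case False
        then have "y \<notin> A" using giff[OF xy(1)] giff[OF xy(2)] xy(3) by simp
        then obtain x' y' where *: "x' \<in> A" "x = opp M x'" "y' \<in> A" "y = opp M y'"
          using DO[OF xy(1) False] DO[OF xy(2)] by blast
        have "opp M' (h x') = g x" using gO[OF *(1)] *(2) by simp
        also have "\<dots> = opp M' (h y')" using gO[OF *(3)] *(4) xy(3) by simp
        finally have "h x' = h y'" using oh(1)[OF *(1)] oh(1)[OF *(3)] by metis
        then show ?thesis using inj_onD[OF hA(2)] * by blast
      qed
    qed
    show "g ` darts M = darts M'"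
    proof (intro equalityI subsetI)
      fix x assume "x \<in> g ` darts M"
      then obtain z where z: "z \<in> darts M" "x = g z" by blast
      show "x \<in> darts M'"
      proof (cases "z \<in> A")
        case True
        then show ?thesis using z gA hA(3) m'.darts_mem by simp
      next
        case False
        then obtain y where "y \<in> A" "z = opp M y" using DO[OF z(1)] by blast
        then show ?thesis using z(2) gO oh(2) by simp
      qed
    next
      fix y assume y: "y \<in> darts M'"
      show "y \<in> g ` darts M"
      proof (cases "y \<in> A'")
        case True
        then obtain x where "x \<in> A" "y = h x" using hA(1) by blast
        then show ?thesis using gA m.darts_mem by (intro image_eqI[of _ _ x]) auto
      next
        case False
        then obtain x where x: "x \<in> A" "y = opp M' (h x)" using hA(1) DO'[OF y] by blast
        then have "y = g (opp M x)" "opp M x \<in> darts M" using gO m.opp(1) m.darts_mem by auto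
        then show ?thesis by blast
      qed
    qed
  qed
qed

context half_map
begin

lemma neighbour_iff:
  assumes "u \<in> vertices M"
  shows "(\<forall>v. neighbour M u v \<longrightarrow> P (vlab M v)) \<longleftrightarrow> (\<forall>d\<in>u. P (lab M (opp M d)))"
proof (intro iffI allI ballI impI)
  fix d assume *: "\<forall>v. neighbour M u v \<longrightarrow> P (vlab M v)" "d \<in> u"
  let ?v = "orbit (rot M) (opp M d)"
  have "opp M d \<in> darts M" using vertexE(2)[OF assms *(2)] opp by blast
  then have v: "?v \<in> vertices M" "opp M d \<in> ?v" using vertex_of by auto
  then show "P (lab M (opp M d))" using * vlab_vertex[OF v] unfolding neighbour_def by metis
next
  fix v assume "\<forall>d\<in>u. P (lab M (opp M d))" "neighbour M u v"
  then show "P (vlab M v)" unfolding neighbour_def using vlab_vertex[of v] by auto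
qed

end

section \<open>Suitably labelled maps\<close>

locale suit_map =
  fixes B :: "('d, int, 'z) lmap_scheme"
  assumes suit: "suitably_labelled B"

sublocale suit_map \<subseteq> half_map B "descending B"
proof
  have *: "\<And>d. d \<in> darts B \<Longrightarrow> \<bar>lab B d - lab B (opp B d)\<bar> = 1"
    and p: "planar_map B" using suit by (auto simp: suitably_labelled_def)
  show "finite (darts B)" "bij_betw (rot B) (darts B) (darts B)"
    "\<And>d. d \<in> darts B \<Longrightarrow> opp B d \<in> darts B" "\<And>d. d \<in> darts B \<Longrightarrow> opp B (opp B d) = d"
    "\<And>d. d \<in> darts B \<Longrightarrow> lab B (rot B d) = lab B d"
    using p by (auto simp: planar_map_def)
  then show "\<And>d. d \<in> darts B \<Longrightarrow> opp B d \<in> descending B \<longleftrightarrow> d \<notin> descending B"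
    using * by (fastforce simp: descending_def)
  show "descending B \<subseteq> darts B" by (auto simp: descending_def)
qed

context suit_map
begin

abbreviation "A \<equiv> descending B"

lemma planar: "planar_map B" 
  using suit by (simp add: suitably_labelled_def)

lemma nonempty: "A \<noteq> {}"
proof -
  obtain d where "d \<in> darts B" using planar by (auto simp: planar_map_def)
  then show ?thesis using opp_iff[of d] by blast
qed

lemma lab_opp: "d \<in> A \<Longrightarrow> lab B (opp B d) = lab B d - 1"
  by (simp add: descending_def)

lemma lab_opp': "d \<in> darts B \<Longrightarrow> d \<notin> A \<Longrightarrow> lab B (opp B d) = lab B d + 1"
  using opp_iff[of d] opp[of d] by (auto simp: descending_def)

lemma local_min_iff: "v \<in> vertices B \<Longrightarrow> local_min B v \<longleftrightarrow> v \<inter> A = {}"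
proof -
  assume v: "v \<in> vertices B"
  have "local_min B v \<longleftrightarrow> (\<forall>d\<in>v. vlab B v < lab B (opp B d))"
    unfolding local_min_def using neighbour_iff[OF v, of "\<lambda>k. vlab B v < k"] by simp
  also have "\<dots> \<longleftrightarrow> (\<forall>d\<in>v. d \<notin> A)"
    using lab_opp lab_opp' vlab_vertex[OF v] vertexE(2)[OF v] by (intro ball_cong) force+
  finally show ?thesis by blast
qed

lemma local_max_iff: "v \<in> vertices B \<Longrightarrow> local_max B v \<longleftrightarrow> v \<subseteq> A"
proof -
  assume v: "v \<in> vertices B"
  have "local_max B v \<longleftrightarrow> (\<forall>d\<in>v. lab B (opp B d) < vlab B v)"
    unfolding local_max_def using neighbour_iff[OF v, of "\<lambda>k. k < vlab B v"] by simp
  also have "\<dots> \<longleftrightarrow> (\<forall>d\<in>v. d \<in> A)"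
    using lab_opp lab_opp' vlab_vertex[OF v] vertexE(2)[OF v] by (intro ball_cong) force+
  finally show ?thesis by blast
qed

text \<open>
  \<open>last_desc x\<close> is the last descending dart at or before \<open>x\<close> around its origin, which must not be
  a local min vertex. Iterating \<open>parent\<close> follows the leftmost descending path.
\<close>

definition last_desc :: "'d \<Rightarrow> 'd" where
  "last_desc x = (if orbit (rot B) x \<inter> A \<noteq> {} 
     then inv_into A (vnext B A) (next_in (rot B) A x) else undefined)"

definition parent :: "'d \<Rightarrow> 'd" where
  "parent p = last_desc (opp B p)"

text \<open>\<open>next_in\<close> looks strictly beyond \<open>p\<close>, so the
  \<open>vnext\<close>-predecessor of its result is \<open>p\<close> itself; this is what makes
  \<open>last_desc\<close> inclusive.\<close>

lemma last_desc_self: "p \<in> A \<Longrightarrow> last_desc p = p"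
  using vertex_of(2)[OF darts_mem] inv_into_left[OF perm_vnext]
  by (auto simp: last_desc_def vnext_def)

text \<open>At a local min vertex both sides are the default value. Since this value is fixed, the
  rule, and with it \<open>parent_run\<close>, holds there as well.\<close>

lemma last_desc_skip: 
  assumes "x \<in> darts B" "rot B x \<notin> A"
  shows "last_desc (rot B x) = last_desc x"
  using orbit_step_on[OF perm_rot assms(1)] next_in_skip[of "rot B" x A] assms
  by (simp add: last_desc_def)

lemma last_desc_before: "rot B x \<in> A \<Longrightarrow> last_desc x = inv_into A (vnext B A) (rot B x)"
  using orbit.base[of "rot B" x] next_in_step[of "rot B" x A] by (auto simp: last_desc_def)

lemma last_desc_mem:
  assumes "x \<in> darts B" "orbit (rot B) x \<inter> A \<noteq> {}"
  shows "last_desc x \<in> A" "last_desc x \<in> orbit (rot B) x"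
proof -
  let ?n = "next_in (rot B) A x"
  have n: "?n \<in> orbit (rot B) x \<inter> A" using next_in_mem[OF assms(2)] .
  have t: "last_desc x = inv_into A (vnext B A) ?n" using assms(2) by (simp add: last_desc_def)
  show m: "last_desc x \<in> A" using inv_into_mem[OF perm_vnext] n t by simp
  have "?n \<in> orbit (rot B) (last_desc x)" 
    using vnext_orbit[OF m] inv_into_right[OF perm_vnext] n t by simp
  then have "last_desc x \<in> orbit (rot B) ?n" using orbit_sym_on[OF perm_rot darts_mem[OF m]] by blast
  then show "last_desc x \<in> orbit (rot B) x" using n orbit_trans by (metis IntD1)
qed

text \<open>
  From a descending dart \<open>e\<close>, the contour of the face to the right of \<open>e\<close> ascends until the next
  descending dart; the reversed ascending darts form a path for \<open>parent\<close>.
\<close>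

definition run :: "'d \<Rightarrow> nat" where
  "run e = nat (lab B (fnext B A e) - lab B e + 2)"

lemma lab_cw: "x \<in> A \<Longrightarrow> lab B (cw B x) = lab B x - 1" 
  "x \<in> darts B \<Longrightarrow> x \<notin> A \<Longrightarrow> lab B (cw B x) = lab B x + 1"
  using lab_opp[of x] lab_opp'[of x] lab_rot[of "opp B x"] opp[of x] darts_mem[of x]
  by (auto simp: cw_def)

lemma run:
  assumes e: "e \<in> A"
  shows run_pos: "0 < run e" and cw_run: "(cw B ^^ run e) e = fnext B A e"
    and run_asc: "\<And>j. 0 < j \<Longrightarrow> j < run e \<Longrightarrow> (cw B ^^ j) e \<notin> A"
    and lab_run: "\<And>j. 0 < j \<Longrightarrow> j \<le> run e \<Longrightarrow> lab B ((cw B ^^ j) e) = lab B e + int j - 2"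
proof -
  have "orbit (cw B) e \<inter> A \<noteq> {}" using face_of(2)[OF darts_mem[OF e]] e by blast
  then obtain k where k: "0 < k" "fnext B A e = (cw B ^^ k) e" "(cw B ^^ k) e \<in> A" 
      "\<And>j. 0 < j \<Longrightarrow> j < k \<Longrightarrow> (cw B ^^ j) e \<notin> A"
    by (rule next_in_obtain_orbit) (rule that; (assumption | simp add: fnext_def))
  \<comment> \<open>The first step of the contour descends by one and each later one ascends by one.
    The first step is the origin of the \<open>- 2\<close> here and of the \<open>+ 2\<close> in
    \<open>run\<close>.\<close>
  have l: "lab B ((cw B ^^ Suc j) e) = lab B e + int (Suc j) - 2" if "j < k" for j
    using that
  proof (induction j)
    case 0
    then show ?case using lab_cw(1)[OF e] by simp
  next
    case (Suc j)
    then have "(cw B ^^ Suc j) e \<notin> A" using k(4)[of "Suc j"] by simp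
    then show ?case using Suc lab_cw(2)[OF funpow_mem[OF perm_cw darts_mem[OF e]], of "Suc j"] by simp
  qed
  have r: "run e = k" using l[of "k - 1"] k by (simp add: run_def)
  show "0 < run e" "(cw B ^^ run e) e = fnext B A e" using k r by simp_all
  show "\<And>j. 0 < j \<Longrightarrow> j < run e \<Longrightarrow> (cw B ^^ j) e \<notin> A" using k r by simp
  fix j assume "0 < j" "j \<le> run e"
  then show "lab B ((cw B ^^ j) e) = lab B e + int j - 2" using l[of "j - 1"] r by (cases j) auto
qed

lemma cw_pow_mem: "e \<in> A \<Longrightarrow> (cw B ^^ j) e \<in> darts B"
  using funpow_mem[OF perm_cw darts_mem] .

lemma run_lab: "e \<in> A \<Longrightarrow> lab B (fnext B A e) = lab B e + int (run e) - 2"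
  using lab_run[of e "run e"] run_pos cw_run by simp

lemma run_opp:
  assumes "e \<in> A" "0 < j" "j < run e"
  shows "opp B ((cw B ^^ j) e) \<in> A" "lab B (opp B ((cw B ^^ j) e)) = lab B e + int j - 1"
  using run_asc[OF assms] cw_pow_mem[OF assms(1), of j] opp_iff lab_opp' lab_run[OF assms(1,2)] assms(3) 
  by auto

text \<open>The contour reaches the origin of \<open>fnext B A e\<close> along the last dart of the
  run, whose reverse comes just before \<open>fnext B A e\<close> in the rotation. Stepping back
  with \<open>vnext\<close> therefore gives the last descending dart at or before this
  reverse.\<close>

lemma lnext_last_desc:
  assumes e: "e \<in> A"
  shows "lnext B A e = last_desc (opp B ((cw B ^^ (run e - 1)) e))"
proof -
  let ?x = "opp B ((cw B ^^ (run e - 1)) e)"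
  have "rot B ?x = (cw B ^^ Suc (run e - 1)) e" by (simp add: cw_def)
  then have "rot B ?x = fnext B A e" using run_pos[OF e] cw_run[OF e] by simp
  then show ?thesis using last_desc_before[of ?x] fnext_mem[OF e] by (simp add: lnext_def)
qed

lemma lnext_run:
  assumes "e \<in> A" "1 < run e"
  shows "lnext B A e = opp B ((cw B ^^ (run e - 1)) e)"
  using lnext_last_desc[OF assms(1)] last_desc_self[OF run_opp(1)[OF assms(1)], of "run e - 1"] assms(2)
  by simp

lemma cw_pow_Suc: "e \<in> A \<Longrightarrow> (cw B ^^ Suc j) e = rot B (opp B ((cw B ^^ j) e))"
  by (simp add: cw_def)

text \<open>Inside a run the contour turns from a reversed dart to the next dart, which ascends; the
  last descending dart seen from either side of this turn is the same.\<close>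

lemma parent_run:
  assumes e: "e \<in> A" and j: "Suc j < run e"
  shows "parent (opp B ((cw B ^^ Suc j) e)) = last_desc (opp B ((cw B ^^ j) e))"
proof -
  have "parent (opp B ((cw B ^^ Suc j) e)) = last_desc (rot B (opp B ((cw B ^^ j) e)))"
    unfolding parent_def using opp(2)[OF cw_pow_mem[OF e], of "Suc j"] cw_pow_Suc[OF e] by simp
  moreover have "rot B (opp B ((cw B ^^ j) e)) \<notin> A"
    using run_asc[OF e, of "Suc j"] j cw_pow_Suc[OF e, of j] by simp
  ultimately show ?thesis using last_desc_skip[of "opp B ((cw B ^^ j) e)"] opp(1)[OF cw_pow_mem[OF e]] by simp
qed

lemma parent_run':
  assumes "e \<in> A" "0 < j" "Suc j < run e"
  shows "parent (opp B ((cw B ^^ Suc j) e)) = opp B ((cw B ^^ j) e)"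
  using parent_run[OF assms(1,3)] last_desc_self[OF run_opp(1)[OF assms(1,2)]] assms(3) by simp

text \<open>The leftmost paths from \<open>e\<close> and from \<open>lnext B A e\<close> merge: the
  latter goes down the ascending run in reverse, \<open>run e - 1\<close> levels, and arrives where
  \<open>e\<close> arrives in one step. If \<open>e\<close> descends into a local min, both sides
  are the default value of \<open>last_desc\<close>.\<close>

lemma parent_pow_lnext:
  assumes e: "e \<in> A"
  shows "(parent ^^ (run e - 1)) (lnext B A e) = parent e"
proof (cases "run e = 1")
  case True
  then show ?thesis using lnext_last_desc[OF e] by (simp add: parent_def)
next
  case False
  then have r: "1 < run e" using run_pos[OF e] by simp
  have "(parent ^^ i) (lnext B A e) = opp B ((cw B ^^ (run e - 1 - i)) e)" if "i < run e - 1" for i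
    using that
  proof (induction i)
    case 0
    then show ?case using lnext_run[OF e r] by simp
  next
    case (Suc i)
    then have "Suc (run e - 1 - Suc i) = run e - 1 - i" by simp
    then show ?case using Suc parent_run'[OF e, of "run e - 1 - Suc i"] by simp
  qed
  from this[of "run e - 2"] have "(parent ^^ (run e - 2)) (lnext B A e) = opp B (cw B e)"
    using r by (simp add: numeral_2_eq_2 Suc_diff_Suc)
  moreover have "parent (opp B (cw B e)) = parent e" 
    using parent_run[OF e, of 0] r by (simp add: parent_def)
  moreover have "run e - 1 = Suc (run e - 2)" using r by simp
  ultimately show ?thesis by simp
qed

lemma lab_lnext_ge: "e \<in> A \<Longrightarrow> lab B (lnext B A e) \<ge> lab B e - 1"
  using lab_lnext run_lab run_pos by force

lemma face_meets: "x \<in> darts B \<Longrightarrow> orbit (cw B) x \<inter> A \<noteq> {}"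
  by (rule orbit_meets_of_ascending[where L = "lab B", OF perm_cw _ lab_cw(2)])

text \<open>Every contour contains a descending dart, so the runs exhaust the darts, and statements
  about \<open>cw B\<close> can be checked run by run, as in \<open>suit_map_unique\<close>.\<close>

lemma run_cover:
  assumes "x \<in> darts B"
  obtains e j where "e \<in> A" "j < run e" "x = (cw B ^^ j) e"
proof -
  obtain e0 where e0: "e0 \<in> A" "e0 \<in> orbit (cw B) x" using face_meets[OF assms] by blast
  then have "x \<in> orbit (cw B) e0" using orbit_sym_on[OF perm_cw assms] by blast
  with perm_cw darts_mem[OF e0(1)] have "\<exists>e\<in>A. \<exists>j<run e. x = (cw B ^^ j) e"
  proof (rule orbit_induct_on)
    show "\<exists>e\<in>A. \<exists>j<run e. e0 = (cw B ^^ j) e"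
      using e0 run_pos by (intro bexI[of _ e0] exI[of _ 0]) auto
    fix z assume "\<exists>e\<in>A. \<exists>j<run e. z = (cw B ^^ j) e"
    then obtain e j where ej: "e \<in> A" "j < run e" "z = (cw B ^^ j) e" by blast
    show "\<exists>e\<in>A. \<exists>j<run e. cw B z = (cw B ^^ j) e"
    proof (cases "Suc j < run e")
      case True
      then show ?thesis using ej by (intro bexI[of _ e] exI[of _ "Suc j"]) auto
    next
      case False
      then have "Suc j = run e" using ej by simp
      then have "cw B z = fnext B A e" using cw_run[OF ej(1)] ej(3) by (metis funpow.simps(2) comp_apply)
      then show ?thesis using fnext_mem[OF ej(1)] run_pos
        by (intro bexI[of _ "fnext B A e"] exI[of _ 0]) auto
    qed
  qed
  then show thesis using that by blast
qed

subsection \<open>Local minima as roots\<close>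

text \<open>Descent along leftmost paths as a relation, so that termination can be settled
  afterwards by labels. The first argument is a dart at the vertex where the path has arrived; a
  dart at a local min vertex thus has this vertex as its root.\<close>

inductive rooted :: "'d \<Rightarrow> 'd set \<Rightarrow> bool" where
  base: "v \<in> vertices B \<Longrightarrow> v \<inter> A = {} \<Longrightarrow> x \<in> v \<Longrightarrow> rooted x v"
| step: "x \<in> darts B \<Longrightarrow> orbit (rot B) x \<inter> A \<noteq> {} \<Longrightarrow> rooted (opp B (last_desc x)) v \<Longrightarrow> rooted x v"

lemma rooted_unique: "rooted x v \<Longrightarrow> rooted x v' \<Longrightarrow> v' = v"
proof (induction rule: rooted.induct)
  case (base v x)
  have "v = orbit (rot B) x" using vertexE(1)[OF base(1,3)] .
  from base(4) show ?case
  proof cases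
    case base
    then show ?thesis using vertexE(1)[of v' x] \<open>v = _\<close> by simp
  next
    case step
    then show ?thesis using base \<open>v = _\<close> by blast
  qed
next
  case (step x v)
  from step(5) show ?case
  proof cases
    case base
    then show ?thesis using vertexE(1)[of v' x] step(2) by simp
  next
    case step
    then show ?thesis using \<open>rooted (opp B (last_desc x)) v' \<Longrightarrow> v' = v\<close> by blast
  qed
qed

lemma lab_last_desc: "x \<in> darts B \<Longrightarrow> orbit (rot B) x \<inter> A \<noteq> {} \<Longrightarrow> lab B (last_desc x) = lab B x"
  using lab_orbit last_desc_mem(2) by blast

text \<open>Each step lowers the label by one, and labels are bounded below on the finite set of
  darts.\<close>

lemma rooted_exists: "x \<in> darts B \<Longrightarrow> \<exists>v. rooted x v"
proof (induction "nat (lab B x - Min (lab B ` darts B))" arbitrary: x rule: less_induct)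
  case less
  show ?case
  proof (cases "orbit (rot B) x \<inter> A = {}")
    case True
    then show ?thesis using base[OF vertex_of(1) _ vertex_of(2)] less.prems by blast
  next
    case False
    note d = last_desc_mem[OF less.prems False]
    let ?y = "opp B (last_desc x)"
    have y: "?y \<in> darts B" using opp d darts_mem by blast
    have "lab B ?y = lab B x - 1" using lab_opp[OF d(1)] lab_last_desc[OF less.prems False] by simp
    moreover have "Min (lab B ` darts B) \<le> lab B ?y" using y fin by simp
    ultimately have "nat (lab B ?y - Min (lab B ` darts B)) < nat (lab B x - Min (lab B ` darts B))" by simp
    then show ?thesis using less.hyps[of ?y] y step[OF less.prems False] by blast
  qed
qed

definition root :: "'d \<Rightarrow> 'd set" where
  "root x = (THE v. rooted x v)"

lemma rooted_root: "x \<in> darts B \<Longrightarrow> rooted x (root x)"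
  unfolding root_def using rooted_exists[of x] rooted_unique[of x] by (metis theI)

lemma root_eqI: "rooted x v \<Longrightarrow> root x = v"
  unfolding root_def by (rule the_equality) (assumption, rule rooted_unique)

lemma root_last_desc: 
  assumes "x \<in> darts B" "orbit (rot B) x \<inter> A \<noteq> {}"
  shows "root (opp B (last_desc x)) = root x"
  using step[OF assms rooted_root] root_eqI opp(1) darts_mem last_desc_mem(1)[OF assms] by metis

lemma root_opp: "x \<in> darts B \<Longrightarrow> root (opp B x) = root x"
proof -
  have *: "root (opp B x) = root x" if "x \<in> A" for x
    using root_last_desc[of x] last_desc_self[OF that] darts_mem[OF that] vertex_of(2) that 
    by (metis IntI empty_iff)
  assume "x \<in> darts B"
  then show ?thesis using *[of x] *[of "opp B x"] opp[of x] opp_iff[of x] by metis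
qed

lemma root_last_desc': 
  assumes "x \<in> darts B" "orbit (rot B) x \<inter> A \<noteq> {}"
  shows "root (last_desc x) = root x"
  using root_last_desc[OF assms] root_opp[OF darts_mem[OF last_desc_mem(1)[OF assms]]] by simp

lemma root_local_min: "v \<in> vertices B \<Longrightarrow> v \<inter> A = {} \<Longrightarrow> x \<in> v \<Longrightarrow> root x = v"
  using base root_eqI by blast

text \<open>Turning past a dart that does not descend leaves the last descending dart, and with it
  the rest of the leftmost path, unchanged; a local min vertex is its own root.\<close>

lemma root_rot:
  assumes x: "x \<in> darts B" and n: "rot B x \<notin> A"
  shows "root (rot B x) = root x"
proof (cases "orbit (rot B) x \<inter> A = {}")
  case True
  then show ?thesis using root_local_min[OF vertex_of(1)[OF x] True] vertex_of(2)[OF x] orbit.base[of "rot B" x] 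
    by metis
next
  case False
  then have "orbit (rot B) (rot B x) \<inter> A \<noteq> {}" using orbit_step_on[OF perm_rot x] by simp
  then show ?thesis
    using root_last_desc'[OF x False] root_last_desc'[OF rot_mem[OF x]] last_desc_skip[OF x n] by simp
qed

lemma root_vertex: 
  "x \<in> darts B \<Longrightarrow> root x \<in> vertices B" 
  "x \<in> darts B \<Longrightarrow> root x \<inter> A = {}"
  "x \<in> darts B \<Longrightarrow> vlab B (root x) \<le> lab B x" 
  "x \<in> darts B \<Longrightarrow> x \<notin> root x \<Longrightarrow> vlab B (root x) < lab B x" 
proof -
  have "v \<in> vertices B \<and> v \<inter> A = {} \<and> vlab B v \<le> lab B x \<and> (x \<notin> v \<longrightarrow> vlab B v < lab B x)"
    if "rooted x v" for x v
    using that
  proof induction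
    case (base v x)
    then show ?case using vlab_vertex by auto
  next
    case (step x v)
    have "lab B (opp B (last_desc x)) = lab B x - 1"
      using lab_opp[OF last_desc_mem(1)[OF step(1,2)]] lab_last_desc[OF step(1,2)] by simp
    then show ?case using step.IH by simp
  qed
  from this[OF rooted_root] show "x \<in> darts B \<Longrightarrow> root x \<in> vertices B" 
    "x \<in> darts B \<Longrightarrow> root x \<inter> A = {}" "x \<in> darts B \<Longrightarrow> vlab B (root x) \<le> lab B x" 
    "x \<in> darts B \<Longrightarrow> x \<notin> root x \<Longrightarrow> vlab B (root x) < lab B x" by auto
qed

lemma root_cw_pow: "e \<in> A \<Longrightarrow> j < run e \<Longrightarrow> root ((cw B ^^ j) e) = root e"
proof (induction j)
  case (Suc j)
  then have "rot B (opp B ((cw B ^^ j) e)) \<notin> A"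
    using run_asc[of e "Suc j"] cw_pow_Suc[of e j] by simp
  then have "root ((cw B ^^ Suc j) e) = root (opp B ((cw B ^^ j) e))"
    using root_rot[OF opp(1)[OF cw_pow_mem[of e j]]] cw_pow_Suc[of e j] Suc by simp
  then show ?case using root_opp[OF cw_pow_mem[of e j]] Suc by simp
qed simp

text \<open>No turn inside the run passes a descending dart, so the root is constant along it. At
  its end, going back to the last descending dart at or before the reversed last dart does not
  change the root either (\<open>root_last_desc'\<close>).\<close>

lemma root_lnext:
  assumes e: "e \<in> A"
  shows "root (lnext B A e) = root e"
proof -
  let ?z = "(cw B ^^ (run e - 1)) e"
  have z: "?z \<in> darts B" using cw_pow_mem[OF e] .
  have "rot B (opp B ?z) = fnext B A e"
    using cw_pow_Suc[OF e, of "run e - 1"] run_pos[OF e] cw_run[OF e] by simp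
  then have "orbit (rot B) (opp B ?z) \<inter> A \<noteq> {}" 
    using orbit.base[of "rot B" "opp B ?z"] fnext_mem[OF e] by auto
  then show ?thesis
    using root_last_desc'[OF opp(1)[OF z]] lnext_last_desc[OF e] root_opp[OF z] 
      root_cw_pow[OF e, of "run e - 1"] run_pos[OF e] by simp
qed

lemma root_orbit: "e \<in> A \<Longrightarrow> y \<in> orbit (lnext B A) e \<Longrightarrow> root y = root e"
  using orbit_invariant[of y "lnext B A" e A root] lnext_mem root_lnext by blast

section \<open>Local minima and cycles of \<open>lnext\<close>\<close>

definition minima :: "'d set set" where
  "minima = {v \<in> vertices B. v \<inter> A = {}}"

lemma card_cycles_lnext_ge: 
  "root ` A = minima" "card minima \<le> card (cycles (lnext B A) A)"
proof -
  show r: "root ` A = minima"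
  proof (intro equalityI subsetI)
    fix v assume "v \<in> minima"
    then have v: "v \<in> vertices B" "v \<inter> A = {}" by (auto simp: minima_def)
    then obtain x where x: "x \<in> v" unfolding vertices_def using orbit.base by fastforce
    \<comment> \<open>The reverse of a dart at a local min descends into it, so every local min is a
      root.\<close>
    then have "opp B x \<in> A" using v vertexE(2)[OF v(1)] opp_iff by blast
    moreover have "root (opp B x) = v" 
      using root_opp[OF vertexE(2)[OF v(1) x]] root_local_min[OF v x] by simp
    ultimately show "v \<in> root ` A" by blast
  next
    fix v assume "v \<in> root ` A"
    then obtain x where "x \<in> A" "v = root x" by blast
    then show "v \<in> minima" using root_vertex(1,2)[OF darts_mem] by (simp add: minima_def)
  qed
  have "minima \<subseteq> (\<lambda>c. root (SOME e. e \<in> c)) ` cycles (lnext B A) A"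
  proof
    fix v assume "v \<in> minima"
    then obtain e where e: "e \<in> A" "v = root e" using r by blast
    have "(SOME x. x \<in> orbit (lnext B A) e) \<in> orbit (lnext B A) e"
      using self_mem_orbit[OF perm_lnext e(1)] by (rule someI)
    then have "v = root (SOME x. x \<in> orbit (lnext B A) e)" using root_orbit[OF e(1)] e(2) by simp
    then show "v \<in> (\<lambda>c. root (SOME e. e \<in> c)) ` cycles (lnext B A) A"
      using e(1) by (auto simp: cycles_def)
  qed
  then show "card minima \<le> card (cycles (lnext B A) A)" using surj_card_le finite_cycles[OF perm_lnext] by blast
qed

subsection \<open>Connectedness and planarity of the star figure\<close>

definition dart_edge :: "'d \<Rightarrow> 'd" where
  "dart_edge x = (if x \<in> A then x else opp B x)"

text \<open>Downward induction on the label; within a vertex, backwards along \<open>rot B\<close>.\<close>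

lemma dart_edge_rot: "x \<in> darts B \<Longrightarrow> (dart_edge x, dart_edge (rot B x)) \<in> half_conn B A"
proof (induction "nat (Max (lab B ` darts B) - lab B x)" arbitrary: x rule: less_induct)
  case less
  have IH: "(dart_edge y, dart_edge (rot B y)) \<in> half_conn B A" 
    if "y \<in> darts B" "lab B x < lab B y" for y
  proof -
    have "lab B y \<le> Max (lab B ` darts B)" using that(1) fin by simp
    then show ?thesis using less.hyps[of y] that by simp
  qed
  have asc: "(dart_edge y, dart_edge (rot B y)) \<in> half_conn B A"
    if y: "y \<in> darts B" "lab B y = lab B x" "y \<notin> A" for y
  proof -
    define p where "p = opp B y"
    have p: "p \<in> A" "opp B p = y" "lab B p = lab B y + 1" 
      using opp_iff[OF y(1)] opp[OF y(1)] lab_opp'[OF y(1,3)] y(3) by (auto simp: p_def)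
    have ey: "dart_edge y = p" using y(3) by (simp add: dart_edge_def p_def)
    have cwp: "rot B y = cw B p" by (simp add: cw_def p(2))
    show ?thesis
    proof (cases "run p = 1")
      case True
      then have "cw B p = fnext B A p" using cw_run[OF p(1)] by simp
      then show ?thesis 
        using ey cwp half_conn_fnext[OF p(1)] fnext_mem[OF p(1)] by (simp add: dart_edge_def)
    next
      case False
      then have r: "1 < run p" using run_pos[OF p(1)] by simp
      \<comment> \<open>The reversed darts of the run start at vertices above the level of
        \<open>x\<close>, where the induction hypothesis links consecutive ones. The last of them is
        \<open>lnext B A p\<close>, which is linked to \<open>p\<close>; this closes the chain from
        \<open>p\<close> to the first.\<close>
      let ?q = "\<lambda>j. opp B ((cw B ^^ j) p)"
      have "(?q 1, ?q (Suc j)) \<in> half_conn B A" if "Suc j < run p" for j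
        using that
      proof (induction j)
        case 0
        then show ?case by (simp add: half_conn_def)
      next
        case (Suc j)
        then have q: "?q (Suc j) \<in> A" "?q (Suc j) \<in> darts B" "lab B x < lab B (?q (Suc j))"
          using run_opp[OF p(1), of "Suc j"] darts_mem y(2) p(3) by auto
        have "rot B (?q (Suc j)) = (cw B ^^ Suc (Suc j)) p" using cw_pow_Suc[OF p(1), of "Suc j"] by simp
        moreover have "(cw B ^^ Suc (Suc j)) p \<notin> A" using run_asc[OF p(1), of "Suc (Suc j)"] Suc.prems by simp
        ultimately have "(?q (Suc j), ?q (Suc (Suc j))) \<in> half_conn B A"
          using IH[OF q(2,3)] q(1) by (simp add: dart_edge_def)
        then show ?case using Suc.IH Suc.prems half_conn_trans by (meson Suc_lessD)
      qed
      from this[of "run p - 2"] have "(?q 1, lnext B A p) \<in> half_conn B A"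
        using r lnext_run[OF p(1) r] by (simp add: numeral_2_eq_2 Suc_diff_Suc)
      then have "(p, ?q 1) \<in> half_conn B A"
        using half_conn_lnext[OF p(1)] half_conn_sym half_conn_trans by blast
      moreover have "dart_edge (rot B y) = ?q 1" 
        using cwp run_asc[OF p(1), of 1] r by (simp add: dart_edge_def)
      ultimately show ?thesis using ey by simp
    qed
  qed
  show ?case
  proof (cases "x \<in> A")
    case False
    then show ?thesis using asc less.prems by simp
  next
    case True
    have "orbit (rot B) x \<inter> A \<noteq> {}" using vertex_of(2)[OF less.prems] True by blast
    then obtain n where n: "0 < n" "vnext B A x = (rot B ^^ n) x" "(rot B ^^ n) x \<in> A" 
      "\<And>j. 0 < j \<Longrightarrow> j < n \<Longrightarrow> (rot B ^^ j) x \<notin> A"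
      by (rule next_in_obtain_orbit) (rule that; (assumption | simp add: vnext_def))
    \<comment> \<open>\<open>x\<close> is linked to \<open>vnext B A x\<close> directly. The darts
      in between do not descend, so \<open>asc\<close> carries the link backwards from there to
      \<open>rot B x\<close>.\<close>
    have "1 \<le> n" using n(1) by simp
    then have "(dart_edge ((rot B ^^ 1) x), dart_edge ((rot B ^^ n) x)) \<in> half_conn B A"
    proof (induction rule: inc_induct)
      case base
      then show ?case by (simp add: half_conn_def)
    next
      case (step i)
      have "lab B ((rot B ^^ i) x) = lab B x" using lab_orbit[OF less.prems funpow_mem_orbit'[OF perm_rot less.prems]] .
      then have "(dart_edge ((rot B ^^ i) x), dart_edge ((rot B ^^ Suc i) x)) \<in> half_conn B A"
        using asc[OF funpow_mem[OF perm_rot less.prems, of i]] n(4)[of i] step(1,2) by simp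
      then show ?case using step.IH half_conn_trans by blast
    qed
    then have "(dart_edge (rot B x), vnext B A x) \<in> half_conn B A" using n(2,3) by (simp add: dart_edge_def)
    then have "(x, dart_edge (rot B x)) \<in> half_conn B A"
      using half_conn_vnext[OF True] half_conn_sym half_conn_trans by blast
    then show ?thesis using True by (simp add: dart_edge_def)
  qed
qed

lemma half_connected: "d \<in> A \<Longrightarrow> e \<in> A \<Longrightarrow> (d, e) \<in> half_conn B A"
  using half_connI[of d e] dart_edge_rot planar unfolding dart_edge_def planar_map_def by blast

text \<open>Every face has a descending dart, whereas the vertices without one are the local minima.
  Euler's relation for \<open>B\<close> is therefore the first equation with
  \<open>card minima\<close> as its third summand; the genus bound and
  \<open>card_cycles_lnext_ge\<close> force the two candidates for this summand to agree.\<close>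

lemma card_cycles_sum:
  "card (cycles (vnext B A) A) + card (cycles (fnext B A) A) + card (cycles (lnext B A) A) = card A + 2"
  "card minima = card (cycles (lnext B A) A)"
proof -
  have "{v \<in> vertices B. v \<inter> A \<noteq> {}} = vertices B - minima" by (auto simp: minima_def)
  moreover have fv: "finite (vertices B)" using fin by (simp add: vertices_def)
  moreover have "minima \<subseteq> vertices B" by (auto simp: minima_def)
  ultimately have v: "card (cycles (vnext B A) A) + card minima = card (vertices B)"
    unfolding card_cycles_vnext by (metis card_Diff_subset card_mono finite_subset le_add_diff_inverse2)
  have "{f \<in> faces B. f \<inter> A \<noteq> {}} = faces B"
    using face_meets by (auto simp: faces_eq cycles_def)
  then have f: "card (cycles (fnext B A) A) = card (faces B)" using card_cycles_fnext by simp
  have "card (vertices B) + card (faces B) = card A + 2" using planar card_edges by (simp add: planar_map_def)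
  with v f genus[OF nonempty half_connected] card_cycles_lnext_ge(2)
  show "card (cycles (vnext B A) A) + card (cycles (fnext B A) A) + card (cycles (lnext B A) A) = card A + 2"
    "card minima = card (cycles (lnext B A) A)" by linarith+
qed

text \<open>Sending a cycle to the common root of its elements is a surjection between finite sets
  of equal size, hence injective.\<close>

lemma root_eq_orbit:
  assumes "d \<in> A" "e \<in> A" "root d = root e"
  shows "d \<in> orbit (lnext B A) e"
proof -
  let ?r = "\<lambda>c. root (SOME e. e \<in> c)"
  have r: "?r (orbit (lnext B A) e) = root e" if "e \<in> A" for e
    using root_orbit[OF that someI[of "\<lambda>x. x \<in> orbit (lnext B A) e", OF self_mem_orbit[OF perm_lnext that]]] .
  have "?r ` cycles (lnext B A) A = minima" 
    unfolding cycles_def card_cycles_lnext_ge(1)[symmetric] image_image using r by simp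
  then have "inj_on ?r (cycles (lnext B A) A)"
    using card_cycles_sum(2) eq_card_imp_inj_on[OF finite_cycles[OF perm_lnext], of ?r] by simp
  moreover have "orbit (lnext B A) d \<in> cycles (lnext B A) A" "orbit (lnext B A) e \<in> cycles (lnext B A) A"
    using assms by (auto simp: cycles_def)
  ultimately have "orbit (lnext B A) d = orbit (lnext B A) e"
    using r[OF assms(1)] r[OF assms(2)] assms(3) by (auto dest: inj_onD)
  then show ?thesis using self_mem_orbit[OF perm_lnext assms(1)] by simp
qed

text \<open>Along the cycle from \<open>e\<close>, as long as the label has not dropped below
  \<open>lab B e\<close>, the leftmost path from the current element passes through
  \<open>parent e\<close>, by repeated merging of paths (\<open>parent_pow_lnext\<close>). At the
  first element of label \<open>lab B e - 1\<close> no step is left, so it is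
  \<open>parent e\<close>. That this label occurs on the cycle at all is due to
  \<open>root_eq_orbit\<close>.\<close>

lemma parent_eq_next_in:
  assumes e: "e \<in> A" and m: "orbit (rot B) (opp B e) \<inter> A \<noteq> {}"
  shows "parent e = next_in (lnext B A) {t \<in> A. lab B t = lab B e - 1} e"
proof -
  let ?X = "{t \<in> A. lab B t = lab B e - 1}"
  have od: "opp B e \<in> darts B" using opp(1)[OF darts_mem[OF e]] .
  have p: "parent e \<in> A" "lab B (parent e) = lab B e - 1" "root (parent e) = root e"
    using last_desc_mem(1)[OF od m] lab_last_desc[OF od m] root_last_desc'[OF od m] 
      lab_opp[OF e] root_opp[OF darts_mem[OF e]] by (auto simp: parent_def)
  then have "parent e \<in> orbit (lnext B A) e \<inter> ?X" using root_eq_orbit[OF _ e] by simp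
  then have "orbit (lnext B A) e \<inter> ?X \<noteq> {}" by blast
  then obtain n where n: "0 < n" "next_in (lnext B A) ?X e = (lnext B A ^^ n) e" 
      "(lnext B A ^^ n) e \<in> ?X" "\<And>j. 0 < j \<Longrightarrow> j < n \<Longrightarrow> (lnext B A ^^ j) e \<notin> ?X"
    by (rule next_in_obtain_orbit) (rule that; assumption)
  have mem: "(lnext B A ^^ j) e \<in> A" for j using funpow_mem[OF perm_lnext e] .
  have "lab B ((lnext B A ^^ j) e) \<ge> lab B e \<and> 
     (parent ^^ nat (lab B ((lnext B A ^^ j) e) - lab B e + 1)) ((lnext B A ^^ j) e) = parent e \<or> 
     j = n \<and> (lnext B A ^^ j) e = parent e" if "j \<le> n" for j
    using that
  proof (induction j)
    case 0
    then show ?case by simp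
  next
    case (Suc j)
    let ?x = "(lnext B A ^^ j) e" and ?y = "(lnext B A ^^ Suc j) e"
    have y: "?y = lnext B A ?x" by simp
    have x: "lab B ?x \<ge> lab B e" "(parent ^^ nat (lab B ?x - lab B e + 1)) ?x = parent e"
      using Suc by auto
    have ge: "lab B ?y \<ge> lab B ?x - 1" unfolding y using lab_lnext_ge[OF mem] .
    have "run ?x - 1 = nat (lab B ?y - lab B ?x + 1)" unfolding y run_def lab_lnext[OF mem] by linarith
    then have s: "(parent ^^ nat (lab B ?y - lab B ?x + 1)) ?y = parent ?x"
      using parent_pow_lnext[OF mem, of j] y by simp
    \<comment> \<open>The path from \<open>?y\<close> first descends to \<open>parent ?x\<close>;
      what remains are the steps left for \<open>?x\<close> after its first one. Neither summand is
      truncated by \<open>nat\<close>.\<close>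
    have "nat (lab B ?y - lab B e + 1) = nat (lab B ?x - lab B e) + nat (lab B ?y - lab B ?x + 1)"
      using x(1) ge by linarith
    then have "(parent ^^ nat (lab B ?y - lab B e + 1)) ?y = (parent ^^ nat (lab B ?x - lab B e)) (parent ?x)"
      using s by (simp only: funpow_add comp_apply)
    also have "\<dots> = (parent ^^ Suc (nat (lab B ?x - lab B e))) ?x"
      by (simp only: funpow_Suc_right comp_apply)
    also have "Suc (nat (lab B ?x - lab B e)) = nat (lab B ?x - lab B e + 1)" using x(1) by linarith
    finally have py: "(parent ^^ nat (lab B ?y - lab B e + 1)) ?y = parent e" using x(2) by simp
    show ?case
    proof (cases "Suc j = n")
      case True
      then have "lab B ?y = lab B e - 1" using n(3) by simp
      then show ?thesis using True py by simp
    next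
      case False
      then have "?y \<notin> ?X" using n(4)[of "Suc j"] Suc.prems by simp
      then have "lab B ?y \<noteq> lab B e - 1" using mem[of "Suc j"] by simp
      then have "lab B ?y \<ge> lab B e" using ge x(1) by linarith
      then show ?thesis using py by simp
    qed
  qed
  from this[of n] show ?thesis using n(2,3) by simp
qed

text \<open>Recovers the darts of a run from its end, using only \<open>lnext\<close> and labels;
  \<open>suit_map_unique\<close> goes back along the run with it.\<close>

lemma parent_in_run:
  assumes e: "e \<in> A" and j: "0 < j" "Suc j < run e"
  defines "p \<equiv> opp B ((cw B ^^ Suc j) e)"
  shows "opp B ((cw B ^^ j) e) = next_in (lnext B A) {t \<in> A. lab B t = lab B p - 1} p"
proof -
  let ?q = "opp B ((cw B ^^ j) e)"
  have p: "p \<in> A" unfolding p_def using run_opp(1)[OF e, of "Suc j"] j by simp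
  have q: "?q \<in> A" using run_opp(1)[OF e] j by simp
  have "opp B p = rot B ?q" unfolding p_def using opp(2)[OF cw_pow_mem[OF e]] cw_pow_Suc[OF e] by metis
  then have "orbit (rot B) (opp B p) = orbit (rot B) ?q" using orbit_step_on[OF perm_rot darts_mem[OF q]] by simp
  then have "orbit (rot B) (opp B p) \<inter> A \<noteq> {}" using q vertex_of(2)[OF darts_mem[OF q]] by blast
  then show ?thesis using parent_eq_next_in[OF p] parent_run'[OF e j] by (simp add: p_def)
qed

end

text \<open>The half-isomorphism respects the start of a run, its length, which depends on labels
  only, and its last reversed dart, given by \<open>lnext\<close>. The interior darts follow by
  \<open>parent_in_run\<close>, so the extension commutes with \<open>cw\<close> on every run, and
  \<open>rot\<close> is \<open>cw\<close> after \<open>opp\<close>.\<close>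

theorem suit_map_unique:
  fixes B :: "('d, int, 'y) lmap_scheme" and B' :: "('e, int, 'z) lmap_scheme"
  assumes "suit_map B" "suit_map B'" "half_iso h B (descending B) B' (descending B')"
  shows "lmap_iso (extend_half h B (descending B) B') B B'"
    (is "lmap_iso ?g B B'")
proof -
  interpret m: suit_map B by fact
  interpret m': suit_map B' by fact
  have h: "bij_betw h m.A m'.A" and hd: "\<And>d. d \<in> m.A \<Longrightarrow> h (vnext B m.A d) = vnext B' m'.A (h d) 
      \<and> h (fnext B m.A d) = fnext B' m'.A (h d) \<and> lab B' (h d) = lab B d"
    using assms(3) by (auto simp: half_iso_def)
  have hA: "h ` m.A = m'.A" "inj_on h m.A" "\<And>d. d \<in> m.A \<Longrightarrow> h d \<in> m'.A" using h by (auto simp: bij_betw_def)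
  note g = extend_half[OF m.half_map_axioms m'.half_map_axioms h]
  note hl = half_iso_lnext[OF m.half_map_axioms m'.half_map_axioms assms(3)]
  have run: "m'.run (h e) = m.run e" if "e \<in> m.A" for e
    using hd[OF that] hd[OF m.fnext_mem[OF that]] by (simp add: m.run_def m'.run_def)
  have hX: "h ` {t \<in> m.A. lab B t = c} = {t \<in> m'.A. lab B' t = c}" for c
    using hd unfolding hA(1)[symmetric] by auto
  have hn: "h (next_in (lnext B m.A) {t \<in> m.A. lab B t = c} p) = next_in (lnext B' m'.A) {t \<in> m'.A. lab B' t = c} (h p)" 
    if "p \<in> m.A" for p c
    unfolding hX[symmetric] by (rule next_in_conj[OF _ hA(2) _ that]) (use hl m.lnext_mem in auto)
  have chain: "h (opp B ((cw B ^^ j) e)) = opp B' ((cw B' ^^ j) (h e))" if e: "e \<in> m.A" and j: "0 < j" "j < m.run e" for e j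
  proof -
    have "j \<le> m.run e - 1" "m.run e - 1 < m.run e" using j by simp_all
    then show ?thesis using j(1)
    proof (induction rule: inc_induct)
      case base
      then show ?case
        using m.lnext_run[OF e] m'.lnext_run[OF hA(3)[OF e]] hl[OF e] run[OF e] by simp
    next
      case (step i)
      let ?p = "opp B ((cw B ^^ Suc i) e)"
      have p: "?p \<in> m.A" using m.run_opp(1)[OF e, of "Suc i"] step by simp
      have IH: "h ?p = opp B' ((cw B' ^^ Suc i) (h e))" using step by simp
      have "h (opp B ((cw B ^^ i) e)) = next_in (lnext B' m'.A) {t \<in> m'.A. lab B' t = lab B ?p - 1} (h ?p)"
        using m.parent_in_run[OF e, of i] hn[OF p] step by simp
      also have "\<dots> = opp B' ((cw B' ^^ i) (h e))"
        using m'.parent_in_run[OF hA(3)[OF e], of i] run[OF e] step IH hd[OF p] by simp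
      finally show ?case .
    qed
  qed
  have g_run: "?g ((cw B ^^ j) e) = (cw B' ^^ j) (h e)" if e: "e \<in> m.A" and j: "j \<le> m.run e" for e j
  proof -
    consider "j = 0" | "0 < j" "j < m.run e" | "j = m.run e" "0 < j" using j by linarith
    then show ?thesis
    proof cases
      case 1
      then show ?thesis using g(1)[OF e] by simp
    next
      case 2
      let ?p = "opp B ((cw B ^^ j) e)"
      have "?g (opp B ?p) = opp B' (h ?p)" using g(2) m.run_opp(1)[OF e 2] .
      then show ?thesis
        using chain[OF e 2] m.opp(2)[OF m.cw_pow_mem[OF e]] m'.opp(2)[OF m'.cw_pow_mem[OF hA(3)[OF e]]] by simp
    next
      case 3
      then show ?thesis 
        using m.cw_run[OF e] m'.cw_run[OF hA(3)[OF e]] run[OF e] g(1)[OF m.fnext_mem[OF e]] hd[OF e] by simp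
    qed
  qed
  have g_cw: "?g (cw B x) = cw B' (?g x)" if x: "x \<in> darts B" for x
  proof -
    obtain e j where ej: "e \<in> m.A" "j < m.run e" "x = (cw B ^^ j) e" using m.run_cover[OF x] .
    have "cw B x = (cw B ^^ Suc j) e" using ej(3) by simp
    then have "?g (cw B x) = (cw B' ^^ Suc j) (h e)" using g_run[OF ej(1), of "Suc j"] ej(2) by (simp only: Suc_leI)
    also have "\<dots> = cw B' ((cw B' ^^ j) (h e))" by simp
    also have "(cw B' ^^ j) (h e) = ?g x" using g_run[OF ej(1), of j] ej(2,3) by (simp only: less_imp_le)
    finally show ?thesis .
  qed
  have g_rot: "?g (rot B x) = rot B' (?g x)" if "x \<in> darts B" for x
  proof -
    have gx: "?g x \<in> darts B'" using g(4) that by (auto simp: bij_betw_def)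
    have "rot B x = cw B (opp B x)" by (simp add: cw_def m.opp(2)[OF that])
    then have "?g (rot B x) = cw B' (?g (opp B x))" using g_cw[OF m.opp(1)[OF that]] by (simp only:)
    also have "?g (opp B x) = opp B' (?g x)" by (rule g(3)[OF that])
    also have "cw B' (opp B' (?g x)) = rot B' (?g x)" by (simp only: cw_def m'.opp(2)[OF gx])
    finally show ?thesis .
  qed
  have g_lab: "lab B' (?g x) = lab B x" if x: "x \<in> darts B" for x
  proof (cases "x \<in> m.A")
    case True
    then show ?thesis using hd g(1) by simp
  next
    case False
    then have o: "opp B x \<in> m.A" using m.opp_iff[OF x] by simp
    then have "?g x = opp B' (h (opp B x))" using g(2)[of "opp B x"] m.opp(2)[OF x] by simp
    then show ?thesis using m'.lab_opp[OF hA(3)[OF o]] hd[OF o] m.lab_opp'[OF x False] by simp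
  qed
  show ?thesis unfolding lmap_iso_def using g_rot g(3,4) g_lab by blast
qed

section \<open>Bicoloured maps\<close>

text \<open>Alternation around vertices makes every face contour stay inside or outside
  \<open>A\<close>, so on \<open>A\<close> the map \<open>fnext\<close> is one step of
  \<open>cw\<close> and \<open>vnext\<close> two steps of \<open>rot\<close>.\<close>

locale alt_map = half_map +
  assumes alt: "\<And>d. d \<in> darts M \<Longrightarrow> rot M d \<in> A \<longleftrightarrow> d \<notin> A"
begin

lemma cw_mem_iff: "d \<in> darts M \<Longrightarrow> cw M d \<in> A \<longleftrightarrow> d \<in> A"
  using alt[of "opp M d"] opp opp_iff by (simp add: cw_def)

lemma fnext_eq: "d \<in> A \<Longrightarrow> fnext M A d = cw M d"
  unfolding fnext_def using cw_mem_iff darts_mem by (intro next_in_step) auto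

lemma vnext_eq:
  assumes "d \<in> A"
  shows "vnext M A d = rot M (rot M d)"
proof -
  have d: "d \<in> darts M" using assms darts_mem by blast
  then have "rot M d \<notin> A" "rot M (rot M d) \<in> A" using alt assms rot_mem by auto
  then show ?thesis unfolding vnext_def 
    using next_in_skip[of "rot M" d A] next_in_step[of "rot M" "rot M d" A] assms vertex_of(2)[OF d] by auto
qed

lemma opp_rot_mem: "d \<in> A \<Longrightarrow> opp M (rot M d) \<in> A"
  using alt opp_iff rot_mem darts_mem by blast

lemma lnext_opp_rot:
  assumes "d \<in> A"
  shows "lnext M A (opp M (rot M d)) = d"
proof -
  have "fnext M A (opp M (rot M d)) = vnext M A d"
    using fnext_eq[OF opp_rot_mem[OF assms]] vnext_eq[OF assms] opp(2)[OF rot_mem[OF darts_mem[OF assms]]]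
    by (simp add: cw_def)
  then show ?thesis by (simp add: lnext_def inv_into_left[OF perm_vnext assms])
qed

lemma rot_eq: "d \<in> A \<Longrightarrow> rot M d = opp M (inv_into A (lnext M A) d)"
  using lnext_opp_rot[of d] inv_into_left[OF perm_lnext opp_rot_mem, of d] 
    opp(2)[OF rot_mem[OF darts_mem], of d] by simp

lemma rot_eq': "d \<in> darts M \<Longrightarrow> d \<notin> A \<Longrightarrow> rot M d = fnext M A (opp M d)"
  using fnext_eq[of "opp M d"] opp_iff opp(2) by (simp add: cw_def)

text \<open>On the reverses of selected darts \<open>cw\<close> acts as the inverse of
  \<open>lnext\<close>, and an orbit does not depend on the direction. Light faces are thus cycles
  of \<open>lnext\<close>, reversed.\<close>

lemma orbit_cw_opp:
  assumes "e \<in> A"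
  shows "orbit (cw M) (opp M e) = opp M ` orbit (lnext M A) e"
proof -
  have "cw M (opp M x) = opp M (inv_into A (lnext M A) x)" if "x \<in> A" for x
    using rot_eq[OF that] opp(2)[OF darts_mem[OF that]] by (simp add: cw_def)
  then have "opp M ` orbit (inv_into A (lnext M A)) e = orbit (cw M) (opp M e)"
    using inv_into_mem[OF perm_lnext] assms by (intro orbit_conj[where D = A]) auto
  then show ?thesis using orbit_inv_into[OF perm_lnext assms] by simp
qed

lemma face_mem_iff: "f \<in> faces M \<Longrightarrow> d \<in> f \<Longrightarrow> e \<in> f \<Longrightarrow> d \<in> A \<longleftrightarrow> e \<in> A"
  using faceE[of f d] orbit_invariant[of e "cw M" d "darts M" "\<lambda>x. x \<in> A"] cw_mem cw_mem_iff by auto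

lemma face_subset: "f \<in> faces M \<Longrightarrow> f \<inter> A \<noteq> {} \<Longrightarrow> f \<subseteq> A"
  using face_mem_iff[of f] by blast

lemma vertices_meet: "v \<in> vertices M \<Longrightarrow> v \<inter> A \<noteq> {}"
proof -
  assume "v \<in> vertices M"
  then obtain d where "d \<in> darts M" "v = orbit (rot M) d" by (auto simp: vertices_def)
  then show ?thesis using alt[of d] vertex_of(2)[of d] orbit.base[of "rot M" d] by blast
qed

lemma card_vertices: "card (vertices M) = card (cycles (vnext M A) A)"
proof -
  have "{v \<in> vertices M. v \<inter> A \<noteq> {}} = vertices M" using vertices_meet by blast
  then show ?thesis using card_cycles_vnext by simp
qed

lemma light_faces_bij: "bij_betw (\<lambda>c. opp M ` c) (cycles (lnext M A) A) {f \<in> faces M. f \<inter> A = {}}"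
proof (rule bij_betw_imageI)
  have sub: "c \<subseteq> darts M" if "c \<in> cycles (lnext M A) A" for c
    using that orbit_subset_dom[OF perm_lnext] sub by (auto simp: cycles_def)
  then show "inj_on (\<lambda>c. opp M ` c) (cycles (lnext M A) A)"
    using inj_on_image_eq_iff[OF perm_on_inj[OF perm_opp]] by (auto simp: inj_on_def)
  show "(\<lambda>c. opp M ` c) ` cycles (lnext M A) A = {f \<in> faces M. f \<inter> A = {}}"
  proof (intro equalityI subsetI)
    fix f assume "f \<in> (\<lambda>c. opp M ` c) ` cycles (lnext M A) A"
    then obtain e where e: "e \<in> A" "f = orbit (cw M) (opp M e)"
      using orbit_cw_opp by (auto simp: cycles_def)
    have oe: "opp M e \<in> darts M" "opp M e \<notin> A" using opp_iff[of e] darts_mem[OF e(1)] opp(1) e(1) by auto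
    then show "f \<in> {f \<in> faces M. f \<inter> A = {}}"
      using face_of[OF oe(1)] face_subset[of f] e(2) by blast
  next
    fix f assume f: "f \<in> {f \<in> faces M. f \<inter> A = {}}"
    then obtain d where d: "d \<in> darts M" "f = orbit (cw M) d" by (auto simp: faces_eq cycles_def)
    then have "d \<notin> A" using f face_of(2) by blast
    then have "opp M d \<in> A" "opp M (opp M d) = d" using d opp_iff opp by auto
    then have "f = opp M ` orbit (lnext M A) (opp M d)" using orbit_cw_opp[of "opp M d"] d by simp
    then show "f \<in> (\<lambda>c. opp M ` c) ` cycles (lnext M A) A"
      using \<open>opp M d \<in> A\<close> by (auto simp: cycles_def)
  qed
qed

lemma card_faces: "card (faces M) = card (cycles (fnext M A) A) + card (cycles (lnext M A) A)"
proof -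
  have "faces M = {f \<in> faces M. f \<inter> A \<noteq> {}} \<union> {f \<in> faces M. f \<inter> A = {}}" by blast
  moreover have "finite (faces M)" using fin by (simp add: faces_def)
  ultimately have "card (faces M) = card {f \<in> faces M. f \<inter> A \<noteq> {}} + card {f \<in> faces M. f \<inter> A = {}}"
    by (subst card_Un_disjoint[symmetric]) auto
  then show ?thesis using card_cycles_fnext bij_betw_same_card[OF light_faces_bij] by simp
qed

text \<open>The rotation exchanges the selected and the unselected darts of a vertex, so there are
  equally many.\<close>

lemma even_vertex:
  assumes v: "v \<in> vertices M"
  shows "even (card v)"
proof -
  obtain d where d: "d \<in> darts M" "v = orbit (rot M) d" using v by (auto simp: vertices_def)
  have sub: "v \<subseteq> darts M" using vertexE(2)[OF v] by blast
  then have fv: "finite v" using fin finite_subset by blast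
  have r: "rot M x \<in> v" if "x \<in> v" for x using that d(2) by (auto intro: orbit.step)
  have inj: "inj_on (rot M) v" using inj_on_subset[OF perm_on_inj[OF perm_rot] sub] .
  have "card (v \<inter> A) \<le> card (v - A)"
    using r alt sub inj_on_subset[OF inj] fv by (intro card_inj_on_le[of "rot M"]) auto
  moreover have "card (v - A) \<le> card (v \<inter> A)"
    using r alt sub inj_on_subset[OF inj] fv by (intro card_inj_on_le[of "rot M"]) auto
  moreover have "card v = card (v \<inter> A) + card (v - A)"
    using fv by (subst card_Un_disjoint[symmetric]) (auto intro: arg_cong[of _ _ card])
  ultimately show ?thesis by simp
qed

lemma half_connected: "connected_map M \<Longrightarrow> d \<in> A \<Longrightarrow> e \<in> A \<Longrightarrow> (d, e) \<in> half_conn M A"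
proof (erule half_connI)
  fix x assume x: "x \<in> darts M"
  show "(if x \<in> A then x else opp M x, if rot M x \<in> A then rot M x else opp M (rot M x)) \<in> half_conn M A"
  proof (cases "x \<in> A")
    case True
    then show ?thesis 
      using alt[OF x] half_conn_lnext[OF opp_rot_mem[OF True]] lnext_opp_rot[OF True] half_conn_sym by simp
  next
    case False
    then show ?thesis using alt[OF x] half_conn_fnext[of "opp M x"] opp_iff[OF x] rot_eq'[OF x] by simp
  qed
qed

end

text \<open>
  The conditions on the two permutations and the labels of selected darts that characterize
  well-labelled hypermaps.
\<close>

locale luk_map = half_map M A for M :: "('d, int, 'z) lmap_scheme" and A +
  assumes nonempty: "A \<noteq> {}"
    and half_connected: "\<And>d e. d \<in> A \<Longrightarrow> e \<in> A \<Longrightarrow> (d, e) \<in> half_conn M A"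
    and euler: "card (cycles (vnext M A) A) + card (cycles (fnext M A) A) + card (cycles (lnext M A) A) 
      = card A + 2"
    and luk: "\<And>d. d \<in> A \<Longrightarrow> lab M (fnext M A d) \<ge> lab M d - 1"

sublocale suit_map \<subseteq> luk_map B "descending B"
  by unfold_locales (use nonempty half_connected card_cycles_sum(1) lab_lnext_ge lab_lnext in auto)

definition dark_darts :: "'d hmap \<Rightarrow> 'd set" where
  "dark_darts H = {d \<in> darts H. right_face H d \<in> dark H}"

locale well_hmap =
  fixes H :: "'d hmap"
  assumes well: "well_labelled H"

sublocale well_hmap \<subseteq> half_map H "dark_darts H"
proof
  have h: "hypermap H" using well by (simp add: well_labelled_def)
  then have p: "planar_map H" by (simp add: hypermap_def)
  show "finite (darts H)" "bij_betw (rot H) (darts H) (darts H)"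
    "\<And>d. d \<in> darts H \<Longrightarrow> opp H d \<in> darts H" "\<And>d. d \<in> darts H \<Longrightarrow> opp H (opp H d) = d"
    "\<And>d. d \<in> darts H \<Longrightarrow> lab H (rot H d) = lab H d"
    using p by (auto simp: planar_map_def)
  show "dark_darts H \<subseteq> darts H" by (auto simp: dark_darts_def)
  fix d assume d: "d \<in> darts H"
  have o: "opp H d \<in> darts H" using p d by (auto simp: planar_map_def)
  have "right_face H d \<in> dark H \<longleftrightarrow> right_face H (opp H d) \<in> light_faces H"
    using h d by (simp add: hypermap_def)
  moreover have "right_face H (opp H d) \<in> faces H" using o by (simp add: faces_def)
  ultimately show "opp H d \<in> dark_darts H \<longleftrightarrow> d \<notin> dark_darts H"
    using d o by (auto simp: dark_darts_def light_faces_def)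
qed

sublocale well_hmap \<subseteq> alt_map H "dark_darts H"
proof
  fix d assume d: "d \<in> darts H"
  have o: "opp H d \<in> darts H" using opp d by blast
  have "rot H d = cw H (opp H d)" using opp d by (simp add: cw_def)
  then have "right_face H (rot H d) = right_face H (opp H d)"
    using orbit_step_on[OF perm_cw o] by (simp add: right_face_def)
  then show "rot H d \<in> dark_darts H \<longleftrightarrow> d \<notin> dark_darts H"
    using opp_iff[OF d] o rot_mem[OF d] by (simp add: dark_darts_def)
qed

context well_hmap
begin

abbreviation "A \<equiv> dark_darts H"

lemma planar: "planar_map H" and dark_sub: "dark H \<subseteq> faces H"
  using well by (auto simp: well_labelled_def hypermap_def)

lemma dark_iff: "f \<in> dark H \<longleftrightarrow> f \<in> faces H \<and> f \<inter> A \<noteq> {}"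
proof
  assume f: "f \<in> dark H"
  then obtain d where d: "d \<in> darts H" "f = orbit (cw H) d" 
    using dark_sub by (auto simp: faces_eq cycles_def)
  then have "d \<in> A" using f by (simp add: dark_darts_def right_face_def)
  then show "f \<in> faces H \<and> f \<inter> A \<noteq> {}" using d face_of by blast
next
  assume f: "f \<in> faces H \<and> f \<inter> A \<noteq> {}"
  then obtain d where "d \<in> f" "d \<in> A" by blast
  then show "f \<in> dark H" using f faceE(1)[of f d] by (simp add: dark_darts_def right_face_def)
qed

lemma dark_eq: "dark H = orbit (cw H) ` A"
proof (intro equalityI subsetI)
  fix f assume "f \<in> dark H"
  then obtain d where "f \<in> faces H" "d \<in> f" "d \<in> A" using dark_iff by blast
  then show "f \<in> orbit (cw H) ` A" using faceE(1)[of f d] by simp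
next
  fix f assume "f \<in> orbit (cw H) ` A"
  then obtain d where d: "d \<in> A" "f = orbit (cw H) d" by blast
  then show "f \<in> dark H" using dark_iff face_of[OF darts_mem[OF d(1)]] by blast
qed

lemma Union_dark: "\<Union> (dark H) = A"
proof (intro equalityI subsetI)
  fix d assume "d \<in> \<Union> (dark H)"
  then obtain f where "f \<in> dark H" "d \<in> f" by blast
  then show "d \<in> A" using dark_iff[of f] face_subset[of f] by blast
next
  fix d assume "d \<in> A"
  then have "orbit (cw H) d \<in> dark H" "d \<in> orbit (cw H) d" using dark_eq face_of(2)[OF darts_mem] by auto
  then show "d \<in> \<Union> (dark H)" by blast
qed

lemma light_iff: "f \<in> light_faces H \<longleftrightarrow> f \<in> faces H \<and> f \<inter> A = {}"
  using dark_iff by (auto simp: light_faces_def)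

end

sublocale well_hmap \<subseteq> luk_map H "dark_darts H"
proof
  obtain d where "d \<in> darts H" using planar by (auto simp: planar_map_def)
  then show "A \<noteq> {}" using opp_iff[of d] by blast
  show "\<And>d e. d \<in> A \<Longrightarrow> e \<in> A \<Longrightarrow> (d, e) \<in> half_conn H A"
    using half_connected planar by (auto simp: planar_map_def)
  show "card (cycles (vnext H A) A) + card (cycles (fnext H A) A) + card (cycles (lnext H A) A) = card A + 2"
    using planar card_vertices card_faces card_edges by (simp add: planar_map_def)
  fix d assume d: "d \<in> A"
  then have "lab H (opp H d) \<ge> lab H d - 1" 
    using well by (auto simp: well_labelled_def dark_darts_def)
  then show "lab H (fnext H A d) \<ge> lab H d - 1"
    using fnext_eq[OF d] lab_rot[OF opp(1)[OF darts_mem[OF d]]] by (simp add: cw_def)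
qed

text \<open>
  The hypermap on the darts of \<open>M\<close> whose dark darts are \<open>A\<close>; its rotation is forced by
  \<open>alt_map.rot_eq\<close> and \<open>alt_map.rot_eq'\<close>.
\<close>

definition hyper_of :: "('d, int, 'z) lmap_scheme \<Rightarrow> 'd set \<Rightarrow> 'd hmap" where
  "hyper_of M A =
     \<lparr>darts = darts M,
      rot = (\<lambda>x. if x \<in> A then opp M (inv_into A (lnext M A) x) else fnext M A (opp M x)),
      opp = opp M,
      lab = (\<lambda>x. if x \<in> A then lab M x else lab M (fnext M A (opp M x))),
      dark = cycles (fnext M A) A\<rparr>"

section \<open>The hypermap with given reduced data\<close>

context luk_map
begin

lemma opp_notin: "x \<in> A \<Longrightarrow> opp M x \<notin> A"
  using opp_iff darts_mem by blast

lemma opp_in: "x \<in> darts M \<Longrightarrow> x \<notin> A \<Longrightarrow> opp M x \<in> A"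
  using opp_iff by blast

lemma hyper_of_simps: "darts (hyper_of M A) = darts M" "opp (hyper_of M A) = opp M"
  "x \<in> A \<Longrightarrow> rot (hyper_of M A) x = opp M (inv_into A (lnext M A) x)"
  "x \<notin> A \<Longrightarrow> rot (hyper_of M A) x = fnext M A (opp M x)"
  "x \<in> A \<Longrightarrow> lab (hyper_of M A) x = lab M x"
  "x \<notin> A \<Longrightarrow> lab (hyper_of M A) x = lab M (fnext M A (opp M x))"
  by (auto simp: hyper_of_def)

lemma hyper_of_alt_map: "alt_map (hyper_of M A) A"
proof
  let ?H = "hyper_of M A"
  note i = inv_into_mem[OF perm_lnext] 
  note s = hyper_of_simps
  show "finite (darts ?H)" using fin by (simp add: s)
  have mem: "rot ?H x \<in> darts M" "rot ?H x \<in> A \<longleftrightarrow> x \<notin> A" if "x \<in> darts M" for x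
    using i[of x] fnext_mem[of "opp M x"] opp_in[OF that] opp(1) opp_notin darts_mem
    by (cases "x \<in> A"; simp add: s)+
  have "perm_on (rot ?H) (darts M)"
  proof (rule perm_onI[OF fin mem(1)])
    show "inj_on (rot ?H) (darts M)"
    proof (rule inj_onI)
      fix x y assume xy: "x \<in> darts M" "y \<in> darts M" "rot ?H x = rot ?H y"
      show "x = y"
      proof (cases "x \<in> A")
        case True
        then have "y \<in> A" using mem(2)[OF xy(1)] mem(2)[OF xy(2)] xy(3) by simp
        then have "inv_into A (lnext M A) x = inv_into A (lnext M A) y"
          using xy(3) True i darts_mem by (simp add: s perm_on_eq_iff[OF perm_opp])
        then show ?thesis using perm_on_eq_iff[OF inv_into_perm[OF perm_lnext] True \<open>y \<in> A\<close>] by simp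
      next
        case False
        then have "y \<notin> A" using mem(2)[OF xy(1)] mem(2)[OF xy(2)] xy(3) by simp
        then have "fnext M A (opp M x) = fnext M A (opp M y)" using xy(3) False by (simp add: s)
        then have "opp M x = opp M y"
          using perm_on_eq_iff[OF perm_fnext opp_in[OF xy(1) False] opp_in[OF xy(2) \<open>y \<notin> A\<close>]] by simp
        then show ?thesis using perm_on_eq_iff[OF perm_opp xy(1,2)] by simp
      qed
    qed
  qed
  then show "bij_betw (rot ?H) (darts ?H) (darts ?H)" by (simp add: perm_on_def s)
  show "\<And>d. d \<in> darts ?H \<Longrightarrow> opp ?H d \<in> darts ?H" "\<And>d. d \<in> darts ?H \<Longrightarrow> opp ?H (opp ?H d) = d"
    "A \<subseteq> darts ?H" "\<And>d. d \<in> darts ?H \<Longrightarrow> opp ?H d \<in> A \<longleftrightarrow> d \<notin> A"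
    "\<And>d. d \<in> darts ?H \<Longrightarrow> rot ?H d \<in> A \<longleftrightarrow> d \<notin> A"
    using opp sub opp_iff mem by (auto simp: s(1,2))
  fix d assume d: "d \<in> darts ?H"
  show "lab ?H (rot ?H d) = lab ?H d"
  proof (cases "d \<in> A")
    case True
    \<comment> \<open>An unselected dart takes its label from the selected dart that follows it in
      the rotation. The rotation of a selected dart is the reverse of its \<phi>-predecessor, and
      \<open>lab_lnext\<close> says that the two labels agree.\<close>
    have "lab ?H (rot ?H d) = lab M (fnext M A (opp M (rot ?H d)))"
      using mem(2)[of d] True darts_mem by (simp add: s)
    also have "opp M (rot ?H d) = inv_into A (lnext M A) d" using opp(2)[OF darts_mem[OF i[OF True]]] True by (simp add: s)
    also have "lab M (fnext M A (inv_into A (lnext M A) d)) = lab M d" 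
      using lab_lnext[OF i[OF True]] inv_into_right[OF perm_lnext True] by simp
    finally show ?thesis using True by (simp add: s)
  next
    case False
    then show ?thesis using fnext_mem[OF opp_in, of d] d by (simp add: s)
  qed
qed

lemma hyper_of_half_iso: "half_iso id M A (hyper_of M A) A"
proof -
  interpret h: alt_map "hyper_of M A" A by (rule hyper_of_alt_map)
  note s = hyper_of_simps
  have "fnext (hyper_of M A) A d = fnext M A d" if "d \<in> A" for d
    using h.fnext_eq[OF that] opp_notin[OF that] opp(2)[OF darts_mem[OF that]] by (simp add: cw_def s)
  moreover have "vnext (hyper_of M A) A d = vnext M A d" if d: "d \<in> A" for d
  proof -
    let ?e = "inv_into A (lnext M A) d"
    have e: "?e \<in> A" using inv_into_mem[OF perm_lnext d] .
    have "vnext (hyper_of M A) A d = fnext M A (opp M (opp M ?e))"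
      using h.vnext_eq[OF d] d opp_notin[OF e] by (simp add: s)
    also have "\<dots> = vnext M A (lnext M A ?e)" using vnext_lnext[OF e] opp(2)[OF darts_mem[OF e]] by simp
    finally show ?thesis using inv_into_right[OF perm_lnext d] by simp
  qed
  ultimately show ?thesis by (simp add: half_iso_def s)
qed

text \<open>Dark faces are the cycles of \<open>fnext\<close> and light ones correspond to those of
  \<open>lnext\<close>, so Euler's relation for the hypermap is \<open>euler\<close>.\<close>

lemma hyper_of_well: "well_labelled (hyper_of M A)" "dark_darts (hyper_of M A) = A"
proof -
  let ?H = "hyper_of M A"
  interpret h: alt_map ?H A by (rule hyper_of_alt_map)
  note s = hyper_of_simps
  have v: "vnext ?H A d = vnext M A d" and f: "fnext ?H A d = fnext M A d" if "d \<in> A" for d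
    using hyper_of_half_iso that by (auto simp: half_iso_def)
  have l: "lnext ?H A d = lnext M A d" if "d \<in> A" for d
    using half_iso_lnext[OF half_map_axioms h.half_map_axioms hyper_of_half_iso that] by simp
  have orb: "orbit (cw ?H) d = orbit (fnext M A) d" if "d \<in> A" for d
    using orbit_cong_on[OF perm_fnext _ that, of "cw ?H"] h.fnext_eq f by simp
  have dark: "orbit (cw ?H) d \<in> dark ?H \<longleftrightarrow> d \<in> A" if "d \<in> darts ?H" for d
  proof
    assume "orbit (cw ?H) d \<in> dark ?H"
    then obtain e where "e \<in> A" "orbit (cw ?H) d = orbit (fnext M A) e" by (auto simp: hyper_of_def cycles_def)
    then show "d \<in> A" using h.face_of(2)[OF that] orbit_subset_dom[OF perm_fnext] by blast
  next
    assume "d \<in> A"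
    then show "orbit (cw ?H) d \<in> dark ?H" unfolding orb[OF \<open>d \<in> A\<close>] by (simp add: hyper_of_def cycles_def)
  qed
  show dd: "dark_darts ?H = A" using dark sub by (auto simp: dark_darts_def right_face_def s)
  have "connected_map ?H"
  proof (rule h.connected_mapI)
    have "graph_on (vnext ?H A) A = graph_on (vnext M A) A" "graph_on (fnext ?H A) A = graph_on (fnext M A) A"
      unfolding graph_on_def using v f by auto
    then show "(d, e) \<in> half_conn ?H A" if "d \<in> A" "e \<in> A" for d e
      using half_connected[OF that] by (simp add: half_conn_def)
  qed
  moreover have "card (vertices ?H) + card (faces ?H) = card (edges ?H) + 2"
    unfolding h.card_vertices h.card_faces h.card_edges 
    using euler cycles_cong[OF perm_vnext v] cycles_cong[OF perm_fnext f] cycles_cong[OF perm_lnext l] by simp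
  moreover have "darts ?H \<noteq> {}" using nonempty sub by (auto simp: s)
  moreover have "opp ?H d \<noteq> d" if "d \<in> darts ?H" for d using opp_iff[of d] that by (auto simp: s)
  ultimately have p: "planar_map ?H" unfolding planar_map_def
    using h.fin h.bij_rot h.opp h.lab_rot by blast
  have "dark ?H \<subseteq> faces ?H"
  proof
    fix c assume "c \<in> dark ?H"
    then obtain e where "e \<in> A" "c = orbit (cw ?H) e" using orb by (auto simp: hyper_of_def cycles_def)
    then show "c \<in> faces ?H" using h.face_of(1) h.darts_mem by blast
  qed
  moreover have "right_face ?H d \<in> dark ?H \<longleftrightarrow> right_face ?H (opp ?H d) \<in> light_faces ?H" if "d \<in> darts ?H" for d
    using dark[OF that] dark[OF h.opp(1)[OF that]] h.opp_iff[OF that] h.face_of(1)[OF h.opp(1)[OF that]]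
    by (simp add: right_face_def light_faces_def)
  ultimately have "hypermap ?H" unfolding hypermap_def using p h.even_vertex by blast
  moreover have "lab ?H (opp ?H d) \<ge> lab ?H d - 1" if "d \<in> darts ?H" "right_face ?H d \<in> dark ?H" for d
  proof -
    have d: "d \<in> A" using that dark by (simp add: right_face_def)
    then show ?thesis using luk[OF d] opp_notin[OF d] opp(2)[OF darts_mem[OF d]] by (simp add: s)
  qed
  ultimately show "well_labelled ?H" unfolding well_labelled_def by blast
qed

end

text \<open>\<open>rot_eq\<close> and \<open>rot_eq'\<close> express the rotation by
  \<open>lnext\<close>, \<open>fnext\<close> and \<open>opp\<close>, all of which the extension of a
  half-isomorphism respects.\<close>

theorem well_hmap_unique:
  fixes H :: "'d hmap" and H' :: "'e hmap"
  assumes "well_hmap H" "well_hmap H'" "half_iso h H (dark_darts H) H' (dark_darts H')"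
  shows "hmap_isomorphic H H'"
proof -
  interpret m: well_hmap H by fact
  interpret m': well_hmap H' by fact
  define g where "g = extend_half h H m.A H'"
  have h: "bij_betw h m.A m'.A" and hd: "\<And>d. d \<in> m.A \<Longrightarrow> h (vnext H m.A d) = vnext H' m'.A (h d) 
      \<and> h (fnext H m.A d) = fnext H' m'.A (h d) \<and> lab H' (h d) = lab H d"
    using assms(3) by (auto simp: half_iso_def)
  have hA: "h ` m.A = m'.A" "inj_on h m.A" "\<And>d. d \<in> m.A \<Longrightarrow> h d \<in> m'.A" using h by (auto simp: bij_betw_def)
  note hl = half_iso_lnext[OF m.half_map_axioms m'.half_map_axioms assms(3)]
  note g = extend_half[OF m.half_map_axioms m'.half_map_axioms h, folded g_def]
  have DO: "\<exists>y\<in>m.A. x = opp H y" if "x \<in> darts H" "x \<notin> m.A" for x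
    using m.opp_in[OF that] m.opp(2)[OF that(1)] by metis
  have g_rot: "g (rot H x) = rot H' (g x) \<and> lab H' (g x) = lab H x" if x: "x \<in> darts H" for x
  proof (cases "x \<in> m.A")
    case True
    let ?y = "opp H (rot H x)"
    have y: "?y \<in> m.A" "lnext H m.A ?y = x" using m.opp_rot_mem[OF True] m.lnext_opp_rot[OF True] by auto
    have "inv_into m'.A (lnext H' m'.A) (h x) = h ?y"
      using hl[OF y(1)] inv_into_left[OF m'.perm_lnext hA(3)[OF y(1)]] y(2) by simp
    then have "rot H' (h x) = opp H' (h ?y)" using m'.rot_eq[OF hA(3)[OF True]] by simp
    moreover have "g (rot H x) = opp H' (h ?y)" using g(2)[OF y(1)] m.opp(2)[OF m.rot_mem[OF x]] by simp
    ultimately have "g (rot H x) = rot H' (g x)" using g(1)[OF True] by simp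
    then show ?thesis using True hd g(1) by simp
  next
    case False
    then obtain y where y: "y \<in> m.A" "x = opp H y" using DO[OF x False] by blast
    have x': "opp H' (h y) \<in> darts H'" "opp H' (h y) \<notin> m'.A" "opp H' (opp H' (h y)) = h y"
      using hA(3)[OF y(1)] m'.opp m'.opp_notin m'.darts_mem by auto
    have "rot H x = fnext H m.A y" using m.rot_eq'[OF x False] y m.opp(2)[OF m.darts_mem] by simp
    moreover have "rot H' (opp H' (h y)) = fnext H' m'.A (h y)" using m'.rot_eq'[OF x'(1,2)] x'(3) by simp
    ultimately have *: "rot H' (g x) = h (rot H x)" "rot H x \<in> m.A" 
      using g(2)[OF y(1)] hd[OF y(1)] m.fnext_mem[OF y(1)] y(2) by auto
    have "g x = opp H' (h y)" unfolding y(2) by (rule g(2)[OF y(1)])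
    then have "lab H' (g x) = lab H' (rot H' (g x))" using m'.lab_rot[OF x'(1)] by (simp only:)
    also have "\<dots> = lab H x" unfolding *(1) using hd[OF *(2)] m.lab_rot[OF x] by simp
    finally show ?thesis using * g(1)[OF *(2)] by simp
  qed
  have iso: "lmap_iso g H H'" unfolding lmap_iso_def using g_rot g(3,4) by blast
  have gof: "g ` orbit (cw H) d = orbit (cw H') (h d)" if d: "d \<in> m.A" for d
  proof -
    have "g ` orbit (cw H) d = orbit (cw H') (g d)"
    proof (rule orbit_conj[where D = "darts H"])
      fix x assume x: "x \<in> darts H"
      then show "cw H x \<in> darts H \<and> g (cw H x) = cw H' (g x)"
        using g_rot[OF m.opp(1)[OF x]] g(3)[OF x] m.cw_mem[OF x] unfolding cw_def by metis
    qed (rule m.darts_mem[OF d])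
    then show ?thesis using g(1)[OF d] by simp
  qed
  have "(\<lambda>f. g ` f) ` dark H = dark H'"
    unfolding m.dark_eq m'.dark_eq hA(1)[symmetric] image_image using gof by (rule image_cong[OF refl])
  then show ?thesis unfolding hmap_isomorphic_def using iso by blast
qed

lemma half_iso_of_hmap_iso:
  assumes "well_hmap H" "well_hmap H'" "lmap_iso g H H'" "(\<lambda>f. g ` f) ` dark H = dark H'"
  shows "half_iso g H (dark_darts H) H' (dark_darts H')"
proof -
  interpret m: well_hmap H by fact
  interpret m': well_hmap H' by fact
  have "g ` m.A = m'.A" unfolding m.Union_dark[symmetric] m'.Union_dark[symmetric] assms(4)[symmetric] by (rule image_Union)
  then show ?thesis using half_iso_of_lmap_iso[OF m.half_map_axioms m'.half_map_axioms assms(3)] by blast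
qed

section \<open>From well-labelled hypermaps to suitably labelled maps\<close>

context luk_map
begin

abbreviation \<phi> :: "'d \<Rightarrow> 'd" where "\<phi> \<equiv> lnext M A"

definition minimal :: "'d set" where
  "minimal = {e \<in> A. \<forall>y\<in>orbit \<phi> e. lab M e \<le> lab M y}"

definition succ :: "'d \<Rightarrow> 'd" where
  "succ e = next_in \<phi> {t \<in> A. lab M t = lab M e - 1} e"

definition preds :: "'d \<Rightarrow> 'd set" where
  "preds t = {s \<in> A - minimal. succ s = t}"

text \<open>The counterpart of \<open>next_incoming\<close>: the half-edge that follows in the
  corner of \<open>t\<close>. Where \<open>next_incoming\<close> yields
  \<open>Base (rot S t)\<close>, which gets erased, the next outgoing half-edge is taken, that of
  \<open>vnext M A t\<close>.\<close>

definition incoming :: "'d \<Rightarrow> 'd \<Rightarrow> 'd" where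
  "incoming t s = (let q = next_in \<phi> (insert t (preds t)) s in if q = t then vnext M A t else opp M q)"

definition psi_rot :: "'d \<Rightarrow> 'd" where
  "psi_rot x = (if x \<in> A then incoming x x
     else if opp M x \<in> minimal then opp M (next_in \<phi> minimal (opp M x))
     else incoming (succ (opp M x)) (opp M x))"

text \<open>
  In \<open>psi_of\<close>, a dart \<open>s \<in> A\<close> plays the role of the half-edge \<open>Out (White s)\<close> of \<open>Psi_figure\<close>, and
  \<open>opp M s\<close> that of \<open>In (White s)\<close>.
\<close>

definition psi_of :: "('d, int) lmap" where
  "psi_of = \<lparr>darts = darts M, rot = psi_rot, opp = opp M,
     lab = (\<lambda>x. if x \<in> A then lab M x else lab M (opp M x) - 1)\<rparr>"

section \<open>Labels and successors along a cycle of \<phi>\<close>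

lemma lab_\<phi>: "e \<in> A \<Longrightarrow> lab M (\<phi> e) \<ge> lab M e - 1"
  using lab_lnext luk by simp

lemma \<phi>_pow_mem: "e \<in> A \<Longrightarrow> (\<phi> ^^ k) e \<in> A"
  using funpow_mem[OF perm_lnext] .

text \<open>Labels drop by at most one per step of \<phi>, so on the way from a label at least
  \<open>c\<close> to one at most \<open>c\<close> the value \<open>c\<close> cannot be
  skipped.\<close>

lemma first_visit:
  assumes "e \<in> A" "m \<le> n" "lab M ((\<phi> ^^ n) e) \<le> c" "c \<le> lab M ((\<phi> ^^ m) e)"
  obtains i where "m \<le> i" "i \<le> n" "lab M ((\<phi> ^^ i) e) = c" 
    "\<And>j. m \<le> j \<Longrightarrow> j < i \<Longrightarrow> lab M ((\<phi> ^^ j) e) > c"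
proof -
  let ?P = "\<lambda>i. m \<le> i \<and> lab M ((\<phi> ^^ i) e) \<le> c"
  define i where "i = (LEAST i. ?P i)"
  have i: "?P i" unfolding i_def by (rule LeastI[of ?P n]) (use assms in simp)
  have min: "\<not> ?P j" if "j < i" for j using not_less_Least[of j ?P] that by (simp add: i_def)
  have "i \<le> n" unfolding i_def by (rule Least_le) (use assms in simp)
  moreover have "lab M ((\<phi> ^^ i) e) = c"
  proof (cases "i = m")
    case True
    then show ?thesis using i assms by simp
  next
    case False
    then have "m \<le> i - 1" "i - 1 < i" "Suc (i - 1) = i" using i by auto
    then have "c < lab M ((\<phi> ^^ (i - 1)) e)" using min[of "i - 1"] by simp
    moreover have "(\<phi> ^^ i) e = \<phi> ((\<phi> ^^ (i - 1)) e)" 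
      using \<open>Suc (i - 1) = i\<close> by (metis funpow.simps(2) comp_apply)
    ultimately show ?thesis using lab_\<phi>[OF \<phi>_pow_mem[OF assms(1), of "i - 1"]] i by simp
  qed
  moreover have "lab M ((\<phi> ^^ j) e) > c" if "m \<le> j" "j < i" for j using min[OF that(2)] that(1) by simp
  ultimately show thesis using that[of i] i by blast
qed

lemma succ_eqI:
  assumes "e \<in> A" "0 < k" "lab M ((\<phi> ^^ k) e) = lab M e - 1" 
    "\<And>j. 0 < j \<Longrightarrow> j < k \<Longrightarrow> lab M ((\<phi> ^^ j) e) > lab M e - 1"
  shows "succ e = (\<phi> ^^ k) e" "e \<notin> minimal"
proof -
  show "succ e = (\<phi> ^^ k) e" unfolding succ_def
  proof (rule next_in_eqI[OF assms(2)])
    show "(\<phi> ^^ k) e \<in> {t \<in> A. lab M t = lab M e - 1}" using assms(3) \<phi>_pow_mem[OF assms(1)] by simp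
    fix j assume "0 < j" "j < k"
    then show "(\<phi> ^^ j) e \<notin> {t \<in> A. lab M t = lab M e - 1}" using assms(4)[of j] by simp
  qed
  show "e \<notin> minimal" using funpow_mem_orbit[OF assms(2), of \<phi> e] assms(3) by (force simp: minimal_def)
qed

text \<open>By \<open>first_visit\<close> no lower label occurs before the successor is met, so up
  to there all labels stay at least \<open>lab M e\<close>.\<close>

lemma succ_obtain:
  assumes "e \<in> A" "e \<notin> minimal"
  obtains k where "0 < k" "succ e = (\<phi> ^^ k) e" "lab M ((\<phi> ^^ k) e) = lab M e - 1"
    "\<And>j. j < k \<Longrightarrow> lab M ((\<phi> ^^ j) e) > lab M e - 1"
proof -
  obtain n where n: "lab M ((\<phi> ^^ n) e) \<le> lab M e - 1"
  proof -
    obtain y where "y \<in> orbit \<phi> e" "lab M y < lab M e" using assms by (auto simp: minimal_def not_le)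
    then show thesis using that by (auto simp: orbit_eq_funpow)
  qed
  have "(0::nat) \<le> n" "lab M e - 1 \<le> lab M ((\<phi> ^^ 0) e)" by simp_all
  then obtain k where k: "lab M ((\<phi> ^^ k) e) = lab M e - 1" 
      "\<And>j. 0 \<le> j \<Longrightarrow> j < k \<Longrightarrow> lab M ((\<phi> ^^ j) e) > lab M e - 1"
    using first_visit[OF assms(1) _ n, of 0] by blast
  have "k \<noteq> 0"
  proof
    assume "k = 0"
    then show False using k(1) by simp
  qed
  then show thesis using that[of k] succ_eqI(1)[OF assms(1) _ k(1)] k by simp
qed

lemma succ_mem: 
  assumes "e \<in> A" "e \<notin> minimal"
  shows "succ e \<in> A" "lab M (succ e) = lab M e - 1" "succ e \<in> orbit \<phi> e"
proof -
  obtain k where "0 < k" "succ e = (\<phi> ^^ k) e" "lab M ((\<phi> ^^ k) e) = lab M e - 1"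
    using succ_obtain[OF assms] by blast
  then show "succ e \<in> A" "lab M (succ e) = lab M e - 1" "succ e \<in> orbit \<phi> e"
    using \<phi>_pow_mem[OF assms(1)] funpow_mem_orbit by auto
qed

lemma minimal_sub: "minimal \<subseteq> A"
  by (auto simp: minimal_def)

lemma minimal_orbit_iff:
  assumes "e \<in> minimal" "y \<in> orbit \<phi> e"
  shows "y \<in> minimal \<longleftrightarrow> lab M y = lab M e"
proof -
  have e: "e \<in> A" using assms(1) minimal_sub by blast
  have y: "y \<in> A" using orbit_subset_dom[OF perm_lnext e] assms(2) by blast
  have "orbit \<phi> y = orbit \<phi> e" using orbit_eq_on[OF perm_lnext e assms(2)] .
  moreover have "e \<in> orbit \<phi> e" using self_mem_orbit[OF perm_lnext e] .
  ultimately show ?thesis using assms y by (fastforce simp: minimal_def)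
qed

lemma minimal_exists:
  assumes "e \<in> A"
  shows "orbit \<phi> e \<inter> minimal \<noteq> {}"
proof -
  have sub: "orbit \<phi> e \<subseteq> A" using orbit_subset_dom[OF perm_lnext assms] .
  then have f: "finite (lab M ` orbit \<phi> e)" using finA finite_subset by blast
  then have "Min (lab M ` orbit \<phi> e) \<in> lab M ` orbit \<phi> e"
    using self_mem_orbit[OF perm_lnext assms] by (intro Min_in) auto
  then obtain y where y: "y \<in> orbit \<phi> e" "lab M y = Min (lab M ` orbit \<phi> e)" by force
  have "y \<in> minimal" unfolding minimal_def using y f sub orbit_eq_on[OF perm_lnext assms y(1)] by auto
  then show ?thesis using y by blast
qed

section \<open>The rotation of \<open>psi_of\<close>\<close>

abbreviation slots :: "'d \<Rightarrow> 'd set" where "slots t \<equiv> insert t (preds t)"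

lemma preds_mem: 
  assumes "s \<in> preds t"
  shows "s \<in> A" "s \<notin> minimal" "succ s = t" "lab M t = lab M s - 1" "s \<in> orbit \<phi> t" "t \<in> A" "s \<noteq> t"
proof -
  show s: "s \<in> A" "s \<notin> minimal" "succ s = t" using assms by (auto simp: preds_def)
  show "lab M t = lab M s - 1" "t \<in> A" using succ_mem[OF s(1,2)] s(3) by auto
  then show "s \<noteq> t" by auto
  show "s \<in> orbit \<phi> t" using orbit_sym_on[OF perm_lnext s(1)] succ_mem(3)[OF s(1,2)] s(3) by blast
qed

lemma slots_sub: "t \<in> A \<Longrightarrow> slots t \<subseteq> A"
  using preds_mem(1) by blast

lemma slots_perm: "t \<in> A \<Longrightarrow> perm_on (next_in \<phi> (slots t)) (slots t)"
  using next_in_perm[OF perm_lnext slots_sub] .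

lemma slots_orbit: "t \<in> A \<Longrightarrow> orbit (next_in \<phi> (slots t)) t = slots t"
  using orbit_next_in[OF perm_lnext slots_sub, of t t] preds_mem(5) self_mem_orbit[OF perm_lnext] by blast

lemma psi_simps: "darts psi_of = darts M" "opp psi_of = opp M" "rot psi_of = psi_rot"
  "x \<in> A \<Longrightarrow> lab psi_of x = lab M x" "x \<notin> A \<Longrightarrow> lab psi_of x = lab M (opp M x) - 1"
  by (auto simp: psi_of_def)

lemma opp_opp: "x \<in> A \<Longrightarrow> opp M (opp M x) = x"
  using opp(2) darts_mem by blast

lemma psi_rot_in: "t \<in> A \<Longrightarrow> psi_rot t = incoming t t"
  by (simp add: psi_rot_def)

lemma psi_rot_min: "s \<in> minimal \<Longrightarrow> psi_rot (opp M s) = opp M (next_in \<phi> minimal s)"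
  using opp_opp[of s] opp_notin[of s] minimal_sub by (auto simp: psi_rot_def)

lemma psi_rot_pred: "s \<in> preds t \<Longrightarrow> psi_rot (opp M s) = incoming t s"
  using opp_opp[of s] opp_notin[of s] preds_mem[of s t] by (simp add: psi_rot_def)

text \<open>Half-edge in the corner of \<open>t\<close>: the outgoing one for \<open>t\<close>
  itself, the arriving end of the chord for a predecessor.\<close>

definition slot_dart :: "'d \<Rightarrow> 'd \<Rightarrow> 'd" where
  "slot_dart t s = (if s = t then t else opp M s)"

lemma psi_rot_slot: "t \<in> A \<Longrightarrow> s \<in> slots t \<Longrightarrow> psi_rot (slot_dart t s) = incoming t s"
  using psi_rot_in psi_rot_pred by (auto simp: slot_dart_def)

text \<open>In the drawing, a half-edge is either at a new vertex inside a face or in the corner of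
  some \<open>t\<close>.\<close>

lemma dart_cases:
  assumes "x \<in> darts M"
  obtains (min) s where "s \<in> minimal" "x = opp M s"
    | (slot) t s where "t \<in> A" "s \<in> slots t" "x = slot_dart t s"
proof (cases "x \<in> A")
  case True
  then show thesis using slot[of x x] by (simp add: slot_dart_def)
next
  case False
  note o = opp_in[OF assms False] opp(2)[OF assms]
  show thesis
  proof (cases "opp M x \<in> minimal")
    case True
    then show ?thesis using min[of "opp M x"] o by simp
  next
    case False
    then have p: "opp M x \<in> preds (succ (opp M x))" using o by (simp add: preds_def)
    then show ?thesis using slot[of "succ (opp M x)" "opp M x"] preds_mem[OF p] o by (simp add: slot_dart_def)
  qed
qed

lemma incoming_cases:
  assumes "t \<in> A" "s \<in> slots t"
  obtains "next_in \<phi> (slots t) s = t" "incoming t s = vnext M A t"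
    | q where "next_in \<phi> (slots t) s = q" "q \<in> preds t" "incoming t s = opp M q"
proof (cases "next_in \<phi> (slots t) s = t")
  case True
  then show thesis using that(1) by (simp add: incoming_def)
next
  case False
  moreover have "next_in \<phi> (slots t) s \<in> slots t" using perm_on_mem[OF slots_perm assms(2)] assms(1) by blast
  ultimately show thesis using that(2)[of "next_in \<phi> (slots t) s"] by (simp add: incoming_def)
qed

lemma next_minimal: "s \<in> minimal \<Longrightarrow> next_in \<phi> minimal s \<in> minimal" 
    "s \<in> minimal \<Longrightarrow> next_in \<phi> minimal s \<in> orbit \<phi> s"
  using next_in_mem'[OF perm_lnext minimal_sub] by blast+

text \<open>A value of \<open>psi_rot\<close> shows where it comes from: a selected dart is
  \<open>vnext M A t\<close> and ends the corner of \<open>t\<close>, the reverse of a non-minimal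
  \<open>q\<close> lies in the corner of \<open>succ q\<close>, and the reverse of a minimal one at
  a new vertex. Within a corner or around a new vertex, the returns of \<phi> are injective.\<close>

lemma psi_perm: "perm_on psi_rot (darts M)"
proof (rule perm_onI[OF fin])
  have slot_eq: "s = s' \<and> t = t'" if "t \<in> A" "s \<in> slots t" "t' \<in> A" "s' \<in> slots t'" "incoming t s = incoming t' s'" 
    for s t s' t'
  proof -
    have *: "t = t' \<and> next_in \<phi> (slots t) s = next_in \<phi> (slots t') s'"
    proof (rule incoming_cases[OF that(1,2)])
      assume 1: "next_in \<phi> (slots t) s = t" "incoming t s = vnext M A t"
      show ?thesis
      proof (rule incoming_cases[OF that(3,4)])
        assume "next_in \<phi> (slots t') s' = t'" "incoming t' s' = vnext M A t'"
        then show ?thesis using 1 that perm_on_eq_iff[OF perm_vnext] by metis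
      next
        fix q assume "q \<in> preds t'" "incoming t' s' = opp M q"
        then show ?thesis using 1 that vnext_mem[OF that(1)] opp_notin[OF preds_mem(1)] by metis
      qed
    next
      fix q assume 1: "next_in \<phi> (slots t) s = q" "q \<in> preds t" "incoming t s = opp M q"
      show ?thesis
      proof (rule incoming_cases[OF that(3,4)])
        assume "next_in \<phi> (slots t') s' = t'" "incoming t' s' = vnext M A t'"
        then show ?thesis using 1 that vnext_mem[OF that(3)] opp_notin[OF preds_mem(1)] by metis
      next
        fix q' assume 2: "next_in \<phi> (slots t') s' = q'" "q' \<in> preds t'" "incoming t' s' = opp M q'"
        then have "q = q'" using 1 that opp_opp[OF preds_mem(1)] by metis
        then show ?thesis using 1 2 preds_mem(3) by metis
      qed
    qed
    have t: "t' = t" using * by simp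
    have "next_in \<phi> (slots t) s = next_in \<phi> (slots t) s'" using conjunct2[OF *] unfolding t .
    moreover have "s' \<in> slots t" using that(4) unfolding t .
    ultimately have "s = s'" using perm_on_eq_iff[OF slots_perm[OF that(1)] that(2)] by blast
    then show ?thesis using * by blast
  qed
  have mixed: "incoming t s \<noteq> opp M (next_in \<phi> minimal s')" 
    if "t \<in> A" "s \<in> slots t" "s' \<in> minimal" for s t s'
  proof (rule incoming_cases[OF that(1,2)])
    assume "incoming t s = vnext M A t"
    then show ?thesis using vnext_mem[OF that(1)] opp_notin next_minimal(1)[OF that(3)] minimal_sub by (metis subsetD)
  next
    fix q assume "q \<in> preds t" "incoming t s = opp M q"
    then show ?thesis 
      using next_minimal(1)[OF that(3)] minimal_sub opp_opp preds_mem(1,2) by (metis subsetD)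
  qed
  show "inj_on psi_rot (darts M)"
  proof (rule inj_onI)
    fix x y assume xy: "x \<in> darts M" "y \<in> darts M" "psi_rot x = psi_rot y"
    show "x = y" using xy(1)
    proof (cases rule: dart_cases)
      case 1: (min s)
      show ?thesis using xy(2)
      proof (cases rule: dart_cases)
        case y: (min s')
        then have "opp M (next_in \<phi> minimal s) = opp M (next_in \<phi> minimal s')" using 1 xy(3) psi_rot_min by simp
        then have "next_in \<phi> minimal s = next_in \<phi> minimal s'" 
          using opp_opp next_minimal(1) 1(1) y(1) minimal_sub by (metis subsetD)
        then show ?thesis using perm_on_eq_iff[OF next_in_perm[OF perm_lnext minimal_sub]] 1 y by blast
      next
        case y: (slot t s')
        then show ?thesis using 1 xy(3) psi_rot_min mixed psi_rot_slot by metis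
      qed
    next
      case 2: (slot t s)
      show ?thesis using xy(2)
      proof (cases rule: dart_cases)
        case y: (min s')
        then show ?thesis using 2 xy(3) psi_rot_min mixed psi_rot_slot by metis
      next
        case y: (slot t' s')
        then show ?thesis using 2 slot_eq[of t s t' s'] xy(3) psi_rot_slot by metis
      qed
    qed
  qed
  show "psi_rot x \<in> darts M" if x: "x \<in> darts M" for x using x
  proof (cases rule: dart_cases)
    case 1: (min s)
    then show ?thesis using psi_rot_min next_minimal(1) minimal_sub opp(1) darts_mem by (metis subsetD)
  next
    case 2: (slot t s)
    show ?thesis
    proof (rule incoming_cases[OF 2(1,2)])
      assume "incoming t s = vnext M A t"
      then show ?thesis using 2 psi_rot_slot vnext_mem darts_mem by metis
    next
      fix q assume "q \<in> preds t" "incoming t s = opp M q"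
      then show ?thesis using 2 psi_rot_slot preds_mem(1) opp(1) darts_mem by metis
    qed
  qed
qed

lemma psi_lab_rot: 
  assumes x: "x \<in> darts M"
  shows "lab psi_of (psi_rot x) = lab psi_of x"
proof -
  have out: "lab psi_of (opp M q) = lab M q - 1" if "q \<in> A" for q
    using psi_simps(5)[OF opp_notin[OF that]] opp_opp[OF that] by simp
  show ?thesis using x
  proof (cases rule: dart_cases)
    case 1: (min s)
    then have "s \<in> A" "next_in \<phi> minimal s \<in> A" using next_minimal(1) minimal_sub by auto
    then show ?thesis using 1 out psi_rot_min next_minimal minimal_orbit_iff[OF 1(1)] by metis
  next
    case 2: (slot t s)
    have "lab psi_of x = lab M t" using 2 out preds_mem(1,4) psi_simps(4) by (auto simp: slot_dart_def)
    moreover have "lab psi_of (incoming t s) = lab M t"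
    proof (rule incoming_cases[OF 2(1,2)])
      assume "incoming t s = vnext M A t"
      then show ?thesis using lab_vnext[OF 2(1)] vnext_mem[OF 2(1)] psi_simps(4) by simp
    next
      fix q assume "q \<in> preds t" "incoming t s = opp M q"
      then show ?thesis using out preds_mem(1,4) by simp
    qed
    ultimately show ?thesis using psi_rot_slot[OF 2(1,2)] 2(3) by simp
  qed
qed

lemma psi_half_map: "half_map psi_of A"
proof
  show "finite (darts psi_of)" "bij_betw (rot psi_of) (darts psi_of) (darts psi_of)"
    using psi_perm by (auto simp: psi_simps perm_on_def)
qed (use opp sub opp_iff psi_lab_rot in \<open>auto simp: psi_simps(1,2,3)\<close>)

text \<open>Slots are traversed in the cyclic order induced by \<phi>. Those met before the return
  to \<open>t\<close> are arriving ends, hence unselected, and the return to \<open>t\<close> is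
  replaced by a step to \<open>vnext M A t\<close>.\<close>

lemma psi_rot_run:
  assumes t: "t \<in> A" and s: "s \<in> slots t"
  obtains m where "0 < m" "(psi_rot ^^ m) (slot_dart t s) = vnext M A t"
    "\<And>j. 0 < j \<Longrightarrow> j < m \<Longrightarrow> (psi_rot ^^ j) (slot_dart t s) \<notin> A"
proof -
  let ?u = "next_in \<phi> (slots t)"
  have "t \<in> orbit ?u s" 
    using orbit_sym_on[OF slots_perm[OF t], of t s] slots_orbit[OF t] s by blast
  then have "orbit ?u s \<inter> {t} \<noteq> {}" by blast
  then obtain m where m: "0 < m" "(?u ^^ m) s \<in> {t}" "\<And>j. 0 < j \<Longrightarrow> j < m \<Longrightarrow> (?u ^^ j) s \<notin> {t}"
    by (rule next_in_obtain_orbit) (rule that; assumption)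
  have mem: "(?u ^^ j) s \<in> slots t" for j using funpow_mem[OF slots_perm[OF t] s] .
  have r: "(psi_rot ^^ j) (slot_dart t s) = slot_dart t ((?u ^^ j) s)" if "j < m" for j
    using that
  proof (induction j)
    case (Suc j)
    have "(psi_rot ^^ Suc j) (slot_dart t s) = incoming t ((?u ^^ j) s)"
      using Suc psi_rot_slot[OF t mem[of j]] by simp
    also have "\<dots> = opp M ((?u ^^ Suc j) s)" using m(3)[of "Suc j"] Suc.prems by (simp add: incoming_def)
    finally show ?case using m(3)[of "Suc j"] Suc.prems by (simp add: slot_dart_def)
  qed simp
  have "(psi_rot ^^ m) (slot_dart t s) = incoming t ((?u ^^ (m - 1)) s)"
    using r[of "m - 1"] m(1) psi_rot_slot[OF t mem[of "m - 1"]] by (cases m) auto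
  moreover have "?u ((?u ^^ (m - 1)) s) = t" using m(1,2) by (cases m) auto
  ultimately have "(psi_rot ^^ m) (slot_dart t s) = vnext M A t" by (simp add: incoming_def)
  moreover have "(psi_rot ^^ j) (slot_dart t s) \<notin> A" if j: "0 < j" "j < m" for j
  proof -
    have "(?u ^^ j) s \<in> preds t" using mem[of j] m(3)[OF j] by blast
    then show ?thesis using r[OF j(2)] opp_notin[OF preds_mem(1)] preds_mem(7) by (simp add: slot_dart_def)
  qed
  ultimately show thesis using that m(1) by blast
qed

lemma psi_vnext:
  assumes "e \<in> A"
  shows "vnext psi_of A e = vnext M A e"
proof -
  obtain m where "0 < m" "(psi_rot ^^ m) (slot_dart e e) = vnext M A e"
    "\<And>j. 0 < j \<Longrightarrow> j < m \<Longrightarrow> (psi_rot ^^ j) (slot_dart e e) \<notin> A"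
    using psi_rot_run[OF assms, of e] by blast
  moreover have "slot_dart e e = e" by (simp add: slot_dart_def)
  ultimately show ?thesis
    unfolding vnext_def psi_simps using next_in_eqI[of m psi_rot e A] vnext_mem[OF assms] 
    by (simp add: vnext_def)
qed

text \<open>
  The contour of the face of \<open>psi_of\<close> to the right of \<open>e\<close> visits, in this order, the first elements with
  labels \<open>lab M e, lab M e + 1, \<dots>, lab M (\<phi> e)\<close> on the cycle of \<open>\<phi>\<close> after \<open>e\<close>. Below, positions on this
  cycle are counted from \<open>e\<close>, which is at the end, at position \<open>n\<close>.
\<close>

context
  fixes e n
  assumes e: "e \<in> A" and n: "0 < n" "(\<phi> ^^ n) e = e" "\<And>j. 0 < j \<Longrightarrow> j < n \<Longrightarrow> (\<phi> ^^ j) e \<noteq> e"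
begin

abbreviation pos :: "nat \<Rightarrow> 'd" where "pos i \<equiv> (\<phi> ^^ i) e"

lemma pos_inj:
  assumes "0 < i" "i \<le> n" "0 < j" "j \<le> n" "pos i = pos j"
  shows "i = j"
proof -
  have "i = j" if "0 < i" "i \<le> j" "j \<le> n" "pos i = pos j" for i j
  proof (rule ccontr)
    assume "i \<noteq> j"
    have "e = (\<phi> ^^ (j - i)) e" using funpow_eq_diff[OF perm_lnext e e that(4,2)] .
    moreover have "0 < j - i" "j - i < n" using that \<open>i \<noteq> j\<close> by auto
    ultimately show False using n(3) by metis
  qed
  from this[of i j] this[of j i] show ?thesis using assms by (metis nat_le_linear)
qed

lemma pos_add: "(\<phi> ^^ k) (pos i) = pos (k + i)"
  by (simp add: funpow_add)

lemma pos_mod: "pos (i + n) = pos i"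
  by (simp add: funpow_add n(2))

lemma first_pos:
  assumes "lab M e \<le> c" "c \<le> lab M (\<phi> e)"
  obtains i where "0 < i" "i \<le> n" "lab M (pos i) = c" "\<And>j. 0 < j \<Longrightarrow> j < i \<Longrightarrow> lab M (pos j) > c"
proof -
  have "1 \<le> n" "lab M (pos n) \<le> c" "c \<le> lab M (pos 1)" using n assms by auto
  then obtain i where "1 \<le> i" "i \<le> n" "lab M (pos i) = c" "\<And>j. 1 \<le> j \<Longrightarrow> j < i \<Longrightarrow> lab M (pos j) > c"
    using first_visit[OF e] by blast
  then show thesis using that[of i] by simp
qed

text \<open>An element beyond \<open>i\<close> with label one more than \<open>pos i\<close> finds
  its successor further on, at the latest at position \<open>n\<close>, where the label is at most
  that of \<open>pos i\<close>. This successor differs from \<open>pos i\<close>.\<close>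

lemma preds_before:
  assumes i: "0 < i" "i \<le> n" "lab M e \<le> lab M (pos i)" and z: "0 < k" "k \<le> n" "pos k \<in> preds (pos i)"
  shows "k < i"
proof (rule ccontr)
  assume "\<not> k < i"
  have l: "lab M (pos k) = lab M (pos i) + 1" using preds_mem(4)[OF z(3)] by simp
  then have "i < k" using \<open>\<not> k < i\<close> by (cases "k = i") auto
  have "lab M (pos n) \<le> lab M (pos i)" "lab M (pos i) \<le> lab M (pos k)" using i(3) n(2) l by auto
  then obtain k' where k': "k \<le> k'" "k' \<le> n" "lab M (pos k') = lab M (pos i)" 
      "\<And>j. k \<le> j \<Longrightarrow> j < k' \<Longrightarrow> lab M (pos j) > lab M (pos i)"
    using first_visit[OF e z(2)] by blast
  have "k \<noteq> k'" using k'(3) l by auto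
  then have kk: "k < k'" using k'(1) by simp
  have "succ (pos k) = (\<phi> ^^ (k' - k)) (pos k)"
  proof (rule succ_eqI)
    show "0 < k' - k" using kk by simp
    show "lab M ((\<phi> ^^ (k' - k)) (pos k)) = lab M (pos k) - 1" using pos_add[of "k' - k" k] kk k'(3) l by simp
    show "lab M ((\<phi> ^^ j) (pos k)) > lab M (pos k) - 1" if "0 < j" "j < k' - k" for j
      using pos_add[of j k] k'(4)[of "j + k"] that l by simp
  qed (rule \<phi>_pow_mem[OF e])
  then have "pos i = pos k'" using preds_mem(3)[OF z(3)] pos_add[of "k' - k" k] kk by simp
  then show False using pos_inj[of i k'] i k'(1,2) \<open>i < k\<close> by simp
qed

lemma succ_pos:
  assumes "0 < i" "i < k" "lab M (pos k) = lab M (pos i) - 1" "\<And>j. i < j \<Longrightarrow> j < k \<Longrightarrow> lab M (pos j) \<ge> lab M (pos i)"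
  shows "pos i \<in> preds (pos k)"
proof -
  have "succ (pos i) = (\<phi> ^^ (k - i)) (pos i)" "pos i \<notin> minimal"
  proof -
    have *: "0 < k - i" "lab M ((\<phi> ^^ (k - i)) (pos i)) = lab M (pos i) - 1" using pos_add[of "k - i" i] assms by auto
    have **: "lab M ((\<phi> ^^ j) (pos i)) > lab M (pos i) - 1" if "0 < j" "j < k - i" for j
    proof -
      have "i < j + i" "j + i < k" using that by auto
      then show ?thesis using pos_add[of j i] assms(4)[of "j + i"] by simp
    qed
    show "succ (pos i) = (\<phi> ^^ (k - i)) (pos i)" by (rule succ_eqI(1)[OF \<phi>_pow_mem[OF e] * **])
    show "pos i \<notin> minimal" by (rule succ_eqI(2)[OF \<phi>_pow_mem[OF e] * **])
  qed
  then show ?thesis using \<phi>_pow_mem[OF e] pos_add[of "k - i" i] assms(2) by (simp add: preds_def)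
qed

lemma rot_first_pos:
  assumes i: "0 < i" "i \<le> n" "lab M e \<le> lab M (pos i)" 
    "\<And>j. 0 < j \<Longrightarrow> j < i \<Longrightarrow> lab M (pos j) > lab M (pos i)"
    and k: "0 < k" "k \<le> n" "lab M (pos k) = lab M (pos i) + 1" "\<And>j. 0 < j \<Longrightarrow> j < k \<Longrightarrow> lab M (pos j) > lab M (pos k)"
    and lt: "lab M (pos i) < lab M (\<phi> e)"
  shows "psi_rot (pos i) = opp M (pos k)"
proof -
  let ?q = "pos i"
  have "pos 1 \<noteq> ?q" using lt by auto
  then have "i \<noteq> 1" by metis
  have ki: "k < i"
  proof (rule ccontr)
    assume "\<not> k < i"
    moreover have "k \<noteq> i" using k(3) by auto
    ultimately have "lab M ?q > lab M (pos k)" using k(4)[of i] i(1) by simp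
    then show False using k(3) by simp
  qed
  have pk: "pos k \<in> preds ?q"
  proof (rule succ_pos[OF k(1) ki])
    show "lab M ?q = lab M (pos k) - 1" using k(3) by simp
    show "lab M (pos j) \<ge> lab M (pos k)" if "k < j" "j < i" for j using i(4)[of j] that k(1,3) by simp
  qed
  \<comment> \<open>From position \<open>i\<close>, \<open>n - i\<close> steps lead to
    \<open>e\<close> at position \<open>n\<close>, and \<open>k\<close> more to \<open>pos k\<close>
    in the next round. On the first part \<open>preds_before\<close> excludes slots; on the second
    the labels are still too large.\<close>
  have "next_in \<phi> (slots ?q) ?q = (\<phi> ^^ (n - i + k)) ?q"
  proof (rule next_in_eqI)
    show "0 < n - i + k" using k by simp
    show "(\<phi> ^^ (n - i + k)) ?q \<in> slots ?q" using pos_add[of "n - i + k" i] pos_mod[of k] i pk by (simp add: add.commute)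
    fix j assume j: "0 < j" "j < n - i + k"
    show "(\<phi> ^^ j) ?q \<notin> slots ?q"
    proof (cases "j + i \<le> n")
      case True
      then have "pos (j + i) \<noteq> ?q" using pos_inj[of "j + i" i] i j by auto
      moreover have "pos (j + i) \<notin> preds ?q" using preds_before[OF i(1-3), of "j + i"] True j by auto
      ultimately show ?thesis using pos_add[of j i] by simp
    next
      case False
      define m where "m = j + i - n"
      have m: "0 < m" "m < k" "j + i = m + n" using False j i(2) by (auto simp: m_def)
      have "lab M (pos m) > lab M ?q + 1" using k(4)[OF m(1,2)] k(3) by simp
      then have "pos m \<noteq> ?q" "pos m \<notin> preds ?q" using preds_mem(4)[of "pos m" ?q] by auto
      then show ?thesis using pos_add[of j i] pos_mod[of m] m(3) by simp
    qed
  qed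
  also have "\<dots> = pos k" using pos_add[of "n - i + k" i] pos_mod[of k] i by (simp add: add.commute)
  finally show ?thesis 
    using psi_rot_in[OF \<phi>_pow_mem[OF e, of i]] preds_mem(7)[OF pk] by (simp add: incoming_def)
qed

text \<open>\<open>\<phi> e\<close> is at position 1, so \<open>preds_before\<close> leaves no room
  for predecessors, and the first slot met is \<open>\<phi> e\<close> again, after the full round of
  \<open>n\<close> steps.\<close>

lemma rot_last_pos:
  assumes "lab M e \<le> lab M (\<phi> e)"
  shows "psi_rot (\<phi> e) = vnext M A (\<phi> e)"
proof -
  have "next_in \<phi> (slots (\<phi> e)) (\<phi> e) = (\<phi> ^^ n) (\<phi> e)"
  proof (rule next_in_eqI[OF n(1)])
    have per: "(\<phi> ^^ n) (\<phi> e) = \<phi> e" using pos_add[of n 1] pos_mod[of 1] by (simp add: add.commute)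
    then show "(\<phi> ^^ n) (\<phi> e) \<in> slots (\<phi> e)" by simp
    fix j assume j: "0 < j" "j < n"
    then have "pos (j + 1) \<noteq> pos 1" using pos_inj[of "j + 1" 1] n by auto
    moreover have "pos (j + 1) \<notin> preds (pos 1)" using preds_before[of 1 "j + 1"] j n assms by auto
    ultimately show "(\<phi> ^^ j) (\<phi> e) \<notin> slots (\<phi> e)" using pos_add[of j 1] by simp
  qed
  also have "\<dots> = \<phi> e" using pos_add[of n 1] pos_mod[of 1] by (simp add: add.commute)
  finally show ?thesis using psi_rot_in[OF lnext_mem[OF e]] by (simp add: incoming_def)
qed

text \<open>The chord of \<open>e\<close> ends at a new vertex or in the corner of
  \<open>succ e\<close>. In both cases the next arriving end belongs to the first later corner with
  the label of \<open>e\<close>, because all labels in between are larger.\<close>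

lemma rot_opp_first_pos:
  assumes i: "0 < i" "i \<le> n" "lab M (pos i) = lab M e" "\<And>j. 0 < j \<Longrightarrow> j < i \<Longrightarrow> lab M (pos j) > lab M (pos i)"
  shows "psi_rot (opp M e) = opp M (pos i)"
proof (cases "e \<in> minimal")
  case True
  have "next_in \<phi> minimal e = pos i"
  proof (rule next_in_eqI[OF i(1)])
    show "pos i \<in> minimal" using minimal_orbit_iff[OF True funpow_mem_orbit[OF i(1)]] i(3) by simp
    fix j assume "0 < j" "j < i"
    then have "lab M (pos j) \<noteq> lab M e" using i(4)[of j] i(3) by simp
    then show "pos j \<notin> minimal" using minimal_orbit_iff[OF True funpow_mem_orbit[OF \<open>0 < j\<close>]] by simp
  qed
  then show ?thesis using psi_rot_min[OF True] by simp
next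
  case False
  obtain k where k: "0 < k" "succ e = pos k" "lab M (pos k) = lab M e - 1"
    "\<And>j. j < k \<Longrightarrow> lab M (pos j) > lab M e - 1"
    using succ_obtain[OF e False] by blast
  have "i < k"
  proof (rule ccontr)
    assume "\<not> i < k"
    then have "lab M (pos k) \<ge> lab M (pos i)" using i(4)[of k] k(1) by (cases "k = i") auto
    then show False using k(3) i(3) by simp
  qed
  have p: "pos i \<in> preds (pos k)"
  proof (rule succ_pos[OF i(1) \<open>i < k\<close>])
    show "lab M (pos k) = lab M (pos i) - 1" using k(3) i(3) by simp
    show "lab M (pos j) \<ge> lab M (pos i)" if "i < j" "j < k" for j using k(4)[of j] that i(3) by simp
  qed
  have pe: "e \<in> preds (pos k)" using e False k(2) by (simp add: preds_def)
  have "next_in \<phi> (slots (pos k)) e = pos i"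
  proof (rule next_in_eqI[OF i(1)])
    show "pos i \<in> slots (pos k)" using p by simp
    fix j assume "0 < j" "j < i"
    then have "lab M (pos j) > lab M e" using i(3,4) by simp
    then show "pos j \<notin> slots (pos k)" using preds_mem(4)[of "pos j" "pos k"] k(3) by auto
  qed
  then show ?thesis using psi_rot_pred[OF pe] preds_mem(7)[OF p] by (simp add: incoming_def)
qed

lemma rot_opp_step:
  assumes "lab M (\<phi> e) < lab M e"
  shows "psi_rot (opp M e) = vnext M A (\<phi> e)"
proof -
  have l: "lab M (\<phi> e) = lab M e - 1" using lab_\<phi>[OF e] assms by simp
  then have "succ e = (\<phi> ^^ 1) e" "e \<notin> minimal" using succ_eqI[OF e, of 1] by auto
  then have "e \<in> preds (\<phi> e)" using e by (simp add: preds_def)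
  then show ?thesis using psi_rot_pred next_in_step[of \<phi> e "slots (\<phi> e)"] by (simp add: incoming_def)
qed

lemma psi_fnext_aux: "fnext psi_of A e = fnext M A e"
proof -
  let ?c = "cw psi_of" and ?K = "nat (lab M (\<phi> e) - lab M e + 1)"
  have c: "?c x = psi_rot (opp M x)" for x by (simp add: cw_def psi_simps)
  have f: "fnext M A e = vnext M A (\<phi> e)" "fnext M A e \<in> A" using vnext_lnext[OF e] fnext_mem[OF e] by auto
  show ?thesis
  proof (cases "lab M (\<phi> e) < lab M e")
    case True
    then show ?thesis unfolding fnext_def[of psi_of] 
      using next_in_step[of ?c e A] c[of e] rot_opp_step f by simp
  next
    case False
    have step: "\<exists>i. 0 < i \<and> i \<le> n \<and> lab M (pos i) = lab M e + int j \<and> 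
        (\<forall>k. 0 < k \<and> k < i \<longrightarrow> lab M (pos k) > lab M (pos i)) \<and> (?c ^^ Suc j) e = opp M (pos i)" 
      if "j < ?K" for j
      using that
    proof (induction j)
      case 0
      obtain i where i: "0 < i" "i \<le> n" "lab M (pos i) = lab M e" "\<And>j. 0 < j \<Longrightarrow> j < i \<Longrightarrow> lab M (pos j) > lab M e"
        using first_pos[of "lab M e"] False by auto
      then show ?case using rot_opp_first_pos[of i] c[of e] by auto
    next
      case (Suc j)
      then obtain i where i: "0 < i" "i \<le> n" "lab M (pos i) = lab M e + int j"
        "\<forall>k. 0 < k \<and> k < i \<longrightarrow> lab M (pos k) > lab M (pos i)" "(?c ^^ Suc j) e = opp M (pos i)" by auto
      have "lab M e \<le> lab M e + int (Suc j)" "lab M e + int (Suc j) \<le> lab M (\<phi> e)" using Suc.prems by linarith+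
      then obtain k where k: "0 < k" "k \<le> n" "lab M (pos k) = lab M e + int (Suc j)" 
         "\<And>j'. 0 < j' \<Longrightarrow> j' < k \<Longrightarrow> lab M (pos j') > lab M e + int (Suc j)"
        using first_pos by blast
      have "(?c ^^ Suc (Suc j)) e = ?c (opp M (pos i))" using i(5) by simp
      also have "\<dots> = psi_rot (pos i)" using c opp_opp[OF \<phi>_pow_mem[OF e]] by simp
      also have "\<dots> = opp M (pos k)"
        by (rule rot_first_pos) (use i k \<open>lab M e + int (Suc j) \<le> lab M (\<phi> e)\<close> in auto)
      finally show ?case using k by auto
    qed
    have K: "0 < ?K" "Suc (?K - 1) = ?K" using False by auto
    then obtain i where i: "0 < i" "i \<le> n" "lab M (pos i) = lab M (\<phi> e)"
      "\<forall>k. 0 < k \<and> k < i \<longrightarrow> lab M (pos k) > lab M (pos i)" "(?c ^^ ?K) e = opp M (pos i)"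
      using step[of "?K - 1"] by auto
    \<comment> \<open>Position 1 holds \<open>\<phi> e\<close>, whose label is the last one visited,
      so its first occurrence is there.\<close>
    have "i = 1" 
    proof (rule ccontr)
      assume "i \<noteq> 1"
      then have "1 < i" using i(1) by simp
      then have "lab M (pos 1) > lab M (pos i)" using i(4) by (metis zero_less_one)
      then show False using i(3) by simp
    qed
    then have "(?c ^^ Suc ?K) e = psi_rot (\<phi> e)" using i(5) c opp_opp[OF lnext_mem[OF e]] by simp
    then have last: "(?c ^^ Suc ?K) e = fnext M A e" using rot_last_pos False f by simp
    have "next_in ?c A e = (?c ^^ Suc ?K) e"
    proof (rule next_in_eqI)
      fix j assume j: "0 < j" "j < Suc ?K"
      then have "j - 1 < ?K" "Suc (j - 1) = j" by auto
      then obtain i where "(?c ^^ j) e = opp M (pos i)" using step[of "j - 1"] by auto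
      then show "(?c ^^ j) e \<notin> A" using opp_notin[OF \<phi>_pow_mem[OF e]] by simp
    qed (use last f in auto)
    then show ?thesis using last by (simp add: fnext_def)
  qed
qed

end

lemma psi_fnext:
  assumes e: "e \<in> A"
  shows "fnext psi_of A e = fnext M A e"
proof -
  have "orbit \<phi> e \<inter> {e} \<noteq> {}" using self_mem_orbit[OF perm_lnext e] by blast
  then obtain n where n: "0 < n" "(\<phi> ^^ n) e \<in> {e}" "\<And>j. 0 < j \<Longrightarrow> j < n \<Longrightarrow> (\<phi> ^^ j) e \<notin> {e}"
    by (rule next_in_obtain_orbit) (rule that; assumption)
  then show ?thesis using psi_fnext_aux[OF e, of n] by blast
qed

lemma psi_half_iso: "half_iso id M A psi_of A"
  by (simp add: half_iso_def psi_vnext psi_fnext psi_simps)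

text \<open>The vertices without selected darts are the new ones. Each consists of the reverses of
  the minimal elements on one cycle of \<phi>, and every cycle has minimal elements.\<close>

lemma psi_vertices: "card (vertices psi_of) = card (cycles (vnext M A) A) + card (cycles \<phi> A)"
proof -
  interpret p: half_map psi_of A by (rule psi_half_map)
  let ?N = "{v \<in> vertices psi_of. v \<inter> A = {}}"
  let ?u = "next_in \<phi> minimal"
  have "vertices psi_of = {v \<in> vertices psi_of. v \<inter> A \<noteq> {}} \<union> ?N" by blast
  moreover have "finite (vertices psi_of)" using p.fin by (simp add: vertices_def)
  ultimately have 1: "card (vertices psi_of) = card {v \<in> vertices psi_of. v \<inter> A \<noteq> {}} + card ?N"
    by (subst card_Un_disjoint[symmetric]) auto
  have 2: "card {v \<in> vertices psi_of. v \<inter> A \<noteq> {}} = card (cycles (vnext M A) A)"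
    using p.card_cycles_vnext cycles_cong[OF perm_vnext psi_vnext] by simp
  have orb: "orbit psi_rot (opp M s) = opp M ` orbit ?u s" if "s \<in> minimal" for s
    using psi_rot_min next_minimal(1) that by (intro orbit_conj[where D = minimal, symmetric]) auto
  have "bij_betw (\<lambda>c. opp M ` c) (cycles ?u minimal) ?N"
  proof (rule bij_betw_imageI)
    have "c \<subseteq> darts M" if "c \<in> cycles ?u minimal" for c
      using that orbit_subset_dom[OF next_in_perm[OF perm_lnext minimal_sub]] minimal_sub sub 
      by (auto simp: cycles_def)
    then show "inj_on (\<lambda>c. opp M ` c) (cycles ?u minimal)"
      using inj_on_image_eq_iff[OF perm_on_inj[OF perm_opp]] by (auto simp: inj_on_def)
    show "(\<lambda>c. opp M ` c) ` cycles ?u minimal = ?N"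
    proof (intro equalityI subsetI)
      fix v assume "v \<in> (\<lambda>c. opp M ` c) ` cycles ?u minimal"
      then obtain s where s: "s \<in> minimal" "v = opp M ` orbit ?u s" by (auto simp: cycles_def)
      then have v: "v = orbit (rot psi_of) (opp M s)" using orb by (simp add: psi_simps)
      have "opp M s \<in> darts psi_of" using s(1) minimal_sub darts_mem opp(1) by (auto simp: psi_simps(1))
      then have "v \<in> vertices psi_of" using p.vertex_of(1) v by blast
      moreover have "orbit ?u s \<subseteq> A" 
        using orbit_subset_dom[OF next_in_perm[OF perm_lnext minimal_sub] s(1)] minimal_sub by blast
      then have "v \<inter> A = {}" using s(2) opp_notin by blast
      ultimately show "v \<in> ?N" by blast
    next
      fix v assume v: "v \<in> ?N"
      then obtain x where x: "x \<in> darts M" "v = orbit psi_rot x" by (auto simp: vertices_def psi_simps)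
      show "v \<in> (\<lambda>c. opp M ` c) ` cycles ?u minimal" using x(1)
      proof (cases rule: dart_cases)
        case 1: (min s)
        then show ?thesis using orb x(2) by (auto simp: cycles_def)
      next
        case 2: (slot t s)
        obtain m where "0 < m" "(psi_rot ^^ m) (slot_dart t s) = vnext M A t" using psi_rot_run[OF 2(1,2)] by blast
        then have "vnext M A t \<in> v" using funpow_mem_orbit[of m psi_rot x] 2(3) x(2) by simp
        then show ?thesis using v vnext_mem[OF 2(1)] by blast
      qed
    qed
  qed
  then have "card (cycles ?u minimal) = card ?N" by (rule bij_betw_same_card)
  then have "card ?N = card {c \<in> cycles \<phi> A. c \<inter> minimal \<noteq> {}}"
    using card_cycles_next_in[OF perm_lnext minimal_sub] by simp
  also have "{c \<in> cycles \<phi> A. c \<inter> minimal \<noteq> {}} = cycles \<phi> A" 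
    using minimal_exists by (auto simp: cycles_def)
  finally show ?thesis using 1 2 by simp
qed

text \<open>Contours ascend by one at unselected darts, so every face meets \<open>A\<close> and
  faces correspond to the cycles of \<open>fnext\<close>; with \<open>psi_vertices\<close>, Euler's
  relation is again \<open>euler\<close>.\<close>

lemma psi_suitable: "suitably_labelled psi_of" "descending psi_of = A"
proof -
  interpret p: half_map psi_of A by (rule psi_half_map)
  have lo: "lab psi_of (opp M d) = lab psi_of d - 1" if "d \<in> A" for d
    using psi_simps(4)[OF that] psi_simps(5)[OF opp_notin[OF that]] opp_opp[OF that] by simp
  have hi: "lab psi_of (opp M d) = lab psi_of d + 1" if "d \<in> darts M" "d \<notin> A" for d
    using psi_simps(4)[OF opp_in[OF that]] psi_simps(5)[OF that(2)] by simp
  show "descending psi_of = A" using lo hi sub by (fastforce simp: descending_def psi_simps(1,2))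
  have "lab psi_of (cw psi_of x) = lab psi_of x + 1" if "x \<in> darts psi_of" "x \<notin> A" for x
    using hi[of x] p.lab_rot[OF p.opp(1)[OF that(1)]] that by (simp add: cw_def psi_simps(1,2))
  then have "orbit (cw psi_of) x \<inter> A \<noteq> {}" if "x \<in> darts psi_of" for x
    using orbit_meets_of_ascending[OF p.perm_cw that, of A "lab psi_of"] by blast
  then have "{f \<in> faces psi_of. f \<inter> A \<noteq> {}} = faces psi_of" by (auto simp: p.faces_eq cycles_def)
  then have "card (faces psi_of) = card (cycles (fnext M A) A)"
    using p.card_cycles_fnext cycles_cong[OF perm_fnext psi_fnext] by simp
  then have "card (vertices psi_of) + card (faces psi_of) = card (edges psi_of) + 2"
    using psi_vertices p.card_edges euler by simp
  moreover have "connected_map psi_of"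
  proof (rule p.connected_mapI)
    have "graph_on (vnext psi_of A) A = graph_on (vnext M A) A" "graph_on (fnext psi_of A) A = graph_on (fnext M A) A"
      unfolding graph_on_def using psi_vnext psi_fnext by auto
    then show "(d, e) \<in> half_conn psi_of A" if "d \<in> A" "e \<in> A" for d e
      using half_connected[OF that] by (simp add: half_conn_def)
  qed
  moreover have "darts psi_of \<noteq> {}" using nonempty sub by (auto simp: psi_simps)
  moreover have "opp psi_of d \<noteq> d" if "d \<in> darts psi_of" for d using p.opp_iff[OF that] by metis
  ultimately have "planar_map psi_of" unfolding planar_map_def
    using p.fin p.bij_rot p.opp p.lab_rot by blast
  moreover have "\<bar>lab psi_of d - lab psi_of (opp psi_of d)\<bar> = 1" if "d \<in> darts psi_of" for d
    using lo[of d] hi[of d] that by (cases "d \<in> A") (auto simp: psi_simps(1,2))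
  ultimately show "suitably_labelled psi_of" by (simp add: suitably_labelled_def)
qed

end

subsection \<open>The figure drawn by the inverse mapping\<close>

context luk_map
begin

abbreviation S :: "('d starred, int option) lmap" where "S \<equiv> star_figure M A"

lemma rot_star_Black': "d \<in> A \<Longrightarrow> rot S (Black d) = Black (inv_into A (fnext M A) d)"
  using rot_star_Black[OF inv_into_mem[OF perm_fnext]] inv_into_right[OF perm_fnext] by metis

lemma perm_rot_S: "perm_on (rot S) (darts S)"
proof (rule perm_onI)
  show "finite (darts S)" using finA by (simp add: darts_star_figure)
  show "\<And>x. x \<in> darts S \<Longrightarrow> rot S x \<in> darts S"
    using rot_star_White rot_star_Black' vnext_mem inv_into_mem[OF perm_fnext] by (auto simp: darts_star_figure)
  show "inj_on (rot S) (darts S)"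
  proof (rule inj_onI)
    fix x y assume "x \<in> darts S" "y \<in> darts S" "rot S x = rot S y"
    then show "x = y"
      using rot_star_White rot_star_Black' perm_on_eq_iff[OF perm_vnext] 
        perm_on_eq_iff[OF inv_into_perm[OF perm_fnext]] by (auto simp: darts_star_figure)
  qed
qed

lemma ccw_White: 
  assumes "e \<in> A"
  shows "ccw S (White e) = Black (fnext M A e)"
proof -
  have "inv_into (darts S) (rot S) (rot S (Black (fnext M A e))) = Black (fnext M A e)"
    using inv_into_left[OF perm_rot_S] fnext_mem[OF assms] by (simp add: darts_star_figure)
  then show ?thesis using rot_star_Black[OF assms] by (simp add: ccw_def opp_star_figure)
qed

lemma ccw_Black: 
  assumes "e \<in> A"
  shows "ccw S (Black e) = White (inv_into A (vnext M A) e)"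
proof -
  have i: "inv_into A (vnext M A) e \<in> A" using inv_into_mem[OF perm_vnext assms] .
  have "inv_into (darts S) (rot S) (rot S (White (inv_into A (vnext M A) e))) = White (inv_into A (vnext M A) e)"
    using inv_into_left[OF perm_rot_S] i by (simp add: darts_star_figure)
  then show ?thesis using rot_star_White[OF i] inv_into_right[OF perm_vnext assms]
    by (simp add: ccw_def opp_star_figure)
qed

text \<open>A face contour of the star figure alternates between white and black half-edges, so two
  steps of \<open>ccw\<close> make one step of \<phi>.\<close>

lemma ccw_pow:
  assumes "e \<in> A"
  shows "(ccw S ^^ (2 * k)) (White e) = White ((\<phi> ^^ k) e)"
    "(ccw S ^^ Suc (2 * k)) (White e) = Black (fnext M A ((\<phi> ^^ k) e))"
proof -
  show *: "(ccw S ^^ (2 * k)) (White e) = White ((\<phi> ^^ k) e)" for k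
  proof (induction k)
    case (Suc k)
    have m: "(\<phi> ^^ k) e \<in> A" using \<phi>_pow_mem[OF assms] .
    have "2 * Suc k = Suc (Suc (2 * k))" by simp
    then have "(ccw S ^^ (2 * Suc k)) (White e) = ccw S (ccw S ((ccw S ^^ (2 * k)) (White e)))"
      by (simp only: funpow.simps(2) comp_apply)
    also have "\<dots> = White (\<phi> ((\<phi> ^^ k) e))"
      by (simp only: Suc ccw_White[OF m] ccw_Black[OF fnext_mem[OF m]] lnext_def[of M A "(\<phi> ^^ k) e"])
    finally show ?case by simp
  qed simp
  show "(ccw S ^^ Suc (2 * k)) (White e) = Black (fnext M A ((\<phi> ^^ k) e))"
    using *[of k] ccw_White[OF \<phi>_pow_mem[OF assms]] by simp
qed

lemma next_in_ccw:
  assumes e: "e \<in> A" and X: "orbit \<phi> e \<inter> X \<noteq> {}"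
  shows "next_in (ccw S) (White ` X) (White e) = White (next_in \<phi> X e)"
proof -
  obtain k where k: "0 < k" "next_in \<phi> X e = (\<phi> ^^ k) e" "(\<phi> ^^ k) e \<in> X" 
      "\<And>j. 0 < j \<Longrightarrow> j < k \<Longrightarrow> (\<phi> ^^ j) e \<notin> X"
    using X by (rule next_in_obtain_orbit) (rule that; assumption)
  have "next_in (ccw S) (White ` X) (White e) = (ccw S ^^ (2 * k)) (White e)"
  proof (rule next_in_eqI)
    show "0 < 2 * k" "(ccw S ^^ (2 * k)) (White e) \<in> White ` X" using k ccw_pow(1)[OF e, of k] by auto
    fix j assume j: "0 < j" "j < 2 * k"
    show "(ccw S ^^ j) (White e) \<notin> White ` X"
    proof (cases "even j")
      case True
      then obtain i where i: "j = 2 * i" by blast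
      then have "(\<phi> ^^ i) e \<notin> X" using j k(4)[of i] by simp
      then show ?thesis unfolding i ccw_pow(1)[OF e] by blast
    next
      case False
      then obtain i where i: "j = Suc (2 * i)" by (metis oddE Suc_eq_plus1)
      show ?thesis unfolding i ccw_pow(2)[OF e] by blast
    qed
  qed
  then show ?thesis using ccw_pow(1)[OF e] k(2) by simp
qed

lemma white_S: "white S = White ` A"
  by (auto simp: white_def darts_star_figure lab_star_figure)

lemma wlab_S: "wlab S (White e) = lab M e"
  by (simp add: wlab_def lab_star_figure)

lemma orbit_ccw:
  assumes e: "e \<in> A"
  shows "orbit (ccw S) (White e) \<inter> white S = White ` orbit \<phi> e"
proof (intro equalityI subsetI)
  fix x assume x: "x \<in> orbit (ccw S) (White e) \<inter> white S"
  then obtain m where m: "0 < m" "x = (ccw S ^^ m) (White e)" by (auto simp: orbit_eq_funpow)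
  show "x \<in> White ` orbit \<phi> e"
  proof (cases "even m")
    case True
    then obtain i where i: "m = 2 * i" by blast
    then show ?thesis using m ccw_pow(1)[OF e, of i] funpow_mem_orbit[of i \<phi> e] by simp
  next
    case False
    then obtain i where i: "m = Suc (2 * i)" by (metis oddE Suc_eq_plus1)
    then have "x = Black (fnext M A ((\<phi> ^^ i) e))" using m(2) ccw_pow(2)[OF e] by simp
    then show ?thesis using x by (auto simp: white_S)
  qed
next
  fix x assume "x \<in> White ` orbit \<phi> e"
  then obtain k where k: "0 < k" "x = White ((\<phi> ^^ k) e)" by (auto simp: orbit_eq_funpow)
  then have "x = (ccw S ^^ (2 * k)) (White e)" using ccw_pow(1)[OF e] by simp
  then have "x \<in> orbit (ccw S) (White e)" using funpow_mem_orbit[of "2 * k"] k(1) by simp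
  then show "x \<in> orbit (ccw S) (White e) \<inter> white S" using k \<phi>_pow_mem[OF e] by (simp add: white_S)
qed

lemma corner_min_S: "e \<in> A \<Longrightarrow> corner_min S (White e) = Min (lab M ` orbit \<phi> e)"
  unfolding corner_min_def by (simp add: orbit_ccw image_image wlab_S)

lemma minimal_iff: "e \<in> A \<Longrightarrow> e \<in> minimal \<longleftrightarrow> lab M e = Min (lab M ` orbit \<phi> e)"
proof -
  assume e: "e \<in> A"
  have "finite (lab M ` orbit \<phi> e)" 
    using orbit_subset_dom[OF perm_lnext e] finA finite_subset by blast
  moreover have "lab M e \<in> lab M ` orbit \<phi> e" using self_mem_orbit[OF perm_lnext e] by blast
  ultimately have "lab M e = Min (lab M ` orbit \<phi> e) \<longleftrightarrow> (\<forall>k\<in>lab M ` orbit \<phi> e. lab M e \<le> k)"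
    by (metis Min_eqI Min_le)
  then show ?thesis using e by (simp add: minimal_def)
qed

lemma min_corners_S: "min_corners S = White ` minimal"
  using minimal_iff minimal_sub by (auto simp: min_corners_def white_S wlab_S corner_min_S)

lemma successor_S:
  assumes "e \<in> A" "e \<notin> minimal"
  shows "successor S (White e) = White (succ e)"
proof -
  let ?X = "{t \<in> A. lab M t = lab M e - 1}"
  have "{t \<in> white S. wlab S t = wlab S (White e) - 1} = White ` ?X" by (auto simp: white_S wlab_S)
  moreover have "orbit \<phi> e \<inter> ?X \<noteq> {}" using succ_mem[OF assms] by blast
  ultimately show ?thesis using next_in_ccw[OF assms(1)] by (simp add: successor_def succ_def)
qed

lemma predecessors_S: "predecessors S (White t) = White ` preds t"
proof -
  have "white S - min_corners S = White ` (A - minimal)" by (auto simp: white_S min_corners_S)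
  then have "predecessors S (White t) = {s \<in> White ` (A - minimal). successor S s = White t}"
    by (simp add: predecessors_def)
  also have "\<dots> = White ` preds t" using successor_S by (auto simp: preds_def)
  finally show ?thesis .
qed

lemma next_incoming_S:
  assumes "t \<in> A" "s \<in> slots t"
  shows "next_incoming S (White t) (White s) 
    = (let q = next_in \<phi> (slots t) s in if q = t then Base (White (vnext M A t)) else In (White q))"
proof -
  have s: "s \<in> A" using assms slots_sub by blast
  have "orbit \<phi> s \<inter> slots t \<noteq> {}" using self_mem_orbit[OF perm_lnext s] assms(2) by blast
  then have "next_in (ccw S) (White ` slots t) (White s) = White (next_in \<phi> (slots t) s)"
    by (rule next_in_ccw[OF s])
  then show ?thesis using rot_star_White[OF assms(1)] by (simp add: next_incoming_def predecessors_S Let_def)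
qed

theorem psi_figure: 
  "lmap_iso (\<lambda>x. if x \<in> A then Out (White x) else In (White (opp M x)))
     (all_white psi_of) (erase (range Base) (add_chords S))" (is "lmap_iso ?g ?L ?R")
proof -
  define g where "g = ?g"
  let ?r = "rot (add_chords S)" and ?X = "Out ` White ` A \<union> In ` White ` A"
  have dR: "darts ?R = ?X" 
    by (auto simp: erase_def add_chords_def white_S darts_star_figure)
  have dX: "darts (add_chords S) - range Base = ?X" 
    by (auto simp: add_chords_def white_S darts_star_figure)
  have rR: "rot ?R x = next_in ?r ?X x" for x by (simp only: erase_def lmap.simps dX)
  have g_in: "g x = Out (White x)" if "x \<in> A" for x using that by (simp add: g_def)
  have g_out: "g (opp M x) = In (White x)" if "x \<in> A" for x
    using opp_notin[OF that] opp_opp[OF that] by (simp add: g_def)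
  have r_Base: "?r (Base (White t)) = Out (White t)" if "t \<in> A" for t
    using that by (simp add: add_chords_def white_S)
  have slot: "next_in ?r ?X y = g (incoming t s)" 
    if "t \<in> A" "s \<in> slots t" "?r y = next_incoming S (White t) (White s)" for t s y
  proof (rule incoming_cases[OF that(1,2)])
    assume 1: "next_in \<phi> (slots t) s = t" "incoming t s = vnext M A t"
    have v: "vnext M A t \<in> A" using vnext_mem[OF that(1)] .
    have ry: "?r y = Base (White (vnext M A t))" using that(3) next_incoming_S[OF that(1,2)] 1 by simp
    \<comment> \<open>The half-edge met at once is of kind \<open>Base\<close> and gets erased; the
      outgoing half-edge of the same dart is immediately behind it.\<close>
    have "next_in ?r ?X y = (?r ^^ 2) y"
    proof (rule next_in_eqI)
      show "(?r ^^ 2) y \<in> ?X" using ry r_Base[OF v] v by (simp add: numeral_2_eq_2)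
      fix j :: nat assume "0 < j" "j < 2"
      then have "j = 1" by simp
      then show "(?r ^^ j) y \<notin> ?X" using ry by auto
    qed simp
    then show ?thesis using ry r_Base[OF v] 1(2) g_in[OF v] by (simp add: numeral_2_eq_2)
  next
    fix q assume q: "next_in \<phi> (slots t) s = q" "q \<in> preds t" "incoming t s = opp M q"
    then have "?r y = In (White q)" using that(3) next_incoming_S[OF that(1,2)] preds_mem(7) by simp
    then show ?thesis using q preds_mem(1)[OF q(2)] g_out[of q] next_in_step[of ?r y ?X] by simp
  qed
  have rot: "g (psi_rot x) = rot ?R (g x)" if x: "x \<in> darts M" for x
    using x
  proof (cases rule: dart_cases)
    case 1: (min s)
    have s: "s \<in> A" "next_in \<phi> minimal s \<in> A" using 1(1) next_minimal(1)[OF 1(1)] minimal_sub by auto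
    have "orbit \<phi> s \<inter> minimal \<noteq> {}" using minimal_exists[OF s(1)] .
    then have "?r (In (White s)) = In (White (next_in \<phi> minimal s))"
      using 1(1) next_in_ccw[OF s(1)] by (simp add: add_chords_def min_corners_S)
    then have "rot ?R (In (White s)) = In (White (next_in \<phi> minimal s))"
      unfolding rR using next_in_step[of ?r "In (White s)" ?X] s(2) by simp
    then show ?thesis using g_out[OF s(1)] g_out[OF s(2)] psi_rot_min[OF 1(1)] 1(2) by simp
  next
    case 2: (slot t s)
    have "?r (g x) = next_incoming S (White t) (White s)"
    proof (cases "s = t")
      case True
      then show ?thesis using 2 g_in by (simp add: slot_dart_def add_chords_def)
    next
      case False
      then have s: "s \<in> preds t" using 2(2) by simp
      then show ?thesis using g_out[OF preds_mem(1)[OF s]] 2(3) False preds_mem(1-3)[OF s] successor_S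
        by (auto simp: slot_dart_def add_chords_def min_corners_S)
    qed
    then show ?thesis unfolding rR using slot[OF 2(1,2)] psi_rot_slot[OF 2(1,2)] 2(3) by simp
  qed
  have cases: "P x" if x: "x \<in> darts M" and "\<And>y. y \<in> A \<Longrightarrow> P y" "\<And>y. y \<in> A \<Longrightarrow> P (opp M y)" for P x
  proof (cases "x \<in> A")
    case False
    then show ?thesis using that(3)[OF opp_in[OF x False]] opp(2)[OF x] by simp
  qed (use that(2) in simp)
  have gopp: "g (opp M x) = opp ?R (g x)" if "x \<in> darts M" for x
    by (rule cases[OF that]) (simp_all add: g_in g_out opp_opp erase_def add_chords_def)
  have glab: "lab ?R (g x) = Some (lab psi_of x)" if "x \<in> darts M" for x
  proof (rule cases[OF that])
    fix y assume y: "y \<in> A"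
    show "lab ?R (g y) = Some (lab psi_of y)" 
      using g_in[OF y] psi_simps(4)[OF y] by (simp add: erase_def add_chords_def lab_star_figure)
    have "lab ?R (In (White y)) = Some (lab M y - 1)"
    proof (cases "y \<in> minimal")
      case True
      then show ?thesis using corner_min_S[OF y] minimal_iff[OF y]
        by (simp add: erase_def add_chords_def min_corners_S)
    next
      case False
      have "White y \<notin> White ` minimal" using False by blast
      then show ?thesis using successor_S[OF y False] succ_mem(2)[OF y False]
        by (simp add: erase_def add_chords_def min_corners_S lab_star_figure)
    qed
    then show "lab ?R (g (opp M y)) = Some (lab psi_of (opp M y))"
      using g_out[OF y] psi_simps(5)[OF opp_notin[OF y]] opp_opp[OF y] by simp
  qed
  have "bij_betw g (darts M) ?X"
  proof (rule bij_betw_imageI)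
    show "inj_on g (darts M)"
    proof (rule inj_onI)
      fix x y assume xy: "x \<in> darts M" "y \<in> darts M" "g x = g y"
      show "x = y"
      proof (cases "x \<in> A")
        case True
        then show ?thesis using xy(3) by (cases "y \<in> A") (simp_all add: g_def)
      next
        case False
        then have "opp M x = opp M y" using xy(3) by (cases "y \<in> A") (simp_all add: g_def)
        then show ?thesis using perm_on_eq_iff[OF perm_opp xy(1,2)] by simp
      qed
    qed
    show "g ` darts M = ?X"
    proof (intro equalityI subsetI)
      fix z assume "z \<in> g ` darts M"
      then obtain x where x: "x \<in> darts M" "z = g x" by blast
      show "z \<in> ?X" unfolding x(2) by (rule cases[OF x(1)]) (use g_in g_out in auto)
    next
      fix z assume "z \<in> ?X"
      then consider x where "x \<in> A" "z = Out (White x)" | x where "x \<in> A" "z = In (White x)" by blast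
      then show "z \<in> g ` darts M"
      proof cases
        case 1
        then show ?thesis using g_in darts_mem by (intro image_eqI[of _ _ x]) auto
      next
        case 2
        then show ?thesis using g_out[OF 2(1)] opp(1) darts_mem by (intro image_eqI[of _ _ "opp M x"]) auto
      qed
    qed
  qed
  then show ?thesis unfolding g_def[symmetric] lmap_iso_def dR using rot gopp glab by (simp add: all_white_def psi_simps(1,2,3))
qed

end

section \<open>The bijection\<close>

lemma star_rep_eq: "star_rep H = star_figure H (dark_darts H)"
  by (simp add: star_rep_def star_figure_def dark_darts_def)

lemma Phi_figure_eq: "Phi_figure B = star_figure B (descending B)"
  by (simp add: Phi_figure_def star_figure_def)

section \<open>Isomorphism classes and equivalence of reduced data\<close>

definition half_equiv :: "('d, 'l, 'y) lmap_scheme \<Rightarrow> 'd set \<Rightarrow> ('e, 'l, 'z) lmap_scheme \<Rightarrow> 'e set \<Rightarrow> bool" where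
  "half_equiv M A M' A' \<longleftrightarrow> (\<exists>h. half_iso h M A M' A')"

lemma half_equiv_sym: "half_map M A \<Longrightarrow> half_equiv M A M' A' \<Longrightarrow> half_equiv M' A' M A"
  unfolding half_equiv_def using half_iso_sym by blast

lemma half_equiv_trans: "half_equiv M A M' A' \<Longrightarrow> half_equiv M' A' M'' A'' \<Longrightarrow> half_equiv M A M'' A''"
  unfolding half_equiv_def using half_iso_trans by blast

lemma star_figure_isomorphic_iff:
  assumes "half_map M A" "half_map M' A'"
  shows "lmap_isomorphic (star_figure M A) (star_figure M' A') \<longleftrightarrow> half_equiv M A M' A'"
  unfolding lmap_isomorphic_def half_equiv_def 
  using star_figure_iso[OF assms] star_figure_isoE[OF assms] by metis

lemma suit_isomorphic_iff:
  assumes "suitably_labelled B" "suitably_labelled B'"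
  shows "lmap_isomorphic B B' \<longleftrightarrow> half_equiv B (descending B) B' (descending B')"
proof -
  interpret m: suit_map B by unfold_locales fact
  interpret m': suit_map B' by unfold_locales fact
  have "g ` descending B = descending B'" if "lmap_iso g B B'" for g
  proof -
    have g: "bij_betw g (darts B) (darts B')" 
      and gd: "\<And>d. d \<in> darts B \<Longrightarrow> g (opp B d) = opp B' (g d) \<and> lab B' (g d) = lab B d"
      using that by (auto simp: lmap_iso_def)
    have "g d \<in> descending B' \<longleftrightarrow> d \<in> descending B" if d: "d \<in> darts B" for d
      using gd[OF d] gd[OF m.opp(1)[OF d]] g d by (auto simp: descending_def bij_betw_def)
    moreover have "darts B' = g ` darts B" using g by (simp add: bij_betw_def)
    moreover have "x \<in> g ` descending B" if "x \<in> descending B'" for x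
    proof -
      obtain d where "d \<in> darts B" "x = g d" using m'.sub \<open>x \<in> descending B'\<close> \<open>darts B' = g ` darts B\<close> by blast
      then show ?thesis using \<open>x \<in> descending B'\<close> \<open>\<And>d. d \<in> darts B \<Longrightarrow> g d \<in> descending B' \<longleftrightarrow> d \<in> descending B\<close> by blast
    qed
    ultimately show ?thesis using m.sub by blast
  qed
  then have "lmap_iso g B B' \<Longrightarrow> half_iso g B (descending B) B' (descending B')" for g
    using half_iso_of_lmap_iso[OF m.half_map_axioms m'.half_map_axioms] by simp
  moreover have "half_iso h B (descending B) B' (descending B') \<Longrightarrow> \<exists>g. lmap_iso g B B'" for h
    by (rule exI, rule suit_map_unique[OF m.suit_map_axioms m'.suit_map_axioms])
  ultimately show ?thesis unfolding lmap_isomorphic_def half_equiv_def by meson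
qed

lemma well_isomorphic_iff:
  assumes "well_labelled H" "well_labelled H'"
  shows "hmap_isomorphic H H' \<longleftrightarrow> half_equiv H (dark_darts H) H' (dark_darts H')"
proof -
  have w: "well_hmap H" "well_hmap H'" using assms by (auto simp: well_hmap_def)
  have "half_equiv H (dark_darts H) H' (dark_darts H')" if "hmap_isomorphic H H'"
    using that half_iso_of_hmap_iso[OF w] unfolding hmap_isomorphic_def half_equiv_def by meson
  moreover have "hmap_isomorphic H H'" if "half_equiv H (dark_darts H) H' (dark_darts H')"
    using that well_hmap_unique[OF w] unfolding half_equiv_def by (elim exE)
  ultimately show ?thesis by (rule iffI)
qed

text \<open>Both mappings are this one relation, read in opposite directions:
  \<open>corr_iff\<close> translates the figure of \<open>Phi\<close>, and
  \<open>corr_Psi_figure\<close> that of \<open>Psi\<close>. What remains is that each object has a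
  partner, unique up to isomorphism.\<close>

definition corr :: "('d, int) lmap \<Rightarrow> 'e hmap \<Rightarrow> bool" where
  "corr B H \<longleftrightarrow> half_equiv H (dark_darts H) B (descending B)"

lemma suit_half_map: "suitably_labelled B \<Longrightarrow> half_map B (descending B)"
proof -
  assume "suitably_labelled B"
  then interpret suit_map B by unfold_locales
  show ?thesis by (rule half_map_axioms)
qed

lemma well_half_map: "well_labelled H \<Longrightarrow> half_map H (dark_darts H)"
proof -
  assume "well_labelled H"
  then interpret well_hmap H by unfold_locales
  show ?thesis by (rule half_map_axioms)
qed

lemma suit_isomorphic_sym: 
  "suitably_labelled B \<Longrightarrow> suitably_labelled B' \<Longrightarrow> lmap_isomorphic B B' \<Longrightarrow> lmap_isomorphic B' B"
  using suit_isomorphic_iff half_equiv_sym[OF suit_half_map] by metis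

lemma corr_suit_isomorphic:
  assumes "suitably_labelled B" "suitably_labelled B'" "corr B H"
  shows "lmap_isomorphic B B' \<Longrightarrow> corr B' H"
  using suit_isomorphic_iff[OF assms(1,2)] half_equiv_trans assms(3) unfolding corr_def by metis

lemma corr_well_isomorphic:
  assumes "well_labelled H" "well_labelled H'" "corr B H"
  shows "hmap_isomorphic H H' \<Longrightarrow> corr B H'"
  using well_isomorphic_iff[OF assms(1,2)] half_equiv_sym[OF well_half_map[OF assms(1)]] 
    half_equiv_trans assms(3) unfolding corr_def by metis

lemma corr_iff:
  assumes "suitably_labelled B" "well_labelled H"
  shows "lmap_isomorphic (star_rep H) (Phi_figure B) \<longleftrightarrow> corr B H"
proof -
  interpret m: suit_map B by unfold_locales fact
  interpret m': well_hmap H by unfold_locales fact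
  show ?thesis unfolding corr_def star_rep_eq Phi_figure_eq
    using star_figure_isomorphic_iff[OF m'.half_map_axioms m.half_map_axioms] .
qed

lemma corr_hyper:
  fixes B :: "('d, int) lmap"
  assumes "suitably_labelled B"
  shows "\<exists>H :: 'd hmap. well_labelled H \<and> corr B H"
proof -
  interpret m: suit_map B by unfold_locales fact
  let ?H = "hyper_of B (descending B)"
  have "half_equiv B (descending B) ?H (dark_darts ?H)" 
    unfolding half_equiv_def m.hyper_of_well(2) using m.hyper_of_half_iso by blast
  then have "corr B ?H" unfolding corr_def using half_equiv_sym[OF m.half_map_axioms] by blast
  then show ?thesis using m.hyper_of_well(1) by blast
qed

lemma suit_isomorphic_corr:
  assumes "suitably_labelled B" "suitably_labelled B'" "well_labelled H" "corr B H" "corr B' H"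
  shows "lmap_isomorphic B B'"
proof -
  have "half_equiv B (descending B) H (dark_darts H)"
    using half_equiv_sym[OF well_half_map[OF assms(3)]] assms(4) by (simp add: corr_def)
  then have "half_equiv B (descending B) B' (descending B')"
    using half_equiv_trans assms(5) unfolding corr_def by metis
  then show ?thesis using suit_isomorphic_iff[OF assms(1,2)] by simp
qed

lemma well_isomorphic_corr:
  assumes "suitably_labelled B" "well_labelled H" "well_labelled H'" "corr B H" "corr B H'"
  shows "hmap_isomorphic H H'"
proof -
  have "half_equiv B (descending B) H' (dark_darts H')"
    using half_equiv_sym[OF well_half_map[OF assms(3)]] assms(5) by (simp add: corr_def)
  then have "half_equiv H (dark_darts H) H' (dark_darts H')"
    using half_equiv_trans assms(4) unfolding corr_def by metis
  then show ?thesis using well_isomorphic_iff[OF assms(2,3)] by simp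
qed

lemma all_white_simps: "darts (all_white B) = darts B" "rot (all_white B) = rot B" 
  "opp (all_white B) = opp B" "lab (all_white B) d = Some (lab B d)"
  by (auto simp: all_white_def)

lemma all_white_iso: "lmap_iso g (all_white B) (all_white B') \<longleftrightarrow> lmap_iso g B B'"
  unfolding lmap_iso_def all_white_simps by simp

lemma half_map_all_white: "half_map B A \<Longrightarrow> half_map (all_white B) A"
  unfolding half_map_def by (simp add: all_white_simps)

text \<open>The figure drawn for \<open>H\<close> is isomorphic to \<open>psi_of\<close>, which has
  the reduced data of \<open>H\<close>; by uniqueness for suitably labelled maps, isomorphism with
  it is equivalence of reduced data.\<close>

lemma corr_Psi_figure:
  fixes B :: "('d, int) lmap" and H :: "'e hmap"
  assumes "suitably_labelled B" "well_labelled H"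
  shows "lmap_isomorphic (all_white B) (Psi_figure H) \<longleftrightarrow> corr B H"
proof -
  interpret m: suit_map B by unfold_locales fact
  interpret w: well_hmap H by unfold_locales fact
  let ?P = "w.psi_of"
  obtain g where g: "lmap_iso g (all_white ?P) (Psi_figure H)"
    using w.psi_figure unfolding Psi_figure_def star_rep_eq by blast
  note g' = lmap_iso_sym[OF half_map_all_white[OF w.psi_half_map] g]
  have "lmap_isomorphic (all_white B) (Psi_figure H) \<longleftrightarrow> lmap_isomorphic B ?P"
    unfolding lmap_isomorphic_def using lmap_iso_trans[OF _ g] lmap_iso_trans[OF _ g'] all_white_iso by blast
  also have "\<dots> \<longleftrightarrow> half_equiv B (descending B) ?P w.A"
    using suit_isomorphic_iff[OF assms(1) w.psi_suitable(1)] w.psi_suitable(2) by simp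
  also have "\<dots> \<longleftrightarrow> corr B H"
  proof
    have P: "half_equiv H w.A ?P w.A" unfolding half_equiv_def using w.psi_half_iso by blast
    show "corr B H" if "half_equiv B (descending B) ?P w.A"
      unfolding corr_def using half_equiv_trans[OF P half_equiv_sym[OF m.half_map_axioms that]] .
    show "half_equiv B (descending B) ?P w.A" if "corr B H"
      using half_equiv_trans[OF half_equiv_sym[OF w.half_map_axioms that[unfolded corr_def]] P] .
  qed
  finally show ?thesis .
qed

lemma corr_suit:
  fixes H :: "'d hmap"
  assumes "well_labelled H"
  shows "\<exists>B :: ('d, int) lmap. suitably_labelled B \<and> corr B H"
proof -
  interpret w: well_hmap H by unfold_locales fact
  have "lmap_isomorphic (all_white w.psi_of) (Psi_figure H)"
    unfolding lmap_isomorphic_def Psi_figure_def star_rep_eq using w.psi_figure by blast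
  then show ?thesis using corr_Psi_figure[OF w.psi_suitable(1) assms] w.psi_suitable(1) by blast
qed

definition suit_class :: "nmap \<Rightarrow> nmap set" where
  "suit_class B = {B'. suitably_labelled B' \<and> lmap_isomorphic B B'}"

definition well_class :: "nhmap \<Rightarrow> nhmap set" where
  "well_class H = {H'. well_labelled H' \<and> hmap_isomorphic H H'}"

lemma suit_maps_eq: "suit_maps = suit_class ` {B. suitably_labelled B}"
  unfolding suit_maps_def quotient_def suit_rel_def suit_class_def by auto

lemma well_hmaps_eq: "well_hmaps = well_class ` {H. well_labelled H}"
  unfolding well_hmaps_def quotient_def well_rel_def well_class_def by auto

lemma mem_suit_class: 
  assumes "suitably_labelled B" "well_labelled H" "corr B H"
  shows "B' \<in> suit_class B \<longleftrightarrow> suitably_labelled B' \<and> corr B' H"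
  using corr_suit_isomorphic[OF assms(1) _ assms(3)] suit_isomorphic_corr[OF assms(1) _ assms(2,3)]
  unfolding suit_class_def by blast

lemma mem_well_class: 
  assumes "suitably_labelled B" "well_labelled H" "corr B H"
  shows "H' \<in> well_class H \<longleftrightarrow> well_labelled H' \<and> corr B H'"
  using corr_well_isomorphic[OF assms(2) _ assms(3)] well_isomorphic_corr[OF assms(1,2) _ assms(3)]
  unfolding well_class_def by blast

lemma Phi_class:
  assumes "suitably_labelled B" "well_labelled H" "corr B H"
  shows "Phi (suit_class B) = well_class H"
proof (intro set_eqI)
  fix H'
  have "H' \<in> Phi (suit_class B) \<longleftrightarrow> well_labelled H' \<and> (\<exists>B'\<in>suit_class B. corr B' H')"
    using corr_iff unfolding Phi_def suit_class_def by blast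
  also have "\<dots> \<longleftrightarrow> well_labelled H' \<and> corr B H'"
    using mem_suit_class[OF assms] assms(1,3) corr_suit_isomorphic[OF _ assms(1)] 
      suit_isomorphic_sym[OF assms(1)] unfolding suit_class_def by blast
  finally show "H' \<in> Phi (suit_class B) \<longleftrightarrow> H' \<in> well_class H" using mem_well_class[OF assms] by simp
qed

lemma Psi_class:
  assumes "suitably_labelled B" "well_labelled H" "corr B H"
  shows "Psi (well_class H) = suit_class B"
proof (intro set_eqI)
  fix B'
  have "B' \<in> Psi (well_class H) \<longleftrightarrow> suitably_labelled B' \<and> (\<exists>H'\<in>well_class H. corr B' H')"
    using corr_Psi_figure unfolding Psi_def well_class_def by blast
  also have "\<dots> \<longleftrightarrow> suitably_labelled B' \<and> corr B' H"
  proof -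
    have "corr B' H" if "suitably_labelled B'" "H' \<in> well_class H" "corr B' H'" for H'
    proof -
      have H': "well_labelled H'" "corr B H'" using that(2) mem_well_class[OF assms] by auto
      then have "B' \<in> suit_class B" using mem_suit_class[OF assms(1) H'] that by blast
      then show ?thesis using mem_suit_class[OF assms] by blast
    qed
    moreover have "H \<in> well_class H" using mem_well_class[OF assms] assms by blast
    ultimately show ?thesis by blast
  qed
  finally show "B' \<in> Psi (well_class H) \<longleftrightarrow> B' \<in> suit_class B" using mem_suit_class[OF assms] by simp
qed

theorem Phi_Psi_bij:
  "bij_betw Phi suit_maps well_hmaps" 
  "\<forall>X\<in>suit_maps. Psi (Phi X) = X" "\<forall>Y\<in>well_hmaps. Phi (Psi Y) = Y"
proof -
  have X: "\<exists>Y\<in>well_hmaps. Phi X = Y \<and> Psi Y = X" if X: "X \<in> suit_maps" for X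
  proof -
    obtain B where B: "suitably_labelled B" "X = suit_class B" using X unfolding suit_maps_eq by blast
    obtain H :: nhmap where "well_labelled H" "corr B H" using corr_hyper[OF B(1)] by blast
    then show ?thesis using Phi_class[OF B(1)] Psi_class[OF B(1)] B(2) unfolding well_hmaps_eq by blast
  qed
  have Y: "\<exists>X\<in>suit_maps. Phi X = Y \<and> Psi Y = X" if Y: "Y \<in> well_hmaps" for Y
  proof -
    obtain H where H: "well_labelled H" "Y = well_class H" using Y unfolding well_hmaps_eq by blast
    obtain B :: nmap where "suitably_labelled B" "corr B H" using corr_suit[OF H(1)] by blast
    then show ?thesis using Phi_class[OF _ H(1)] Psi_class[OF _ H(1)] H(2) unfolding suit_maps_eq by blast
  qed
  show 1: "\<forall>X\<in>suit_maps. Psi (Phi X) = X" using X by auto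
  show 2: "\<forall>Y\<in>well_hmaps. Phi (Psi Y) = Y" using Y by auto
  show "bij_betw Phi suit_maps well_hmaps"
    by (rule bij_betw_byWitness[of _ Psi]) (use 1 2 X Y in auto)
qed

section \<open>Corresponding vertices and faces\<close>

lemma bij_betw_cycles_image:
  assumes "bij_betw h A A'" "perm_on f A" "\<And>d. d \<in> A \<Longrightarrow> h (f d) = f' (h d)"
  shows "bij_betw (\<lambda>c. h ` c) (cycles f A) (cycles f' A')"
proof (rule bij_betw_imageI)
  have sub: "c \<subseteq> A" if "c \<in> cycles f A" for c using that orbit_subset_dom[OF assms(2)] by (auto simp: cycles_def)
  then show "inj_on (\<lambda>c. h ` c) (cycles f A)"
    using inj_on_image_eq_iff[OF bij_betw_imp_inj_on[OF assms(1)]] by (auto simp: inj_on_def)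
  have orb: "h ` orbit f d = orbit f' (h d)" if "d \<in> A" for d
    using perm_on_mem[OF assms(2)] assms(3) that by (intro orbit_conj[where D = A]) auto
  have "(\<lambda>c. h ` c) ` cycles f A = (\<lambda>d. orbit f' (h d)) ` A"
    unfolding cycles_def image_image using orb by (rule image_cong[OF refl])
  also have "\<dots> = cycles f' (h ` A)" by (simp add: cycles_def image_image)
  finally show "(\<lambda>c. h ` c) ` cycles f A = cycles f' A'" using bij_betw_imp_surj_on[OF assms(1)] by simp
qed

text \<open>Cycles are matched through their traces on the selected darts, which are the cycles of
  the return maps. With \<open>rot\<close> this yields the correspondence of vertices, with
  \<open>cw\<close> that of dark faces and faces.\<close>

lemma cycle_transfer:
  assumes "perm_on f D" "A \<subseteq> D" "perm_on f' D'" "A' \<subseteq> D'" "bij_betw h A A'" 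
    "\<And>d. d \<in> A \<Longrightarrow> h (next_in f A d) = next_in f' A' (h d)"
  obtains \<nu> where "bij_betw \<nu> {c \<in> cycles f D. c \<inter> A \<noteq> {}} {c \<in> cycles f' D'. c \<inter> A' \<noteq> {}}"
    "\<And>c. c \<in> cycles f D \<Longrightarrow> c \<inter> A \<noteq> {} \<Longrightarrow> \<nu> c \<inter> A' = h ` (c \<inter> A)"
proof -
  let ?C = "{c \<in> cycles f D. c \<inter> A \<noteq> {}}" and ?C' = "{c \<in> cycles f' D'. c \<inter> A' \<noteq> {}}"
  note n = bij_betw_cycles_next_in[OF assms(1,2)] 
  note n' = bij_betw_cycles_next_in[OF assms(3,4)]
  note k = bij_betw_cycles_image[OF assms(5) next_in_perm[OF assms(1,2)] assms(6)]
  let ?m = "(\<lambda>c. h ` c) \<circ> (\<lambda>c. c \<inter> A)"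
  let ?\<nu> = "inv_into ?C' (\<lambda>c. c \<inter> A') \<circ> ?m"
  have m: "bij_betw ?m ?C (cycles (next_in f' A') A')" using bij_betw_trans[OF n k] .
  have "bij_betw ?\<nu> ?C ?C'" using bij_betw_trans[OF m bij_betw_inv_into[OF n']] .
  moreover have "?\<nu> c \<inter> A' = h ` (c \<inter> A)" if "c \<in> cycles f D" "c \<inter> A \<noteq> {}" for c
    using bij_betw_inv_into_right[OF n', of "?m c"] bij_betwE[OF m] that by auto
  ultimately show thesis by (rule that)
qed

lemma funpow_card_orbit:
  assumes "perm_on f D" "x \<in> D" "0 < n" "(f ^^ n) x = x" "\<And>j. 0 < j \<Longrightarrow> j < n \<Longrightarrow> (f ^^ j) x \<noteq> x"
  shows "card (orbit f x) = n"
proof -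
  have "orbit f x = (\<lambda>k. (f ^^ k) x) ` {..<n}"
  proof (intro equalityI subsetI)
    fix y assume "y \<in> orbit f x"
    then obtain k where "y = (f ^^ k) x" by (auto simp: orbit_eq_funpow)
    then have "y = (f ^^ (k mod n)) x" using funpow_mod_eq[OF assms(4), of k] by simp
    then show "y \<in> (\<lambda>k. (f ^^ k) x) ` {..<n}" using assms(3) by (intro image_eqI[of _ _ "k mod n"]) auto
  qed (use funpow_mem_orbit'[OF assms(1,2)] in auto)
  moreover have "inj_on (\<lambda>k. (f ^^ k) x) {..<n}"
  proof (rule inj_onI)
    have "i = j" if "i \<le> j" "j < n" "(f ^^ i) x = (f ^^ j) x" for i j
    proof (rule ccontr)
      assume "i \<noteq> j"
      then have "0 < j - i" "j - i < n" using that by auto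
      moreover have "x = (f ^^ (j - i)) x" using funpow_eq_diff[OF assms(1,2,2) that(3,1)] .
      ultimately show False using assms(5) by metis
    qed
    then show "i = j" if "i \<in> {..<n}" "j \<in> {..<n}" "(f ^^ i) x = (f ^^ j) x" for i j
      using that by (metis lessThan_iff nat_le_linear)
  qed
  ultimately show ?thesis by (simp add: card_image)
qed

lemma
  assumes "perm_on f D" "x \<in> D"
  shows card_orbit_pos: "0 < card (orbit f x)" and funpow_card: "(f ^^ card (orbit f x)) x = x"
    and funpow_less_card: "\<And>j. 0 < j \<Longrightarrow> j < card (orbit f x) \<Longrightarrow> (f ^^ j) x \<noteq> x"
proof -
  have "orbit f x \<inter> {x} \<noteq> {}" using self_mem_orbit[OF assms] by blast
  then obtain n where n: "0 < n" "(f ^^ n) x \<in> {x}" "\<And>j. 0 < j \<Longrightarrow> j < n \<Longrightarrow> (f ^^ j) x \<notin> {x}"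
    by (rule next_in_obtain_orbit) (rule that; assumption)
  then have "card (orbit f x) = n" by (intro funpow_card_orbit[OF assms]) auto
  then show "0 < card (orbit f x)" "(f ^^ card (orbit f x)) x = x" 
    "\<And>j. 0 < j \<Longrightarrow> j < card (orbit f x) \<Longrightarrow> (f ^^ j) x \<noteq> x" using n by auto
qed

section \<open>Cyclic types as the rotations of one reading\<close>

definition reading :: "('d, 'l, 'z) lmap_scheme \<Rightarrow> 'd \<Rightarrow> 'l list" where
  "reading M d = map (\<lambda>k. lab M ((cw M ^^ k) d)) [0..<card (orbit (cw M) d)]"

context half_map
begin

lemma cw_type_reading: "f \<in> faces M \<Longrightarrow> cw_type M f = reading M ` f"
  unfolding cw_type_def using faceE(1) by (intro image_cong refl) (simp add: reading_def)

lemma rotate_reading: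
  assumes d: "d \<in> darts M"
  shows "rotate n (reading M d) = reading M ((cw M ^^ n) d)"
proof (rule nth_equalityI)
  have "(cw M ^^ n) d \<in> orbit (cw M) d" using funpow_mem_orbit'[OF perm_cw d] .
  then have c: "card (orbit (cw M) ((cw M ^^ n) d)) = card (orbit (cw M) d)"
    using orbit_eq_on[OF perm_cw d] by simp
  then show "length (rotate n (reading M d)) = length (reading M ((cw M ^^ n) d))" by (simp add: reading_def)
  fix i assume "i < length (rotate n (reading M d))"
  then have i: "i < card (orbit (cw M) d)" by (simp add: reading_def)
  have "(n + i) mod card (orbit (cw M) d) < card (orbit (cw M) d)" using i by simp
  then show "rotate n (reading M d) ! i = reading M ((cw M ^^ n) d) ! i"
    using i c funpow_mod_eq[OF funpow_card[OF perm_cw d], of "n + i"]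
    by (simp add: reading_def nth_rotate funpow_add_apply add.commute)
qed

lemma cw_type_rotate:
  assumes "f \<in> faces M" "d \<in> f"
  shows "cw_type M f = {rotate n (reading M d) | n. True}"
proof -
  have d: "f = orbit (cw M) d" "d \<in> darts M" using faceE[OF assms] by auto
  have "f = {(cw M ^^ n) d | n. True}" 
    using funpow_mem_orbit'[OF perm_cw d(2)] unfolding d(1) by (auto simp: orbit_eq_funpow)
  then show ?thesis unfolding cw_type_reading[OF assms(1)] rotate_reading[OF d(2)] by auto
qed

end

lemma map_upto: "map (\<lambda>j. a + int j) [0..<n] = [a..a + int n - 1]"
  by (rule nth_equalityI) auto

section \<open>The type of a face of a suitably labelled map\<close>

context suit_map
begin

text \<open>The descent from \<open>i\<close> and the ascents that follow, up to the label
  \<open>j\<close> of the next descending dart, excluded, form the block that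
  \<open>lower_completion_list\<close> produces for consecutive elements \<open>i\<close> and
  \<open>j\<close>.\<close>

lemma run_reading:
  assumes e: "e \<in> A"
  defines "i \<equiv> lab B e" and "j \<equiv> lab B (fnext B A e)"
  shows "map (\<lambda>k. lab B ((cw B ^^ k) e)) [0..<run e] = i # (if j \<ge> i then [i - 1..j - 1] else [])"
proof -
  obtain m where m: "run e = Suc m" using run_pos[OF e] by (cases "run e") auto
  have r: "[0..<run e] = 0 # map Suc [0..<run e - 1]" 
    unfolding m by (simp add: upt_conv_Cons map_Suc_upt del: upt_Suc)
  have "map (\<lambda>k. lab B ((cw B ^^ Suc k) e)) [0..<run e - 1] = map (\<lambda>k. (i - 1) + int k) [0..<run e - 1]"
    using lab_run[OF e] by (intro map_cong refl) (simp add: i_def del: funpow.simps)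
  also have "\<dots> = [i - 1..j - 1]" 
    unfolding map_upto using run_lab[OF e] run_pos[OF e] by (simp add: i_def j_def of_nat_diff)
  \<comment> \<open>For \<open>j < i\<close> the interval is empty by itself.\<close>
  also have "\<dots> = (if j \<ge> i then [i - 1..j - 1] else [])"
    using luk[OF e] run_lab[OF e] by (auto simp: i_def j_def)
  finally show ?thesis unfolding r by (simp add: i_def comp_def del: funpow.simps)
qed

text \<open>Position on the contour of the \<open>k\<close>-th descending dart after
  \<open>e\<close> (\<open>cw_run_sum\<close>).\<close>

definition run_sum :: "'d \<Rightarrow> nat \<Rightarrow> nat" where
  "run_sum e k = (\<Sum>i<k. run ((fnext B A ^^ i) e))"

lemma fnext_pow_mem: "e \<in> A \<Longrightarrow> (fnext B A ^^ k) e \<in> A"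
  using funpow_mem[OF perm_fnext] .

lemma cw_run_sum: "e \<in> A \<Longrightarrow> (cw B ^^ run_sum e k) e = (fnext B A ^^ k) e"
proof (induction k)
  case (Suc k)
  have "run_sum e (Suc k) = run ((fnext B A ^^ k) e) + run_sum e k" by (simp add: run_sum_def)
  then show ?case using Suc cw_run[OF fnext_pow_mem[OF Suc.prems, of k]] by (simp add: funpow_add)
qed (simp add: run_sum_def)

lemma run_sum_reading: 
  "e \<in> A \<Longrightarrow> map (\<lambda>m. lab B ((cw B ^^ m) e)) [0..<run_sum e n] = 
    concat (map (\<lambda>k. map (\<lambda>j. lab B ((cw B ^^ j) ((fnext B A ^^ k) e))) [0..<run ((fnext B A ^^ k) e)]) [0..<n])"
proof (induction n)
  case (Suc n)
  let ?T = "run_sum e n" and ?r = "run ((fnext B A ^^ n) e)"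
  have "[0..<run_sum e (Suc n)] = [0..<?T] @ map (\<lambda>j. j + ?T) [0..<?r]"
  proof -
    have "run_sum e (Suc n) = ?T + ?r" by (simp add: run_sum_def)
    then show ?thesis using upt_add_eq_append[of 0 ?T ?r] map_add_upt[of ?T ?r] 
      by (simp only: le0 add.commute[of ?r])
  qed
  moreover have "(cw B ^^ (j + ?T)) e = (cw B ^^ j) ((fnext B A ^^ n) e)" for j
    by (simp add: funpow_add cw_run_sum[OF Suc.prems])
  ultimately show ?case using Suc by (simp add: comp_def)
qed (simp add: run_sum_def)

lemma run_sum_split: "m < run_sum e n \<Longrightarrow> \<exists>k<n. \<exists>j<run ((fnext B A ^^ k) e). m = run_sum e k + j"
proof (induction n)
  case (Suc n)
  show ?case
  proof (cases "m < run_sum e n")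
    case True
    then show ?thesis using Suc.IH less_Suc_eq by blast
  next
    case False
    then have "m - run_sum e n < run ((fnext B A ^^ n) e)" using Suc.prems by (simp add: run_sum_def)
    then show ?thesis using False by (intro exI[of _ n] conjI exI[of _ "m - run_sum e n"]) auto
  qed
qed (simp add: run_sum_def)

text \<open>After leaving \<open>e\<close> and before all runs are completed, the contour is at a
  non-descending dart or at the start of a run other than the first, so it has not returned to
  \<open>e\<close>.\<close>

lemma card_face:
  assumes e: "e \<in> A"
  shows "card (orbit (cw B) e) = run_sum e (card (orbit (fnext B A) e))"
proof -
  let ?n = "card (orbit (fnext B A) e)"
  note n = card_orbit_pos[OF perm_fnext e] funpow_card[OF perm_fnext e] funpow_less_card[OF perm_fnext e]
  show ?thesis
  proof (rule funpow_card_orbit[OF perm_cw darts_mem[OF e]])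
    have "run e \<le> run_sum e ?n" 
      using n(1) member_le_sum[of 0 "{..<?n}" "\<lambda>i. run ((fnext B A ^^ i) e)"] by (simp add: run_sum_def)
    then show "0 < run_sum e ?n" using run_pos[OF e] by simp
    show "(cw B ^^ run_sum e ?n) e = e" using cw_run_sum[OF e] n(2) by simp
    fix m assume m: "0 < m" "m < run_sum e ?n"
    then obtain k j where kj: "k < ?n" "j < run ((fnext B A ^^ k) e)" "m = run_sum e k + j" 
      using run_sum_split by blast
    have c: "(cw B ^^ m) e = (cw B ^^ j) ((fnext B A ^^ k) e)"
      unfolding kj(3) by (simp add: add.commute[of _ j] funpow_add cw_run_sum[OF e])
    show "(cw B ^^ m) e \<noteq> e"
    proof (cases "j = 0")
      case True
      then have "0 < k" using m(1) kj(3) by (cases k) (auto simp: run_sum_def)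
      then show ?thesis using c True n(3) kj(1) by simp
    next
      case False
      then have "(cw B ^^ m) e \<notin> A" using c run_asc[OF fnext_pow_mem[OF e] _ kj(2)] by simp
      then show ?thesis using e by metis
    qed
  qed
qed

lemma reading_eq:
  assumes e: "e \<in> A"
  shows "reading B e = lower_completion_list (map (\<lambda>k. lab B ((fnext B A ^^ k) e)) [0..<card (orbit (fnext B A) e)])"
proof -
  let ?n = "card (orbit (fnext B A) e)"
  let ?xs = "map (\<lambda>k. lab B ((fnext B A ^^ k) e)) [0..<?n]"
  have x: "?xs ! (Suc k mod length ?xs) = lab B (fnext B A ((fnext B A ^^ k) e))" if "k < ?n" for k
    using funpow_mod_eq[OF funpow_card[OF perm_fnext e], of "Suc k"] card_orbit_pos[OF perm_fnext e] by simp
  have "reading B e = concat (map (\<lambda>k. map (\<lambda>j. lab B ((cw B ^^ j) ((fnext B A ^^ k) e))) [0..<run ((fnext B A ^^ k) e)]) [0..<?n])"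
    unfolding reading_def card_face[OF e] run_sum_reading[OF e] ..
  also have "\<dots> = lower_completion_list ?xs"
    unfolding lower_completion_list_def Let_def run_reading[OF fnext_pow_mem[OF e]]
    using x by (intro arg_cong[of _ _ concat] map_cong) (simp_all del: funpow.simps)
  finally show ?thesis .
qed

end

context alt_map
begin

lemma cw_pow_fnext: "d \<in> A \<Longrightarrow> (cw M ^^ k) d = (fnext M A ^^ k) d"
  using funpow_cong_on[OF perm_fnext, of "cw M" d k] fnext_eq by simp

lemma orbit_cw_fnext: "d \<in> A \<Longrightarrow> orbit (cw M) d = orbit (fnext M A) d"
  using orbit_cong_on[OF perm_fnext, of "cw M" d] fnext_eq by simp

end

section \<open>A map and a hypermap with the same reduced data\<close>

locale half_corr = B: suit_map B + H: well_hmap H for B :: nmap and H :: nhmap +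
  fixes h
  assumes iso: "half_iso h H (dark_darts H) B (descending B)"
begin

lemma h: "bij_betw h H.A B.A" "d \<in> H.A \<Longrightarrow> h d \<in> B.A" 
  "d \<in> H.A \<Longrightarrow> h (vnext H H.A d) = vnext B B.A (h d)"
  "d \<in> H.A \<Longrightarrow> h (fnext H H.A d) = fnext B B.A (h d)"
  "d \<in> H.A \<Longrightarrow> lab B (h d) = lab H d"
  using iso bij_betwE[of h H.A B.A] by (auto simp: half_iso_def)

lemma h_surj: "e \<in> B.A \<Longrightarrow> \<exists>d\<in>H.A. e = h d"
  using h(1) by (auto simp: bij_betw_def)

lemma h_inj: "d \<in> H.A \<Longrightarrow> d' \<in> H.A \<Longrightarrow> h d = h d' \<Longrightarrow> d = d'"
  using h(1) by (auto simp: bij_betw_def dest: inj_onD)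

lemma h_lnext: "d \<in> H.A \<Longrightarrow> h (lnext H H.A d) = lnext B B.A (h d)"
  using half_iso_lnext[OF H.half_map_axioms B.half_map_axioms iso] .

text \<open>A dark dart \<open>d\<close> ends at the origin of \<open>fnext H H.A d\<close>, since
  \<open>fnext\<close> is one step of \<open>cw\<close>. In this form the condition speaks of
  selected darts and their labels, which \<open>h\<close> transports.\<close>

lemma right_local_max_iff:
  assumes v: "v \<in> vertices H"
  shows "right_local_max H v \<longleftrightarrow> (\<forall>d\<in>H.A. fnext H H.A d \<in> v \<longrightarrow> lab H d \<le> lab H (fnext H H.A d))"
proof -
  have iff: "opp H d \<in> v \<longleftrightarrow> fnext H H.A d \<in> v" if d: "d \<in> H.A" for d
  proof -
    have o: "opp H d \<in> darts H" using H.opp(1)[OF H.darts_mem[OF d]] .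
    have r: "rot H (opp H d) = fnext H H.A d" using H.fnext_eq[OF d] by (simp add: cw_def)
    have "v = orbit (rot H) (opp H d)" if "fnext H H.A d \<in> v"
      using H.vertexE(1)[OF v that] orbit_step_on[OF H.perm_rot o] r by simp
    then show ?thesis using H.vertexE(1)[OF v, of "opp H d"] orbit.base[of "rot H" "opp H d"] r 
        H.vertex_of(2)[OF o] by metis
  qed
  have "right_local_max H v \<longleftrightarrow> (\<forall>d\<in>H.A. opp H d \<in> v \<longrightarrow> lab H d \<le> vlab H v)"
  proof
    assume *: "right_local_max H v"
    show "\<forall>d\<in>H.A. opp H d \<in> v \<longrightarrow> lab H d \<le> vlab H v"
    proof (intro ballI impI)
      fix d assume d: "d \<in> H.A" "opp H d \<in> v"
      note u = H.vertex_of[OF H.darts_mem[OF d(1)]]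
      have "right_neighbour H v (orbit (rot H) d)"
        unfolding right_neighbour_def using u d by (auto simp: dark_darts_def)
      then show "lab H d \<le> vlab H v" using * H.vlab_vertex[OF u] unfolding right_local_max_def by auto
    qed
  next
    assume *: "\<forall>d\<in>H.A. opp H d \<in> v \<longrightarrow> lab H d \<le> vlab H v"
    show "right_local_max H v" unfolding right_local_max_def
    proof (intro allI impI)
      fix u assume "right_neighbour H v u"
      then obtain d where d: "u \<in> vertices H" "d \<in> u" "opp H d \<in> v" "right_face H d \<in> dark H" 
        by (auto simp: right_neighbour_def)
      then have "d \<in> H.A" using H.vertexE(2)[OF d(1,2)] by (simp add: dark_darts_def)
      then show "vlab H u \<le> vlab H v" using * d H.vlab_vertex[OF d(1,2)] by simp
    qed
  qed
  also have "\<dots> \<longleftrightarrow> (\<forall>d\<in>H.A. fnext H H.A d \<in> v \<longrightarrow> lab H d \<le> lab H (fnext H H.A d))"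
    using iff H.vlab_vertex[OF v] by (intro ball_cong refl) auto
  finally show ?thesis .
qed

text \<open>The dart just before \<open>fnext B B.A d\<close> in the rotation is the reversed last
  dart of the run of \<open>d\<close>. It descends exactly if the run has more than one dart, that
  is, if the label does not drop. So the condition says that descending darts at \<open>v\<close>
  are preceded by descending ones; as there is one, all are.\<close>

lemma local_max_iff_fnext:
  assumes v: "v \<in> vertices B" "v \<inter> B.A \<noteq> {}"
  shows "local_max B v \<longleftrightarrow> (\<forall>d\<in>B.A. fnext B B.A d \<in> v \<longrightarrow> lab B d \<le> lab B (fnext B B.A d))"
proof -
  have prev: "\<exists>x. rot B x = fnext B B.A d \<and> x \<in> darts B \<and> (x \<in> B.A \<longleftrightarrow> lab B d \<le> lab B (fnext B B.A d))" 
    if d: "d \<in> B.A" for d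
  proof (intro exI conjI)
    let ?z = "(cw B ^^ (B.run d - 1)) d"
    have z: "?z \<in> darts B" using B.cw_pow_mem[OF d] .
    show "opp B ?z \<in> darts B" using B.opp(1)[OF z] .
    show "rot B (opp B ?z) = fnext B B.A d" 
      using B.cw_pow_Suc[OF d, of "B.run d - 1"] B.run_pos[OF d] B.cw_run[OF d] by simp
    have "opp B ?z \<in> B.A \<longleftrightarrow> 1 < B.run d"
    proof (cases "B.run d = 1")
      case True
      then show ?thesis using B.opp_notin[OF d] by simp
    next
      case False
      then show ?thesis using B.run_opp(1)[OF d, of "B.run d - 1"] B.run_pos[OF d] by simp
    qed
    then show "opp B ?z \<in> B.A \<longleftrightarrow> lab B d \<le> lab B (fnext B B.A d)" using B.run_lab[OF d] by auto
  qed
  have "v \<subseteq> B.A \<longleftrightarrow> (\<forall>d\<in>B.A. fnext B B.A d \<in> v \<longrightarrow> lab B d \<le> lab B (fnext B B.A d))"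
  proof (intro iffI ballI impI)
    fix d assume vA: "v \<subseteq> B.A" and d: "d \<in> B.A" "fnext B B.A d \<in> v"
    obtain x where x: "rot B x = fnext B B.A d" "x \<in> darts B" 
        "x \<in> B.A \<longleftrightarrow> lab B d \<le> lab B (fnext B B.A d)" using prev[OF d(1)] by blast
    have "v = orbit (rot B) x" using B.vertexE(1)[OF v(1) d(2)] orbit_step_on[OF B.perm_rot x(2)] x(1) by simp
    then have "x \<in> v" using B.vertex_of(2)[OF x(2)] by simp
    then show "lab B d \<le> lab B (fnext B B.A d)" using vA x(3) by blast
  next
    assume *: "\<forall>d\<in>B.A. fnext B B.A d \<in> v \<longrightarrow> lab B d \<le> lab B (fnext B B.A d)"
    obtain e where e: "e \<in> v" "e \<in> B.A" using v(2) by blast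
    note eD = B.darts_mem[OF e(2)]
    have ve: "v = orbit (rot B) e" using B.vertexE(1)[OF v(1) e(1)] .
    have closed: "inv_into (darts B) (rot B) z \<in> B.A" if z: "z \<in> B.A" "z \<in> v" for z
    proof -
      obtain d where d: "d \<in> B.A" "z = fnext B B.A d" using perm_on_surj[OF B.perm_fnext z(1)] by blast
      obtain x where x: "rot B x = z" "x \<in> darts B" 
        "x \<in> B.A \<longleftrightarrow> lab B d \<le> lab B (fnext B B.A d)" using prev[OF d(1)] d(2) by blast
      have "x \<in> B.A" using * d z(2) x(3) by blast
      then show ?thesis using inv_into_left[OF B.perm_rot x(2)] x(1) by simp
    qed
    show "v \<subseteq> B.A"
    proof
      fix y assume "y \<in> v"
      then have "y \<in> orbit (inv_into (darts B) (rot B)) e" using ve orbit_inv_into[OF B.perm_rot eD] by simp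
      then have "y \<in> orbit (inv_into (darts B) (rot B)) e \<and> y \<in> B.A"
      proof (rule orbit_induct_on[OF inv_into_perm[OF B.perm_rot] eD])
        show "e \<in> orbit (inv_into (darts B) (rot B)) e \<and> e \<in> B.A"
          using self_mem_orbit[OF inv_into_perm[OF B.perm_rot] eD] e(2) by blast
        fix z assume "z \<in> orbit (inv_into (darts B) (rot B)) e \<and> z \<in> B.A"
        then show "inv_into (darts B) (rot B) z \<in> orbit (inv_into (darts B) (rot B)) e 
            \<and> inv_into (darts B) (rot B) z \<in> B.A"
          using closed[of z] orbit_inv_into[OF B.perm_rot eD] ve by (blast intro: orbit.step)
      qed
      then show "y \<in> B.A" by blast
    qed
  qed
  then show ?thesis using B.local_max_iff[OF v(1)] by simp
qed

lemma vertex_bij: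
  obtains \<nu> where "bij_betw \<nu> (vertices H) {v' \<in> vertices B. \<not> local_min B v'}"
    "\<And>v d. v \<in> vertices H \<Longrightarrow> d \<in> v \<Longrightarrow> d \<in> H.A \<Longrightarrow> h d \<in> \<nu> v"
    "\<And>v. v \<in> vertices H \<Longrightarrow> vlab B (\<nu> v) = vlab H v"
    "\<And>v. v \<in> vertices H \<Longrightarrow> right_local_max H v \<longleftrightarrow> local_max B (\<nu> v)"
proof -
  obtain \<nu> where \<nu>: "bij_betw \<nu> {c \<in> cycles (rot H) (darts H). c \<inter> H.A \<noteq> {}} {c \<in> cycles (rot B) (darts B). c \<inter> B.A \<noteq> {}}"
    "\<And>c. c \<in> cycles (rot H) (darts H) \<Longrightarrow> c \<inter> H.A \<noteq> {} \<Longrightarrow> \<nu> c \<inter> B.A = h ` (c \<inter> H.A)"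
    using cycle_transfer[OF H.perm_rot H.sub B.perm_rot B.sub h(1)] h(3)[unfolded vnext_def] by blast
  have VH: "{c \<in> cycles (rot H) (darts H). c \<inter> H.A \<noteq> {}} = vertices H"
    using H.vertices_meet by (auto simp: H.vertices_eq)
  have VB: "{c \<in> cycles (rot B) (darts B). c \<inter> B.A \<noteq> {}} = {v' \<in> vertices B. \<not> local_min B v'}"
    using B.local_min_iff by (auto simp: B.vertices_eq)
  have bij: "bij_betw \<nu> (vertices H) {v' \<in> vertices B. \<not> local_min B v'}" using \<nu>(1) unfolding VH VB .
  have img: "\<nu> v \<inter> B.A = h ` (v \<inter> H.A)" if "v \<in> vertices H" for v
    using \<nu>(2) H.vertices_meet[OF that] that by (simp add: H.vertices_eq)
  have mem: "h d \<in> \<nu> v" if "v \<in> vertices H" "d \<in> v" "d \<in> H.A" for v d using img[OF that(1)] that by blast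
  have vB: "\<nu> v \<in> vertices B" "\<nu> v \<inter> B.A \<noteq> {}" if "v \<in> vertices H" for v
    using bij_betwE[OF bij] that img[OF that] H.vertices_meet[OF that] by auto
  show thesis
  proof (rule that[OF bij mem])
    fix v assume v: "v \<in> vertices H"
    obtain d where d: "d \<in> v" "d \<in> H.A" using H.vertices_meet[OF v] by blast
    show "vlab B (\<nu> v) = vlab H v"
      using B.vlab_vertex[OF vB(1)[OF v] mem[OF v d]] H.vlab_vertex[OF v d(1)] h(5)[OF d(2)] by simp
    have iff: "h e \<in> \<nu> v \<longleftrightarrow> e \<in> v" if e: "e \<in> H.A" for e
    proof
      assume "h e \<in> \<nu> v"
      then have "h e \<in> h ` (v \<inter> H.A)" using img[OF v] h(2)[OF e] by blast
      then show "e \<in> v" using h_inj[OF e] by blast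
    qed (use mem[OF v] e in blast)
    have "right_local_max H v \<longleftrightarrow> (\<forall>d\<in>H.A. fnext H H.A d \<in> v \<longrightarrow> lab H d \<le> lab H (fnext H H.A d))"
      by (rule right_local_max_iff[OF v])
    also have "\<dots> \<longleftrightarrow> (\<forall>d\<in>H.A. fnext B B.A (h d) \<in> \<nu> v \<longrightarrow> lab B (h d) \<le> lab B (fnext B B.A (h d)))"
      using iff[OF H.fnext_mem] h(4,5) h(5)[OF H.fnext_mem] by (intro ball_cong refl) metis
    also have "\<dots> \<longleftrightarrow> (\<forall>d\<in>B.A. fnext B B.A d \<in> \<nu> v \<longrightarrow> lab B d \<le> lab B (fnext B B.A d))"
      using h_surj h(2) by blast
    also have "\<dots> \<longleftrightarrow> local_max B (\<nu> v)" using local_max_iff_fnext[OF vB[OF v]] by simp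
    finally show "right_local_max H v \<longleftrightarrow> local_max B (\<nu> v)" .
  qed
qed

lemma dark_face_bij:
  obtains \<delta> where "bij_betw \<delta> (dark H) (faces B)"
    "\<And>f d. f \<in> dark H \<Longrightarrow> d \<in> f \<Longrightarrow> h d \<in> \<delta> f"
    "\<And>f. f \<in> dark H \<Longrightarrow> cw_type B (\<delta> f) = lower_completion (cw_type H f)"
proof -
  obtain \<delta> where \<delta>: "bij_betw \<delta> {c \<in> cycles (cw H) (darts H). c \<inter> H.A \<noteq> {}} {c \<in> cycles (cw B) (darts B). c \<inter> B.A \<noteq> {}}"
    "\<And>c. c \<in> cycles (cw H) (darts H) \<Longrightarrow> c \<inter> H.A \<noteq> {} \<Longrightarrow> \<delta> c \<inter> B.A = h ` (c \<inter> H.A)"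
    using cycle_transfer[OF H.perm_cw H.sub B.perm_cw B.sub h(1)] h(4)[unfolded fnext_def] by blast
  have FH: "{c \<in> cycles (cw H) (darts H). c \<inter> H.A \<noteq> {}} = dark H"
    using H.dark_iff by (auto simp: H.faces_eq)
  have FB: "{c \<in> cycles (cw B) (darts B). c \<inter> B.A \<noteq> {}} = faces B"
    using B.face_meets by (auto simp: B.faces_eq cycles_def)
  have bij: "bij_betw \<delta> (dark H) (faces B)" using \<delta>(1) unfolding FH FB .
  have dA: "f \<in> faces H" "f \<subseteq> H.A" "f \<inter> H.A \<noteq> {}" if "f \<in> dark H" for f 
    using that H.dark_iff H.face_subset by auto
  have mem: "h d \<in> \<delta> f" if "f \<in> dark H" "d \<in> f" for f d
    using \<delta>(2)[of f] dA[OF that(1)] that(2) by (auto simp: H.faces_eq)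
  show thesis
  proof (rule that[OF bij mem])
    fix f assume f: "f \<in> dark H"
    have lcl: "lower_completion_list (reading H d) = reading B (h d)" if "d \<in> f" for d
    proof -
      have d: "d \<in> H.A" using dA(2)[OF f] that by blast
      have *: "h ((fnext H H.A ^^ k) d) = (fnext B B.A ^^ k) (h d)" "(fnext H H.A ^^ k) d \<in> H.A" for k
        using h(4) H.fnext_mem d by (induction k) auto
      have "h ` orbit (fnext H H.A) d = orbit (fnext B B.A) (h d)"
        using h(4) H.fnext_mem d by (intro orbit_conj[where D = H.A]) auto
      then have c: "card (orbit (fnext B B.A) (h d)) = card (orbit (cw H) d)"
        using card_image[of h "orbit (fnext H H.A) d"] orbit_subset_dom[OF H.perm_fnext d] 
          bij_betw_imp_inj_on[OF h(1)] H.orbit_cw_fnext[OF d] by (metis inj_on_subset)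
      have "reading H d = map (\<lambda>k. lab B ((fnext B B.A ^^ k) (h d))) [0..<card (orbit (fnext B B.A) (h d))]"
        unfolding reading_def c using H.cw_pow_fnext[OF d] h(5)[OF *(2)] *(1) by simp
      then show ?thesis using B.reading_eq[OF h(2)[OF d]] by simp
    qed
    have type_eq: "cw_type B (\<delta> f) = {rotate n (lower_completion_list (reading H d)) | n. True}" if "d \<in> f" for d
      using B.cw_type_rotate[OF _ mem[OF f that]] bij_betwE[OF bij] f lcl[OF that] by auto
    obtain d0 where "d0 \<in> f" using dA(3)[OF f] by blast
    then show "cw_type B (\<delta> f) = lower_completion (cw_type H f)"
      using type_eq unfolding lower_completion_def H.cw_type_reading[OF dA(1)[OF f]] by blast
  qed
qed

text \<open>A light face is a reversed cycle of \<open>lnext\<close>; \<open>h\<close> carries this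
  cycle to one in \<open>B\<close>, whose elements share a root. The composite is bijective because
  roots separate the cycles.\<close>

lemma light_face_bij:
  obtains \<mu> where "bij_betw \<mu> (light_faces H) {w \<in> vertices B. local_min B w}"
    "\<And>f e. f \<in> light_faces H \<Longrightarrow> e \<in> \<mu> f \<Longrightarrow> \<exists>d\<in>H.A. h d = opp B e \<and> opp H d \<in> f"
    "\<And>f. f \<in> light_faces H \<Longrightarrow> vlab B (\<mu> f) = face_min H f - 1"
proof -
  let ?C = "cycles (lnext H H.A) H.A" and ?C' = "cycles (lnext B B.A) B.A"
  let ?r = "\<lambda>c. B.root (SOME e. e \<in> c)"
  have r: "?r c = B.root e" if c: "c \<in> ?C'" "e \<in> c" for c e
  proof -
    have s: "(SOME e. e \<in> c) \<in> c" using c(2) by (rule someI)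
    have c': "c = orbit (lnext B B.A) e" using cycles_eq_orbit[OF B.perm_lnext c] .
    have "c \<subseteq> B.A" using c(1) orbit_subset_dom[OF B.perm_lnext] by (auto simp: cycles_def)
    then have "e \<in> B.A" using c(2) by blast
    then show ?thesis using B.root_orbit[of e] s c' by simp
  qed
  have bij_r: "bij_betw ?r ?C' B.minima"
  proof (rule bij_betw_imageI)
    have orb: "?r (orbit (lnext B B.A) e) = B.root e" if "e \<in> B.A" for e
      using that self_mem_orbit[OF B.perm_lnext that] by (intro r) (auto simp: cycles_def)
    show "?r ` ?C' = B.minima" 
      unfolding cycles_def B.card_cycles_lnext_ge(1)[symmetric] image_image using orb by (rule image_cong[OF refl])
    then show "inj_on ?r ?C'"
      using B.card_cycles_sum(2) eq_card_imp_inj_on[OF finite_cycles[OF B.perm_lnext], of ?r] by simp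
  qed
  note bij_h = bij_betw_cycles_image[OF h(1) H.perm_lnext h_lnext]
  have light: "{f \<in> faces H. f \<inter> H.A = {}} = light_faces H" using H.light_iff by blast
  note bij_o = H.light_faces_bij[unfolded light]
  have min: "B.minima = {w \<in> vertices B. local_min B w}" using B.local_min_iff by (auto simp: B.minima_def)
  let ?i = "inv_into ?C (\<lambda>c. opp H ` c)"
  define \<mu> where "\<mu> f = ?r (h ` ?i f)" for f
  have "bij_betw (?r \<circ> ((\<lambda>c. h ` c) \<circ> ?i)) (light_faces H) B.minima"
    using bij_betw_trans[OF bij_betw_trans[OF bij_betw_inv_into[OF bij_o] bij_h] bij_r] .
  moreover have "?r \<circ> ((\<lambda>c. h ` c) \<circ> ?i) = \<mu>" by (simp add: fun_eq_iff \<mu>_def)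
  ultimately have bij: "bij_betw \<mu> (light_faces H) {w \<in> vertices B. local_min B w}" unfolding min by simp
  have cyc: "\<exists>c\<in>?C. f = opp H ` c \<and> h ` c \<in> ?C' \<and> (\<forall>d\<in>c. \<mu> f = B.root (h d)) \<and> c \<subseteq> H.A \<and> c \<noteq> {}" 
    if f: "f \<in> light_faces H" for f
  proof (intro bexI conjI ballI)
    show i: "?i f \<in> ?C" using bij_betwE[OF bij_betw_inv_into[OF bij_o]] f by blast
    show "f = opp H ` ?i f" using bij_betw_inv_into_right[OF bij_o f] by simp
    show hc: "h ` ?i f \<in> ?C'" using bij_betwE[OF bij_h] i by blast
    show "\<mu> f = B.root (h d)" if "d \<in> ?i f" for d using r[OF hc, of "h d"] that by (simp add: \<mu>_def)
    show "?i f \<subseteq> H.A" using i orbit_subset_dom[OF H.perm_lnext] by (auto simp: cycles_def)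
    obtain d where "?i f = orbit (lnext H H.A) d" using i by (auto simp: cycles_def)
    then show "?i f \<noteq> {}" using orbit.base[of "lnext H H.A" d] by blast
  qed
  have nbr: "\<exists>d\<in>c. h d = opp B e" 
    if c: "f \<in> light_faces H" "h ` c \<in> ?C'" "\<forall>d\<in>c. \<mu> f = B.root (h d)" "c \<subseteq> H.A" "c \<noteq> {}" and e: "e \<in> \<mu> f" for f c e
  proof -
    obtain d0 where d0: "d0 \<in> c" using c(5) by blast
    have v: "\<mu> f \<in> vertices B" "\<mu> f \<inter> B.A = {}" using bij_betwE[OF bij] c(1) B.local_min_iff by auto
    have eD: "e \<in> darts B" using B.vertexE(2)[OF v(1) e] .
    have o: "opp B e \<in> B.A" using B.opp_in[OF eD] e v(2) by blast
    have "B.root (opp B e) = \<mu> f" using B.root_opp[OF eD] B.root_local_min[OF v e] by simp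
    also have "\<dots> = B.root (h d0)" using c(3) d0 by blast
    finally have "opp B e \<in> orbit (lnext B B.A) (h d0)" using B.root_eq_orbit[OF o h(2)] c(4) d0 by blast
    also have "\<dots> = h ` c" using cycles_eq_orbit[OF B.perm_lnext c(2), of "h d0"] d0 by simp
    finally show ?thesis by force
  qed
  show thesis
  proof (rule that[OF bij])
    fix f e assume f: "f \<in> light_faces H" and e: "e \<in> \<mu> f"
    obtain c where c: "c \<in> ?C" "f = opp H ` c" "h ` c \<in> ?C'" "\<forall>d\<in>c. \<mu> f = B.root (h d)" "c \<subseteq> H.A" "c \<noteq> {}"
      using cyc[OF f] by blast
    then show "\<exists>d\<in>H.A. h d = opp B e \<and> opp H d \<in> f" using nbr[OF f c(3-6) e] by blast
  next
    fix f assume f: "f \<in> light_faces H"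
    obtain c where c: "c \<in> ?C" "f = opp H ` c" "h ` c \<in> ?C'" "\<forall>d\<in>c. \<mu> f = B.root (h d)" "c \<subseteq> H.A" "c \<noteq> {}"
      using cyc[OF f] by blast
    have lab: "lab H (opp H d) = lab H (lnext H H.A d)" if "d \<in> c" for d
    proof -
      have d: "d \<in> H.A" using c(5) that by blast
      then have "lab H (opp H d) = lab H (cw H d)" 
        using H.lab_rot[OF H.opp(1)[OF H.darts_mem]] by (simp add: cw_def)
      then show ?thesis using H.fnext_eq[OF d] H.lab_lnext[OF d] by simp
    qed
    \<comment> \<open>The origin of \<open>opp H d\<close> has the label of
      \<open>lnext H H.A d\<close>, so the labels on \<open>f\<close> are those of the cycle
      \<open>c\<close>, shifted by one step.\<close>
    have img: "lnext H H.A ` c = c"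
    proof -
      obtain d where d: "d \<in> H.A" "c = orbit (lnext H H.A) d" using c(1) by (auto simp: cycles_def)
      have "lnext H H.A ` c \<subseteq> c" unfolding d(2) by (auto intro: orbit.step)
      moreover have "finite c" using c(5) H.finA finite_subset by blast
      moreover have "inj_on (lnext H H.A) c" using perm_on_inj[OF H.perm_lnext] c(5) inj_on_subset by blast
      ultimately show ?thesis by (simp add: endo_inj_surj)
    qed
    have "lab H ` f = lab H ` (lnext H H.A ` c)" unfolding c(2) image_image using lab by (rule image_cong[OF refl])
    then have f': "lab H ` f = (\<lambda>d. lab B (h d)) ` c" using img h(5) c(5) by (auto intro!: image_cong)
    have v: "\<mu> f \<in> vertices B" "\<mu> f \<inter> B.A = {}" using bij_betwE[OF bij] f B.local_min_iff by auto
    \<comment> \<open>Every element of the cycle lies strictly above its root, and the darts that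
      descend straight into the root belong to the cycle and attain the minimum.\<close>
    have "Min (lab H ` f) = vlab B (\<mu> f) + 1"
    proof (rule Min_eqI)
      show "finite (lab H ` f)" unfolding f' using c(5) H.finA finite_subset by blast
      fix y assume "y \<in> lab H ` f"
      then obtain d where d: "d \<in> c" "y = lab B (h d)" unfolding f' by blast
      have hd: "h d \<in> B.A" using h(2) c(5) d(1) by blast
      then have "h d \<notin> \<mu> f" using v(2) by blast
      then have "vlab B (\<mu> f) < lab B (h d)" using B.root_vertex(4)[OF B.darts_mem[OF hd]] c(4) d(1) by simp
      then show "vlab B (\<mu> f) + 1 \<le> y" using d(2) by simp
    next
      obtain x where "x \<in> darts B" "\<mu> f = orbit (rot B) x" using v(1) by (auto simp: vertices_def)
      then obtain e where e: "e \<in> \<mu> f" using B.vertex_of(2) by blast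
      then obtain d where d: "d \<in> c" "h d = opp B e" using nbr[OF f c(3-6)] by blast
      have "lab B (opp B e) = lab B e + 1" using B.lab_opp' B.vertexE(2)[OF v(1) e] e v(2) by blast
      then have "lab B (h d) = vlab B (\<mu> f) + 1" using d(2) B.vlab_vertex[OF v(1) e] by simp
      then show "vlab B (\<mu> f) + 1 \<in> lab H ` f" unfolding f' using d(1) by (metis image_eqI)
    qed
    then show "vlab B (\<mu> f) = face_min H f - 1" by (simp add: face_min_def)
  qed
qed

end

theorem theorem1:
  shows
    "(\<forall>B :: nmap. suitably_labelled B \<longrightarrow>
        (\<exists>H :: nhmap. well_labelled H \<and> lmap_isomorphic (star_rep H) (Phi_figure B))) \<and>
     bij_betw Phi suit_maps well_hmaps \<and>
     (\<forall>X\<in>suit_maps. Psi (Phi X) = X) \<and>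
     (\<forall>Y\<in>well_hmaps. Phi (Psi Y) = Y) \<and>
     (\<forall>(B :: nmap) (H :: nhmap) g.
        suitably_labelled B \<and> well_labelled H \<and> lmap_iso g (star_rep H) (Phi_figure B) \<longrightarrow>
        (\<exists>\<nu>. bij_betw \<nu> (vertices H) {v' \<in> vertices B. \<not> local_min B v'} \<and>
             (\<forall>v\<in>vertices H.
                vertex_corr g H v (\<nu> v) \<and>
                vlab B (\<nu> v) = vlab H v \<and>
                (right_local_max H v \<longleftrightarrow> local_max B (\<nu> v)))) \<and>
        (\<exists>\<mu>. bij_betw \<mu> (light_faces H) {w \<in> vertices B. local_min B w} \<and>
             (\<forall>f\<in>light_faces H.
                light_face_corr g H B f (\<mu> f) \<and>
                vlab B (\<mu> f) = face_min H f - 1)) \<and>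
        (\<exists>\<delta>. bij_betw \<delta> (dark H) (faces B) \<and>
             (\<forall>f\<in>dark H.
                dark_face_corr g H f (\<delta> f) \<and>
                cw_type B (\<delta> f) = lower_completion (cw_type H f))))"
proof (intro conjI allI impI)
  fix B :: nmap assume B: "suitably_labelled B"
  then show "\<exists>H :: nhmap. well_labelled H \<and> lmap_isomorphic (star_rep H) (Phi_figure B)"
    using corr_hyper[OF B] corr_iff[OF B] by blast
next
  show "bij_betw Phi suit_maps well_hmaps" "\<forall>X\<in>suit_maps. Psi (Phi X) = X" "\<forall>Y\<in>well_hmaps. Phi (Psi Y) = Y"
    by (fact Phi_Psi_bij)+
next
  fix B :: nmap and H :: nhmap and g
  assume *: "suitably_labelled B \<and> well_labelled H \<and> lmap_iso g (star_rep H) (Phi_figure B)"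
  then have BH: "suitably_labelled B" "well_labelled H" and g: "lmap_iso g (star_rep H) (Phi_figure B)" by auto
  obtain h where iso: "half_iso h H (dark_darts H) B (descending B)" 
    and gW: "\<And>d. d \<in> dark_darts H \<Longrightarrow> g (White d) = White (h d)" 
    and gB: "\<And>d. d \<in> dark_darts H \<Longrightarrow> g (Black d) = Black (h d)"
    by (rule star_figure_isoE[OF well_half_map[OF BH(2)] suit_half_map[OF BH(1)] 
          g[unfolded star_rep_eq Phi_figure_eq]]) (rule that; assumption)
  interpret half_corr B H h by unfold_locales (use BH iso in auto)
  have darts: "White d \<in> darts (star_rep H) \<longleftrightarrow> d \<in> H.A" "Black d \<in> darts (star_rep H) \<longleftrightarrow> d \<in> H.A" for d
    unfolding star_rep_eq H.darts_star_figure by auto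
  show "\<exists>\<nu>. bij_betw \<nu> (vertices H) {v' \<in> vertices B. \<not> local_min B v'} \<and>
             (\<forall>v\<in>vertices H.
                vertex_corr g H v (\<nu> v) \<and>
                vlab B (\<nu> v) = vlab H v \<and>
                (right_local_max H v \<longleftrightarrow> local_max B (\<nu> v)))"
  proof -
    obtain \<nu> where \<nu>: "bij_betw \<nu> (vertices H) {v' \<in> vertices B. \<not> local_min B v'}"
      "\<And>v d. v \<in> vertices H \<Longrightarrow> d \<in> v \<Longrightarrow> d \<in> H.A \<Longrightarrow> h d \<in> \<nu> v"
      "\<And>v. v \<in> vertices H \<Longrightarrow> vlab B (\<nu> v) = vlab H v"
      "\<And>v. v \<in> vertices H \<Longrightarrow> right_local_max H v \<longleftrightarrow> local_max B (\<nu> v)"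
      using vertex_bij by blast
    have "vertex_corr g H v (\<nu> v)" if v: "v \<in> vertices H" for v
    proof -
      obtain d where "d \<in> v" "d \<in> H.A" using H.vertices_meet[OF v] by blast
      then show ?thesis unfolding vertex_corr_def darts using \<nu>(2)[OF v] gW by blast
    qed
    then show ?thesis using \<nu> by blast
  qed
  show "\<exists>\<mu>. bij_betw \<mu> (light_faces H) {w \<in> vertices B. local_min B w} \<and>
             (\<forall>f\<in>light_faces H.
                light_face_corr g H B f (\<mu> f) \<and>
                vlab B (\<mu> f) = face_min H f - 1)"
  proof -
    obtain \<mu> where \<mu>: "bij_betw \<mu> (light_faces H) {w \<in> vertices B. local_min B w}"
      "\<And>f e. f \<in> light_faces H \<Longrightarrow> e \<in> \<mu> f \<Longrightarrow> \<exists>d\<in>H.A. h d = opp B e \<and> opp H d \<in> f"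
      "\<And>f. f \<in> light_faces H \<Longrightarrow> vlab B (\<mu> f) = face_min H f - 1"
      using light_face_bij by blast
    have "light_face_corr g H B f (\<mu> f)" if f: "f \<in> light_faces H" for f
      unfolding light_face_corr_def darts using \<mu>(2)[OF f] gW by metis
    then show ?thesis using \<mu>(1,3) by blast
  qed
  show "\<exists>\<delta>. bij_betw \<delta> (dark H) (faces B) \<and>
             (\<forall>f\<in>dark H.
                dark_face_corr g H f (\<delta> f) \<and>
                cw_type B (\<delta> f) = lower_completion (cw_type H f))"
  proof -
    obtain \<delta> where \<delta>: "bij_betw \<delta> (dark H) (faces B)"
      "\<And>f d. f \<in> dark H \<Longrightarrow> d \<in> f \<Longrightarrow> h d \<in> \<delta> f"
      "\<And>f. f \<in> dark H \<Longrightarrow> cw_type B (\<delta> f) = lower_completion (cw_type H f)"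
      using dark_face_bij by blast
    have "dark_face_corr g H f (\<delta> f)" if f: "f \<in> dark H" for f
    proof -
      obtain d where d: "d \<in> f" "d \<in> H.A" using H.dark_iff f by blast
      then show ?thesis unfolding dark_face_corr_def darts using \<delta>(2)[OF f] gB by blast
    qed
    then show ?thesis using \<delta>(1,3) by blast
  qed
qed

end
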